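(* Let $\{a_n\}_{n=1}^\infty$ (with $a_n>0$) and $\{b_n\}_{n=1}^\infty$ (with $b_n\in\mathbb{R}$) be Jacobi parameters that obey $$\sum_{n=1}^\infty n\,(|a_n-1|+|b_n|)<\infty .$$ Let $\{P_n\}_{n=0}^\infty$ be the monic orthogonal polynomials and let $\{E_j\}_{j=1}^{J}$ ($J<\infty$) be the mass points of the associated measure which lie outside $[-2,2]$. Then for $n$ sufficiently large, $P_n(x)$ has precisely $J$ zeros outside $[-2,2]$ and the other $n-J$ zeros in $[-2,2]$. Define $0<\theta_1^{(n)}<\cdots<\theta_{n-J}^{(n)}<\pi$ so that the zeros of $P_n(x)$ on $[-2,2]$ are exactly at $\{2\cos(\theta_\ell^{(n)})\}_{\ell=1}^{n-J}$. Then $$\sup_{j=1,\dots,n-J-1}\, n\left|\theta_{j+1}^{(n)}-\theta_j^{(n)}-\frac{2\pi}{2n}\right|\to 0\quad\text{as } n\to\infty.$$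
   Context: The Jacobi parameters $\{a_n,b_n\}_{n\ge1}$ of a probability measure on $\mathbb{R}$ with bounded infinite support are defined by the recursion for its monic orthogonal polynomials $xP_n(x)=P_{n+1}(x)+b_{n+1}P_n(x)+a_n^2P_{n-1}(x)$, with $P_0(x)=1$ and $P_{-1}(x)=0$. Bounded Jacobi parameters determine the measure uniquely (it is the spectral measure, for the vector $\delta_1$, of the corresponding Jacobi matrix). *)

theory Defs
  imports "HOL-Probability.Probability" "HOL-Computational_Algebra.Polynomial"
begin

definition measure_support :: "real measure \<Rightarrow> real set" where
  "measure_support \<mu> = {x. \<forall>U. open U \<and> x \<in> U \<longrightarrow> emeasure \<mu> U > 0}"

definition monic_orthogonal_polys :: "real measure \<Rightarrow> (nat \<Rightarrow> real poly) \<Rightarrow> bool" where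
  "monic_orthogonal_polys \<mu> P \<longleftrightarrow>
     (\<forall>n. degree (P n) = n \<and> lead_coeff (P n) = 1) \<and>
     (\<forall>m n. m \<noteq> n \<longrightarrow> (\<integral>x. poly (P m) x * poly (P n) x \<partial>\<mu>) = 0)"

text \<open>
  The recursion x P_n = P_(n+1) + b_(n+1) P_n + a_n^2 P_(n-1) with P_(-1) = 0.
  The parameters are indexed from 1; the values \<open>a 0\<close> and \<open>b 0\<close> play no role.
  Since the recursion only sees the squares of the \<open>a n\<close>, positivity is part of the definition.
\<close>

definition jacobi_parameters ::
    "(nat \<Rightarrow> real poly) \<Rightarrow> (nat \<Rightarrow> real) \<Rightarrow> (nat \<Rightarrow> real) \<Rightarrow> bool" where
  "jacobi_parameters P a b \<longleftrightarrow>
     (\<forall>n\<ge>1. a n > 0) \<and>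
     (\<forall>n. [:0, 1:] * P n =
        P (Suc n) + smult (b (Suc n)) (P n) +
        (if n = 0 then 0 else smult ((a n)\<^sup>2) (P (n - 1))))"

definition exterior_mass_points :: "real measure \<Rightarrow> real set" where
  "exterior_mass_points \<mu> = {E. E \<notin> {-2..2} \<and> measure \<mu> {E} > 0}"

text \<open>
  \<open>zero_angles p m \<theta>\<close>: the zeros of \<open>p\<close> on [-2,2] are exactly the points
  \<open>2 * cos (\<theta> l)\<close>, \<open>l = 1, \<dots>, m\<close>, where 0 < \<open>\<theta> 1\<close> < ... < \<open>\<theta> m\<close> < \<open>pi\<close>.
  Values of \<open>\<theta>\<close> outside {1..m} are irrelevant.
\<close>

definition zero_angles :: "real poly \<Rightarrow> nat \<Rightarrow> (nat \<Rightarrow> real) \<Rightarrow> bool" where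
  "zero_angles p m \<theta> \<longleftrightarrow>
     strict_mono_on {1..m} \<theta> \<and>
     \<theta> ` {1..m} \<subseteq> {0<..<pi} \<and>
     (\<lambda>l. 2 * cos (\<theta> l)) ` {1..m} = {x \<in> {-2..2}. poly p x = 0}"

end

theory Submission
  imports Defs "HOL-Computational_Algebra.Fundamental_Theorem_Algebra"
begin

text \<open>
  Let \<open>p n\<close> be the orthonormal polynomials. Everything rests on comparing solutions of the
  three-term recursion by means of the Christoffel-Darboux formula.

  Outside \<open>[-2,2]\<close> the coefficients are close to constant, so a solution either eventually grows or
  decays exponentially, and \<open>E\<close> is a mass point iff \<open>p n E\<close> is square summable. For large \<open>n\<close>, each
  such \<open>E\<close> has exactly one zero of \<open>p n\<close> next to it, and there are no other zeros outside \<open>[-2,2]\<close>.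

  Inside, write \<open>x = 2 cos t\<close> and \<open>X = exp (\<i>t) p n - p (n - 1)\<close>, so that \<open>sin t * p n = Im X\<close>. The
  argument of \<open>exp (- \<i>nt) X\<close> converges as \<open>n\<close> grows, uniformly on compact subsets of \<open>(0,pi)\<close>. Near
  \<open>t = 0\<close> the first-moment condition still gives a uniform limit as long as \<open>n t\<close> stays away from 0
  (two cases, depending on whether \<open>p n 2\<close> grows linearly or not); \<open>t = pi\<close> follows by reflection.
  Hence this argument is nearly constant on intervals of length \<open>O(1/n)\<close>, and zeros
  \<open>t < t'\<close> that are consecutive satisfy \<open>n (t' - t) = k pi + o(1)\<close> with \<open>k = 0\<close> or \<open>k = 1\<close>.
  The value \<open>k = 0\<close> is impossible: at a zero \<open>X = - p (n - 1)\<close>, which changes sign from one zero to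
  the next.
\<close>

section \<open>Christoffel-Darboux formula and reality of the zeros\<close>

text \<open>The obstacle is the edge. One step of the recursion may turn the phase by a multiple of
  \<open>e n / sin t\<close>, so interior estimates degenerate as t tends to 0, while zeros do have
  angles of order 1/n. The first moment closes this gap: it makes m times the sum of
  \<open>e k\<close> over k \<ge> m small, so the phase is almost frozen from an index m with m t of
  order one onwards, and only the indices up to m need a comparison with the solution at 2. The two
  growth types of that solution lead to different limit directions of \<open>X\<close>, one real and
  one imaginary; for the spacing it matters only that there is a limit. Directions are unit complex
  numbers, obtained by \<open>sgn\<close>, so that no branch of the argument has to be chosen.
  Outside \<open>[-2,2]\<close> the count is squeezed: a compactness argument bounds the number of
  zeros from above, and each eigenvalue traps a zero on its inner side. That there are only finitely
  many exterior mass points comes out of the same squeeze.\<close>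

lemma christoffel_darboux:
  fixes u v A B :: "nat \<Rightarrow> 'a::comm_ring"
  assumes u: "\<And>n. x * u n = A (Suc n) * u (Suc n) + B (Suc n) * u n
                + (if n = 0 then 0 else A n * u (n - 1))"
    and v: "\<And>n. y * v n = A (Suc n) * v (Suc n) + B (Suc n) * v n
                + (if n = 0 then 0 else A n * v (n - 1))"
  shows "(x - y) * (\<Sum>k\<le>n. u k * v k) = A (Suc n) * (u (Suc n) * v n - u n * v (Suc n))"
proof -
  have *: "(x - y) * (u n * v n) = (x * u n) * v n - u n * (y * v n)" for n
    by (simp add: algebra_simps)
  show ?thesis
  proof (induction n)
    case 0
    show ?case
      using *[of 0] by (simp add: u v) (simp add: algebra_simps)
  next
    case (Suc n)
    show ?case
      using *[of "Suc n"] Suc.IH by (simp add: u v distrib_left) (simp add: algebra_simps)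
  qed
qed

text \<open>The recursion and the decay are all that is assumed, without a measure. The coefficients
  \<open>- b\<close> then give a second instance, through which every result at 2 is transferred to
  -2.\<close>

locale jacobi_polys =
  fixes p :: "nat \<Rightarrow> real poly" and a b :: "nat \<Rightarrow> real"
  assumes p_0: "p 0 = 1"
    and p_rec: "\<And>n. [:0, 1:] * p n = smult (a (Suc n)) (p (Suc n)) + smult (b (Suc n)) (p n)
                  + (if n = 0 then 0 else smult (a n) (p (n - 1)))"
    and a_pos: "\<And>n. n \<ge> 1 \<Longrightarrow> a n > 0"
    and decay: "summable (\<lambda>n. real n * (\<bar>a n - 1\<bar> + \<bar>b n\<bar>))"
begin

definition q :: "real \<Rightarrow> nat \<Rightarrow> real" where "q x n = poly (p n) x"

lemma q_0 [simp]: "q x 0 = 1"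
  by (simp add: q_def p_0)

lemma q_rec: "x * q x n = a (Suc n) * q x (Suc n) + b (Suc n) * q x n
                + (if n = 0 then 0 else a n * q x (n - 1))"
  using arg_cong[OF p_rec[of n], of "\<lambda>r. poly r x"] by (cases n) (auto simp: q_def)

lemma q_step:
  assumes "n \<ge> 1"
  shows "a (Suc n) * q x (Suc n) = (x - b (Suc n)) * q x n - a n * q x (n - 1)"
  using q_rec[of x n] assms by (simp add: algebra_simps)

lemma isCont_q [continuous_intros]: "isCont (\<lambda>x. q x n) x"
  by (simp add: q_def)

lemma continuous_on_q [continuous_intros]:
  "continuous_on A f \<Longrightarrow> continuous_on A (\<lambda>x. q (f x) n)"
  unfolding q_def by (intro continuous_intros)

lemma q_CD: "(x - y) * (\<Sum>k\<le>n. q x k * q y k) = a (Suc n) * (q x (Suc n) * q y n - q x n * q y (Suc n))"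
  by (rule christoffel_darboux[OF q_rec q_rec])

lemma sum_q_square_pos: "(\<Sum>k\<le>n. q x k * q x k) > 0"
proof -
  have "(\<Sum>k\<le>n. q x k * q x k) \<ge> (\<Sum>k\<in>{0}. q x k * q x k)"
    by (rule sum_mono2) auto
  then show ?thesis by simp
qed

lemma q_consecutive_nonzero:
  assumes "q x n = 0" shows "q x (Suc n) \<noteq> 0"
proof
  assume *: "q x (Suc n) = 0"
  have "q x n = 0 \<and> q x (Suc n) = 0 \<Longrightarrow> False"
  proof (induction n)
    case (Suc n)
    have "a (Suc n) * q x n = 0"
      using q_rec[of x "Suc n"] Suc.prems by simp
    with a_pos[of "Suc n"] Suc show False by simp
  qed simp
  with * assms show False by simp
qed

lemma degree_p: "degree (p n) = n"
  and lead_coeff_p: "lead_coeff (p n) \<noteq> 0"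
proof -
  have "degree (p n) = n \<and> degree (p (Suc n)) = Suc n \<and> p n \<noteq> 0 \<and> p (Suc n) \<noteq> 0"
  proof (induction n)
    case 0
    have e: "[:0, 1:] = smult (a (Suc 0)) (p (Suc 0)) + [:b (Suc 0):]"
      using p_rec[of 0] p_0 by simp
    have "smult (a (Suc 0)) (p (Suc 0)) = [:0, 1:] - [:b (Suc 0):]"
      unfolding e by simp
    then have "degree (smult (a (Suc 0)) (p (Suc 0))) = 1" by simp
    then have "degree (p (Suc 0)) = 1" using a_pos[of "Suc 0"] by simp
    then show ?case using p_0 by auto
  next
    case (Suc n)
    have "smult (a (Suc (Suc n))) (p (Suc (Suc n)))
        = [:0, 1:] * p (Suc n) - (smult (b (Suc (Suc n))) (p (Suc n)) + smult (a (Suc n)) (p n))"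
      using p_rec[of "Suc n"] by (simp add: algebra_simps)
    moreover have "degree ([:0, 1:] * p (Suc n)
        + (- (smult (b (Suc (Suc n))) (p (Suc n)) + smult (a (Suc n)) (p n)))) = Suc (Suc n)"
    proof (subst degree_add_eq_left)
      have "degree ([:0, 1:] * p (Suc n)) = Suc (Suc n)"
        using Suc by (subst degree_mult_eq) auto
      moreover have "degree (- (smult (b (Suc (Suc n))) (p (Suc n)) + smult (a (Suc n)) (p n))) \<le> Suc n"
        unfolding degree_minus using Suc by (intro degree_add_le) auto
      ultimately show "degree (- (smult (b (Suc (Suc n))) (p (Suc n)) + smult (a (Suc n)) (p n)))
          < degree ([:0, 1:] * p (Suc n))" "degree ([:0, 1:] * p (Suc n)) = Suc (Suc n)"
        by auto
    qed
    ultimately have "degree (smult (a (Suc (Suc n))) (p (Suc (Suc n)))) = Suc (Suc n)"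
      by (simp only: diff_conv_add_uminus)
    then have "degree (p (Suc (Suc n))) = Suc (Suc n)" using a_pos[of "Suc (Suc n)"] by simp
    then show ?case using Suc by auto
  qed
  then show "degree (p n) = n" "lead_coeff (p n) \<noteq> 0"
    using leading_coeff_neq_0 by blast+
qed

lemma finite_zeros: "finite {x. q x n = 0}"
  unfolding q_def using lead_coeff_p[of n] by (intro poly_roots_finite) auto

text \<open>For the pair \<open>z\<close>, \<open>cnj z\<close> the right-hand side of
  Christoffel-Darboux vanishes at a zero, while the sum on the left consists of squared moduli and
  contains the term 1; hence \<open>z = cnj z\<close>.\<close>

lemma complex_root_real:
  fixes z :: complex
  assumes "poly (map_poly of_real (p n)) z = 0"
  shows "z \<in> \<real>"
proof -
  define Q where "Q w k = poly (map_poly of_real (p k)) w" for w :: complex and k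
  have Q_rec: "w * Q w k = of_real (a (Suc k)) * Q w (Suc k) + of_real (b (Suc k)) * Q w k
                + (if k = 0 then 0 else of_real (a k) * Q w (k - 1))" for w k
  proof -
    have add: "map_poly (of_real :: real \<Rightarrow> complex) (r + s) = map_poly of_real r + map_poly of_real s" for r s
      by (rule poly_eqI) (simp add: coeff_map_poly)
    have sm: "map_poly (of_real :: real \<Rightarrow> complex) (smult c r) = smult (of_real c) (map_poly of_real r)" for c r
      by (rule poly_eqI) (simp add: coeff_map_poly)
    show ?thesis
      using arg_cong[OF p_rec[of k], of "\<lambda>r. poly (map_poly of_real r) w"]
      by (cases k) (auto simp: Q_def map_poly_pCons add sm)
  qed
  have cnj: "Q (cnj w) k = cnj (Q w k)" for w k
    unfolding Q_def by (rule poly_cnj_real[symmetric]) (simp add: coeff_map_poly)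
  show ?thesis
  proof (cases n)
    case 0
    then show ?thesis using assms by (simp add: p_0)
  next
    case (Suc m)
    have "(z - cnj z) * (\<Sum>k\<le>m. Q z k * Q (cnj z) k)
        = of_real (a (Suc m)) * (Q z (Suc m) * Q (cnj z) m - Q z m * Q (cnj z) (Suc m))"
      by (rule christoffel_darboux[OF Q_rec Q_rec])
    moreover have "Q z (Suc m) = 0" using assms Suc by (simp add: Q_def)
    ultimately have "(z - cnj z) * (\<Sum>k\<le>m. Q z k * Q (cnj z) k) = 0"
      by (simp add: cnj)
    moreover have "(\<Sum>k\<le>m. Q z k * Q (cnj z) k) = of_real (\<Sum>k\<le>m. (cmod (Q z k))\<^sup>2)"
      by (simp add: cnj flip: complex_norm_square)
    moreover have "(\<Sum>k\<le>m. (cmod (Q z k))\<^sup>2) \<ge> (\<Sum>k\<in>{0}. (cmod (Q z k))\<^sup>2)"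
      by (rule sum_mono2) auto
    then have "(\<Sum>k\<le>m. (cmod (Q z k))\<^sup>2) > 0" by (simp add: Q_def p_0)
    ultimately have "z - cnj z = 0"
      by (metis less_irrefl mult_eq_0_iff of_real_eq_0_iff)
    then have "z = cnj z" by simp
    then show ?thesis by (simp add: Reals_cnj_iff)
  qed
qed

text \<open>At a zero \<open>x\<close>, Christoffel-Darboux factors a multiple of \<open>p n\<close>
  by the linear factor of \<open>x\<close>. The derivative at \<open>x\<close> is the cofactor
  there, a positive sum of squares.\<close>

lemma simple_root:
  assumes "q x n = 0"
  shows "poly (pderiv (p n)) x \<noteq> 0"
proof (cases n)
  case 0
  with assms show ?thesis by simp
next
  case (Suc m)
  have eq: "smult (a n * q x m) (p n) = [:- x, 1:] * (\<Sum>k\<le>m. smult (q x k) (p k))"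
  proof (subst poly_eq_poly_eq_iff[symmetric], rule ext)
    fix y
    show "poly (smult (a n * q x m) (p n)) y = poly ([:- x, 1:] * (\<Sum>k\<le>m. smult (q x k) (p k))) y"
      using q_CD[of y x m] assms Suc
      by (simp add: poly_sum q_def algebra_simps sum_distrib_left)
  qed
  have "poly (pderiv (smult (a n * q x m) (p n))) x = (\<Sum>k\<le>m. q x k * q x k)"
    unfolding eq pderiv_mult by (simp add: pderiv_pCons poly_sum q_def del: mult_pCons_left)
  then show ?thesis using sum_q_square_pos[of x m] by (auto simp: pderiv_smult)
qed

text \<open>A squarefree complex polynomial has as many roots as its degree; since all roots are
  real and simple, the count holds on the real line.\<close>

lemma card_zeros: "card {x. q x n = 0} = n"
proof -
  let ?c = "map_poly (of_real :: real \<Rightarrow> complex) (p n)"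
  have nz: "?c \<noteq> 0" using lead_coeff_p[of n] by (auto simp: poly_eq_iff coeff_map_poly)
  have ev: "poly (map_poly (of_real :: real \<Rightarrow> complex) r) (of_real x) = of_real (poly r x)" for r x
    by (induction r) (auto simp: map_poly_pCons)
  have pd: "pderiv ?c = map_poly of_real (pderiv (p n))"
    by (rule poly_eqI) (simp add: coeff_pderiv coeff_map_poly)
  have roots: "{z. poly ?c z = 0} = of_real ` {x. q x n = 0}"
  proof (intro equalityI subsetI)
    fix z assume z: "z \<in> {z. poly ?c z = 0}"
    then obtain x where "z = of_real x" using complex_root_real[of n z] by (blast elim: Reals_cases)
    then show "z \<in> of_real ` {x. q x n = 0}" using z by (simp add: ev q_def)
  qed (auto simp: ev q_def)
  have "rsquarefree ?c"
    unfolding rsquarefree_roots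
  proof (intro allI notI)
    fix z assume z: "poly ?c z = 0 \<and> poly (pderiv ?c) z = 0"
    then obtain x where "z = of_real x" using complex_root_real[of n z] by (blast elim: Reals_cases)
    then show False using z simple_root[of x n] by (simp add: pd ev q_def)
  qed
  then have "degree (smult (lead_coeff ?c) (\<Prod>z|poly ?c z = 0. [:- z, 1:])) = degree ?c"
    by (simp only: complex_poly_decompose_rsquarefree)
  then have "card {z. poly ?c z = 0} = degree ?c"
    using nz by (simp add: degree_prod_eq_sum_degree)
  also have "degree ?c = n" by (simp add: degree_map_poly degree_p)
  finally show ?thesis unfolding roots by (simp add: card_image inj_on_def)
qed

end

section \<open>Solutions outside the essential spectrum\<close>

context jacobi_polys
begin

lemma
  shows a_tendsto: "a \<longlonglongrightarrow> 1" and b_tendsto: "b \<longlonglongrightarrow> 0"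
proof -
  have lim: "(\<lambda>n. real n * (\<bar>a n - 1\<bar> + \<bar>b n\<bar>)) \<longlonglongrightarrow> 0"
    using decay by (rule summable_LIMSEQ_zero)
  have le: "\<bar>a n - 1\<bar> + \<bar>b n\<bar> \<le> real n * (\<bar>a n - 1\<bar> + \<bar>b n\<bar>)" if "n \<ge> 1" for n
    using that mult_right_mono[of 1 "real n" "\<bar>a n - 1\<bar> + \<bar>b n\<bar>"] by simp
  have "(\<lambda>n. a n - 1) \<longlonglongrightarrow> 0" "b \<longlonglongrightarrow> 0"
    using le by (force intro!: Lim_null_comparison[OF _ lim] eventually_sequentiallyI[of 1])+
  then show "a \<longlonglongrightarrow> 1" "b \<longlonglongrightarrow> 0" by (simp_all add: LIM_zero_iff)
qed

text \<open>Beyond 2 by a fixed margin the diagonal term dominates both neighbours: growth, once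
  started, reproduces itself without a sign change, and its absence forces geometric decay.
  \<open>N\<close> and \<open>\<kappa>\<close> depend on \<open>\<eta>\<close> only, which gives
  uniformity in \<open>x\<close>.\<close>

lemma exterior_dichotomy:
  assumes "\<eta> > 0"
  obtains N \<kappa> where "N \<ge> 1" "0 < \<kappa>" "\<kappa> < 1"
    "\<And>x n. x \<ge> 2 + \<eta> \<Longrightarrow> n \<ge> N \<Longrightarrow> q x n \<noteq> 0 \<Longrightarrow>
       \<bar>q x (n - 1)\<bar> \<le> \<bar>q x n\<bar> \<or> q x (n - 1) * q x n \<le> 0 \<Longrightarrow>
       q x (Suc n) * q x n > 0 \<and> \<bar>q x n\<bar> < \<bar>q x (Suc n)\<bar>"
    "\<And>x n. x \<ge> 2 + \<eta> \<Longrightarrow> n \<ge> N \<Longrightarrow> \<bar>q x (Suc n)\<bar> \<le> \<bar>q x n\<bar> \<Longrightarrow>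
       \<bar>q x n\<bar> \<le> \<kappa> * \<bar>q x (n - 1)\<bar>"
proof -
  \<comment> \<open>\<open>x - b\<close> is at least 2 + 3d and \<open>a\<close> at most 1 + d, so
    absorbing one neighbour leaves 1 + 2d against 1 + d; the quotient of these is
    \<open>\<kappa>\<close>.\<close>
  define d where "d = \<eta> / 4"
  have d: "d > 0" and e: "\<eta> = 4 * d" using assms by (auto simp: d_def)
  have "eventually (\<lambda>n. \<bar>a n - 1\<bar> < d) sequentially"
    using tendstoD[OF a_tendsto d] by (simp add: dist_real_def)
  moreover have "eventually (\<lambda>n. \<bar>b n\<bar> < d) sequentially"
    using tendstoD[OF b_tendsto d] by (simp add: dist_real_def)
  ultimately have "eventually (\<lambda>n. \<bar>a n - 1\<bar> < d \<and> \<bar>b n\<bar> < d) sequentially"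
    by eventually_elim simp
  then obtain N0 where N0: "\<And>n. n \<ge> N0 \<Longrightarrow> \<bar>a n - 1\<bar> < d \<and> \<bar>b n\<bar> < d"
    by (auto simp: eventually_sequentially)
  define N where "N = Suc N0"
  define \<kappa> where "\<kappa> = (1 + d) / (1 + 2 * d)"
  have \<kappa>: "0 < \<kappa>" "\<kappa> < 1" using d by (auto simp: \<kappa>_def)
  show thesis
  proof (rule that[of N \<kappa>])
    show "N \<ge> 1" by (simp add: N_def)
    show "0 < \<kappa>" "\<kappa> < 1" by fact+
  next
    fix x n
    assume x: "x \<ge> 2 + \<eta>" and n: "n \<ge> N" and nz: "q x n \<noteq> 0"
      and grow: "\<bar>q x (n - 1)\<bar> \<le> \<bar>q x n\<bar> \<or> q x (n - 1) * q x n \<le> 0"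
    have n1: "n \<ge> 1" using n by (simp add: N_def)
    have bd: "\<bar>a n - 1\<bar> < d" "\<bar>a (Suc n) - 1\<bar> < d" "\<bar>b (Suc n)\<bar> < d"
      using N0[of n] N0[of "Suc n"] n by (auto simp: N_def)
    have an: "a n > 0" "a (Suc n) > 0" using a_pos n1 by auto
    let ?u = "q x n" and ?v = "q x (n - 1)" and ?w = "q x (Suc n)"
    have "a (Suc n) * (?w * ?u) = ((x - b (Suc n)) * ?u - a n * ?v) * ?u"
      unfolding q_step[OF n1, symmetric] by (simp only: mult.assoc)
    then have "a (Suc n) * (?w * ?u) = (x - b (Suc n)) * ?u\<^sup>2 - a n * (?v * ?u)"
      by (simp add: left_diff_distrib power2_eq_square mult.assoc)
    moreover have "(x - b (Suc n)) * ?u\<^sup>2 \<ge> (2 + 3 * d) * ?u\<^sup>2"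
      using bd x e by (intro mult_right_mono) auto
    moreover have "a n * (?v * ?u) \<le> (1 + d) * ?u\<^sup>2"
      using grow
    proof
      assume "\<bar>?v\<bar> \<le> \<bar>?u\<bar>"
      then have "\<bar>?v\<bar> * \<bar>?u\<bar> \<le> \<bar>?u\<bar> * \<bar>?u\<bar>" by (rule mult_right_mono) simp
      then have "?v * ?u \<le> ?u\<^sup>2"
        using abs_ge_self[of "?v * ?u"] by (simp add: abs_mult power2_eq_square)
      then have "a n * (?v * ?u) \<le> a n * ?u\<^sup>2" using an by simp
      also have "\<dots> \<le> (1 + d) * ?u\<^sup>2" using bd by (intro mult_right_mono) auto
      finally show ?thesis .
    next
      assume "?v * ?u \<le> 0"
      then have "a n * (?v * ?u) \<le> 0" using an by (simp add: mult_nonneg_nonpos)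
      also have "0 \<le> (1 + d) * ?u\<^sup>2" using d by simp
      finally show ?thesis .
    qed
    ultimately have main: "a (Suc n) * (?w * ?u) \<ge> (1 + 2 * d) * ?u\<^sup>2"
      by (simp add: algebra_simps)
    have u2: "?u\<^sup>2 > 0" using nz by simp
    then have "(1 + 2 * d) * ?u\<^sup>2 > 0" using d by (intro mult_pos_pos) auto
    with main have "a (Suc n) * (?w * ?u) > 0" by linarith
    then have pos: "?w * ?u > 0" using an by (simp add: zero_less_mult_iff)
    have "(1 + d) * (?w * ?u) \<ge> a (Suc n) * (?w * ?u)"
      using pos bd by (intro mult_right_mono) auto
    moreover have "(1 + d) * ?u\<^sup>2 < (1 + 2 * d) * ?u\<^sup>2" using u2 d by simp
    ultimately have "(1 + d) * ?u\<^sup>2 < (1 + d) * (?w * ?u)" using main by linarith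
    then have "?u\<^sup>2 < ?w * ?u" using d by simp
    also have "?w * ?u = \<bar>?w\<bar> * \<bar>?u\<bar>" using pos by (simp flip: abs_mult)
    finally have "\<bar>?u\<bar> * \<bar>?u\<bar> < \<bar>?w\<bar> * \<bar>?u\<bar>" by (simp add: power2_eq_square)
    then have "\<bar>?u\<bar> < \<bar>?w\<bar>" by (rule mult_right_less_imp_less) simp
    then show "?w * ?u > 0 \<and> \<bar>?u\<bar> < \<bar>?w\<bar>" using pos by simp
  next
    fix x n
    assume x: "x \<ge> 2 + \<eta>" and n: "n \<ge> N" and le: "\<bar>q x (Suc n)\<bar> \<le> \<bar>q x n\<bar>"
    have n1: "n \<ge> 1" using n by (simp add: N_def)
    have bd: "\<bar>a n - 1\<bar> < d" "\<bar>a (Suc n) - 1\<bar> < d" "\<bar>b (Suc n)\<bar> < d"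
      using N0[of n] N0[of "Suc n"] n by (auto simp: N_def)
    let ?u = "q x n" and ?v = "q x (n - 1)" and ?w = "q x (Suc n)"
    have "(x - b (Suc n)) * ?u = a (Suc n) * ?w + a n * ?v"
      using q_step[OF n1, of x] by (simp add: algebra_simps)
    then have "\<bar>x - b (Suc n)\<bar> * \<bar>?u\<bar> \<le> \<bar>a (Suc n)\<bar> * \<bar>?w\<bar> + \<bar>a n\<bar> * \<bar>?v\<bar>"
      by (metis abs_mult abs_triangle_ineq)
    moreover have "\<bar>x - b (Suc n)\<bar> * \<bar>?u\<bar> \<ge> (2 + 3 * d) * \<bar>?u\<bar>"
      using bd x e by (intro mult_right_mono) auto
    moreover have "\<bar>a (Suc n)\<bar> * \<bar>?w\<bar> \<le> (1 + d) * \<bar>?u\<bar>"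
      using bd le by (intro mult_mono) auto
    moreover have "\<bar>a n\<bar> * \<bar>?v\<bar> \<le> (1 + d) * \<bar>?v\<bar>"
      using bd by (intro mult_right_mono) auto
    ultimately have "(1 + 2 * d) * \<bar>?u\<bar> \<le> (1 + d) * \<bar>?v\<bar>" by (simp add: algebra_simps)
    then show "\<bar>?u\<bar> \<le> \<kappa> * \<bar>?v\<bar>" using d by (simp add: \<kappa>_def field_simps)
  qed
qed

text \<open>The one-step conclusion at \<open>k\<close> contains the hypothesis at
  \<open>Suc k\<close>, so a single instance of growth propagates forever.\<close>

lemma exterior_growth_persists:
  assumes N: "\<And>n. n \<ge> N \<Longrightarrow> q x n \<noteq> 0 \<Longrightarrow>
       \<bar>q x (n - 1)\<bar> \<le> \<bar>q x n\<bar> \<or> q x (n - 1) * q x n \<le> 0 \<Longrightarrow>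
       q x (Suc n) * q x n > 0 \<and> \<bar>q x n\<bar> < \<bar>q x (Suc n)\<bar>"
    and n: "n \<ge> N" "q x n \<noteq> 0" "\<bar>q x (n - 1)\<bar> \<le> \<bar>q x n\<bar> \<or> q x (n - 1) * q x n \<le> 0"
    and k: "k \<ge> n"
  shows "q x k * q x n > 0 \<and> \<bar>q x n\<bar> \<le> \<bar>q x k\<bar>"
proof -
  have "q x k * q x n > 0 \<and> \<bar>q x n\<bar> \<le> \<bar>q x k\<bar> \<and> q x (Suc k) * q x k > 0 \<and> \<bar>q x k\<bar> < \<bar>q x (Suc k)\<bar>"
    using k
  proof (induction k rule: dec_induct)
    case base
    then show ?case using N[OF n] n(2) by (auto simp: zero_less_mult_iff)
  next
    case (step k)
    from step have "q x (Suc k) \<noteq> 0" by auto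
    then have *: "q x (Suc (Suc k)) * q x (Suc k) > 0 \<and> \<bar>q x (Suc k)\<bar> < \<bar>q x (Suc (Suc k))\<bar>"
      using N[of "Suc k"] step n by simp
    moreover have "q x (Suc k) * q x n > 0" using step by (auto simp: zero_less_mult_iff)
    ultimately show ?case using step by auto
  qed
  then show ?thesis by simp
qed

text \<open>A sign change triggers growth, and growth preserves the sign, so there is no second
  change. The factor \<open>s\<close> makes the sign before the change positive.\<close>

lemma exterior_sign_flip:
  assumes N: "\<And>n. n \<ge> N \<Longrightarrow> q x n \<noteq> 0 \<Longrightarrow>
       \<bar>q x (n - 1)\<bar> \<le> \<bar>q x n\<bar> \<or> q x (n - 1) * q x n \<le> 0 \<Longrightarrow>
       q x (Suc n) * q x n > 0 \<and> \<bar>q x n\<bar> < \<bar>q x (Suc n)\<bar>"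
    and n: "n \<ge> N" "n \<ge> 1" and s: "s = 1 \<or> s = -1"
    and flip: "s * q x (n - 1) > 0" "s * q x n \<le> 0" and k: "k > n"
  shows "s * q x k < 0"
proof (cases "q x n = 0")
  case True
  \<comment> \<open>At an exact zero the recursion gives the next value the sign opposite to the
    previous one; growth then starts at \<open>Suc n\<close>.\<close>
  have "a (Suc n) * (s * q x (Suc n)) = - (a n * (s * q x (n - 1)))"
    using arg_cong[OF q_step[of n x], of "\<lambda>z. s * z"] n True by (simp add: mult.left_commute)
  then have "a (Suc n) * (s * q x (Suc n)) < 0" using flip a_pos[of n] n by simp
  then have 1: "s * q x (Suc n) < 0" using a_pos[of "Suc n"] by (simp add: mult_less_0_iff)
  then have "q x k * q x (Suc n) > 0"
    using exterior_growth_persists[of N x "Suc n" k, OF N] k n True q_consecutive_nonzero[OF True] by auto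
  with 1 s show ?thesis by (auto simp: zero_less_mult_iff)
next
  case False
  have "(s * q x (n - 1)) * (s * q x n) \<le> 0" using flip by (simp add: mult_nonneg_nonpos)
  then have "q x (n - 1) * q x n \<le> 0" using s by auto
  then have "q x k * q x n > 0"
    using exterior_growth_persists[of N x n k, OF N] k n False by auto
  with s flip show ?thesis by (auto simp: zero_less_mult_iff)
qed

text \<open>The eigenvalues of the Jacobi matrix: \<open>q x\<close> solves the formal eigenvalue
  equation and is an eigenvector when it is square summable. The link to the measure is made only
  with the mass points.\<close>

definition l2_points :: "real set" where "l2_points = {x. summable (\<lambda>n. (q x n)\<^sup>2)}"

lemma l2_points_tendsto:
  assumes "x \<in> l2_points" shows "q x \<longlonglongrightarrow> 0"
proof -
  have "(\<lambda>n. (q x n)\<^sup>2) \<longlonglongrightarrow> 0"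
    by (rule summable_LIMSEQ_zero) (use assms in \<open>simp add: l2_points_def\<close>)
  then show ?thesis by simp
qed

text \<open>Growth or a sign change at any index from \<open>N\<close> on would keep
  \<open>q x\<close> away from 0, contrary to square summability.\<close>

lemma l2_points_decreasing:
  assumes N: "\<And>n. n \<ge> N \<Longrightarrow> q x n \<noteq> 0 \<Longrightarrow>
       \<bar>q x (n - 1)\<bar> \<le> \<bar>q x n\<bar> \<or> q x (n - 1) * q x n \<le> 0 \<Longrightarrow>
       q x (Suc n) * q x n > 0 \<and> \<bar>q x n\<bar> < \<bar>q x (Suc n)\<bar>"
    and "N \<ge> 1" "x \<in> l2_points" "n \<ge> N"
  shows "\<bar>q x n\<bar> < \<bar>q x (n - 1)\<bar>" "q x (n - 1) * q x n > 0"
proof -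
  have not_grow: "\<not> (\<bar>q x (n - 1)\<bar> \<le> \<bar>q x n\<bar> \<or> q x (n - 1) * q x n \<le> 0)"
    if n: "n \<ge> N" "q x n \<noteq> 0" for n
  proof
    assume *: "\<bar>q x (n - 1)\<bar> \<le> \<bar>q x n\<bar> \<or> q x (n - 1) * q x n \<le> 0"
    have "(\<lambda>k. \<bar>q x k\<bar>) \<longlonglongrightarrow> 0" using l2_points_tendsto[OF \<open>x \<in> l2_points\<close>] by (simp add: tendsto_rabs_zero)
    moreover have "\<forall>k\<ge>n. \<bar>q x n\<bar> \<le> \<bar>q x k\<bar>"
      using exterior_growth_persists[OF N n *] by blast
    ultimately have "\<bar>q x n\<bar> \<le> 0" by (intro Lim_bounded2[where N = n]) auto
    with n show False by simp
  qed
  have nz: "q x n \<noteq> 0" if n: "n \<ge> N" for n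
  proof
    assume 0: "q x n = 0"
    then have "q x (Suc n) \<noteq> 0" by (rule q_consecutive_nonzero)
    with not_grow[of "Suc n"] n 0 show False by simp
  qed
  show "\<bar>q x n\<bar> < \<bar>q x (n - 1)\<bar>" "q x (n - 1) * q x n > 0"
    using not_grow[OF \<open>n \<ge> N\<close> nz[OF \<open>n \<ge> N\<close>]] by auto
qed

text \<open>If no step from \<open>N\<close> on grew, each would contract by
  \<open>\<kappa>\<close>, and the ratio test would make the squares summable.\<close>

lemma not_l2_points_growth:
  assumes N: "\<And>n. n \<ge> N \<Longrightarrow> \<bar>q x (Suc n)\<bar> \<le> \<bar>q x n\<bar> \<Longrightarrow> \<bar>q x n\<bar> \<le> \<kappa> * \<bar>q x (n - 1)\<bar>"
    and "0 < \<kappa>" "\<kappa> < 1" "x \<notin> l2_points"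
  obtains n where "n \<ge> N" "\<bar>q x (Suc n)\<bar> > \<bar>q x n\<bar>"
proof (rule ccontr)
  assume "\<not> thesis"
  then have "\<And>n. n \<ge> N \<Longrightarrow> \<bar>q x (Suc n)\<bar> \<le> \<bar>q x n\<bar>" using that not_less by blast
  then have dec: "\<bar>q x n\<bar> \<le> \<kappa> * \<bar>q x (n - 1)\<bar>" if "n \<ge> N" for n using N that by blast
  have "(q x (Suc n))\<^sup>2 \<le> \<kappa>\<^sup>2 * (q x n)\<^sup>2" if "n \<ge> N" for n
  proof -
    have "\<bar>q x (Suc n)\<bar> \<le> \<kappa> * \<bar>q x n\<bar>" using dec[of "Suc n"] that by simp
    then have "\<bar>q x (Suc n)\<bar>\<^sup>2 \<le> (\<kappa> * \<bar>q x n\<bar>)\<^sup>2" by (intro power_mono) auto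
    then show ?thesis by (simp add: power_mult_distrib)
  qed
  moreover have "\<kappa>\<^sup>2 < 1" using assms by (simp add: abs_square_less_1)
  ultimately have "summable (\<lambda>n. (q x n)\<^sup>2)"
    by (intro summable_ratio_test[of "\<kappa>\<^sup>2" N]) auto
  with \<open>x \<notin> l2_points\<close> show False by (simp add: l2_points_def)
qed

text \<open>Sturm oscillation: if the solution at a point \<open>x\<close> just left of
  \<open>E\<close> kept the sign of the decaying one, their Wronskian would stay above a positive
  constant, although it tends to 0 along with \<open>q E\<close>. So the sign changes, permanently,
  and for all later indices a zero lies between \<open>x\<close> and \<open>E\<close>.\<close>

lemma zero_left_of_l2_point:
  assumes E: "E \<in> l2_points" "E > 2" and x0: "x0 < E"
  shows "eventually (\<lambda>n. \<exists>z. x0 < z \<and> z < E \<and> q z n = 0) sequentially"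
proof -
  define \<eta> where "\<eta> = (E - 2) / 2"
  have \<eta>: "\<eta> > 0" "2 + \<eta> < E" using E by (auto simp: \<eta>_def field_simps)
  obtain N \<kappa> where N: "N \<ge> 1" and grow: "\<And>x n. x \<ge> 2 + \<eta> \<Longrightarrow> n \<ge> N \<Longrightarrow> q x n \<noteq> 0 \<Longrightarrow>
       \<bar>q x (n - 1)\<bar> \<le> \<bar>q x n\<bar> \<or> q x (n - 1) * q x n \<le> 0 \<Longrightarrow>
       q x (Suc n) * q x n > 0 \<and> \<bar>q x n\<bar> < \<bar>q x (Suc n)\<bar>"
    using exterior_dichotomy[OF \<eta>(1)] by metis
  have growE: "n \<ge> N \<Longrightarrow> q E n \<noteq> 0 \<Longrightarrow>
       \<bar>q E (n - 1)\<bar> \<le> \<bar>q E n\<bar> \<or> q E (n - 1) * q E n \<le> 0 \<Longrightarrow>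
       q E (Suc n) * q E n > 0 \<and> \<bar>q E n\<bar> < \<bar>q E (Suc n)\<bar>" for n
    using grow[of E n] \<eta> by simp
  note decE = l2_points_decreasing[OF growE N E(1)]
  define s where "s = sgn (q E N)"
  have qEN: "q E N \<noteq> 0" using decE[of N] by auto
  then have s: "s = 1 \<or> s = -1" by (auto simp: s_def sgn_if)
  then have ss: "s * s = 1" by auto
  have sE: "s * q E n > 0" if "n \<ge> N" for n using that
  proof (induction n rule: dec_induct)
    case base then show ?case using qEN by (simp add: s_def sgn_if)
  next
    case (step n)
    then show ?case using decE(2)[of "Suc n"] s by (auto simp: zero_less_mult_iff)
  qed
  have decEs: "s * q E (Suc n) < s * q E n" if "n \<ge> N" for n
    using decE(1)[of "Suc n"] sE[of n] sE[of "Suc n"] s that by (auto simp: abs_if split: if_splits)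
  \<comment> \<open>\<open>x\<close> is taken so close to \<open>E\<close> that the kernel sum up to
    \<open>N\<close> and the normalised value at \<open>N\<close> are still positive.\<close>
  have "isCont (\<lambda>x. \<Sum>k\<le>N. q E k * q x k) E" "isCont (\<lambda>x. s * q x N) E"
    by (intro continuous_intros)+
  then have "eventually (\<lambda>x. 0 < (\<Sum>k\<le>N. q E k * q x k)) (at_left E)"
      "eventually (\<lambda>x. 0 < s * q x N) (at_left E)"
    using order_tendstoD(1)[of _ "\<Sum>k\<le>N. q E k * q E k" "at_left E" 0]
      order_tendstoD(1)[of _ "s * q E N" "at_left E" 0] sum_q_square_pos[of E N] sE[of N]
    by (auto simp: continuous_within isCont_def intro: tendsto_within_subset)
  moreover have "eventually (\<lambda>x. x \<in> {max x0 (2 + \<eta>)<..<E}) (at_left E)"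
    using x0 \<eta> by (intro eventually_at_leftI[of "max x0 (2 + \<eta>)"]) auto
  ultimately have "eventually (\<lambda>x. 0 < (\<Sum>k\<le>N. q E k * q x k) \<and> 0 < s * q x N \<and> x \<in> {max x0 (2 + \<eta>)<..<E}) (at_left E)"
    by eventually_elim auto
  from eventually_happens'[OF trivial_limit_at_left_real this]
  obtain x where x: "0 < (\<Sum>k\<le>N. q E k * q x k)" "0 < s * q x N" "x0 < x" "2 + \<eta> < x" "x < E"
    by auto
  have ex: "\<exists>n>N. s * q x n \<le> 0"
  proof (rule ccontr)
    assume "\<not> ?thesis"
    then have pos: "s * q x n > 0" if "n \<ge> N" for n using that x(2) by (cases "n = N") (auto simp: not_le)
    define c where "c = (\<Sum>k\<le>N. q E k * q x k)"
    have mono: "(\<Sum>k\<le>n. q E k * q x k) \<ge> c" if "n \<ge> N" for n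
      unfolding c_def
    proof (rule sum_mono2)
      fix k assume "k \<in> {..n} - {..N}"
      then have "s * q E k > 0" "s * q x k > 0" using pos sE by auto
      then have "(s * q E k) * (s * q x k) > 0" by simp
      also have "(s * q E k) * (s * q x k) = (s * s) * (q E k * q x k)" by (simp only: mult_ac)
      finally show "0 \<le> q E k * q x k" using ss by simp
    qed (use that in auto)
    \<comment> \<open>The Wronskian of the two solutions. As \<open>q E\<close> decreases in
      modulus, its positivity forces \<open>q x\<close> to decrease as well, hence to stay
      bounded.\<close>
    have W: "a (Suc n) * (s * q E (Suc n) * (s * q x n) - s * q E n * (s * q x (Suc n))) \<ge> (E - x) * c"
      if "n \<ge> N" for n
    proof -
      have "a (Suc n) * (s * q E (Suc n) * (s * q x n) - s * q E n * (s * q x (Suc n)))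
          = (s * s) * (a (Suc n) * (q E (Suc n) * q x n - q E n * q x (Suc n)))"
        by (simp add: algebra_simps)
      also have "\<dots> = (E - x) * (\<Sum>k\<le>n. q E k * q x k)" using q_CD[of E x n] ss by simp
      also have "\<dots> \<ge> (E - x) * c" using x mono[OF that] by simp
      finally show ?thesis .
    qed
    have Ec: "(E - x) * c > 0" using x c_def by simp
    have dec: "s * q x (Suc n) < s * q x n" if "n \<ge> N" for n
    proof -
      have "a (Suc n) * (s * q E (Suc n) * (s * q x n) - s * q E n * (s * q x (Suc n))) > 0"
        using W[OF that] Ec by linarith
      then have "s * q E n * (s * q x (Suc n)) < s * q E (Suc n) * (s * q x n)"
        using a_pos[of "Suc n"] by (simp add: zero_less_mult_iff)
      also have "\<dots> < s * q E n * (s * q x n)" using decEs[OF that] pos[OF that] by (intro mult_strict_right_mono) auto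
      finally show ?thesis using sE[OF that] by (simp add: mult_less_cancel_left)
    qed
    have bnd: "s * q x n \<le> s * q x N" if "n \<ge> N" for n
      using that by (induction n rule: dec_induct) (auto dest: dec)
    have le: "(E - x) * c \<le> a (Suc n) * (s * q E (Suc n) * (s * q x N))" if "n \<ge> N" for n
    proof -
      have "s * q E (Suc n) * (s * q x n) - s * q E n * (s * q x (Suc n)) \<le> s * q E (Suc n) * (s * q x n)"
        using sE[of n] pos[of "Suc n"] that by (simp add: less_imp_le)
      also have "\<dots> \<le> s * q E (Suc n) * (s * q x N)"
        using sE[of "Suc n"] that by (intro mult_left_mono bnd) auto
      finally have "a (Suc n) * (s * q E (Suc n) * (s * q x n) - s * q E n * (s * q x (Suc n)))
          \<le> a (Suc n) * (s * q E (Suc n) * (s * q x N))"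
        using a_pos[of "Suc n"] by (intro mult_left_mono) auto
      with W[OF that] show ?thesis by linarith
    qed
    \<comment> \<open>The upper bound for the Wronskian is a bounded factor times
      \<open>q E\<close>, which tends to 0.\<close>
    have "(\<lambda>n. a (Suc n) * (s * q E (Suc n) * (s * q x N))) \<longlonglongrightarrow> 1 * (s * 0 * (s * q x N))"
      using a_tendsto l2_points_tendsto[OF E(1)] by (intro tendsto_intros LIMSEQ_Suc)
    then have "(E - x) * c \<le> 0" using le by (intro Lim_bounded2[where N = N]) auto
    with Ec show False by simp
  qed
  \<comment> \<open>Minimality makes the normalised value at \<open>n - 1\<close> positive, as the
    sign-flip argument requires.\<close>
  define n where "n = (LEAST n. n > N \<and> s * q x n \<le> 0)"
  have n: "n > N" "s * q x n \<le> 0" using LeastI_ex[OF ex[unfolded Bex_def]] by (auto simp: n_def)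
  have prev: "s * q x (n - 1) > 0"
  proof (cases "n - 1 = N")
    case False
    then have "\<not> (n - 1 > N \<and> s * q x (n - 1) \<le> 0)"
      unfolding n_def using n(1) by (intro not_less_Least) (auto simp: n_def)
    then show ?thesis using False n by auto
  qed (use x in simp)
  have grow_x: "n \<ge> N \<Longrightarrow> q x n \<noteq> 0 \<Longrightarrow>
       \<bar>q x (n - 1)\<bar> \<le> \<bar>q x n\<bar> \<or> q x (n - 1) * q x n \<le> 0 \<Longrightarrow>
       q x (Suc n) * q x n > 0 \<and> \<bar>q x n\<bar> < \<bar>q x (Suc n)\<bar>" for n
    using grow[of x n] x by simp
  have neg: "s * q x k < 0" if k: "k \<ge> Suc n" for k
    using exterior_sign_flip[of N x n s k, OF grow_x] N n s prev k by simp
  show ?thesis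
  proof (rule eventually_sequentiallyI[of "Suc n"])
    fix k assume k: "Suc n \<le> k"
    have "\<exists>z. x \<le> z \<and> z \<le> E \<and> s * q z k = 0"
      using neg[OF k] sE[of k] k n x by (intro IVT) (auto intro!: continuous_intros)
    then obtain z where z: "x \<le> z" "z \<le> E" "s * q z k = 0" by blast
    then have "q z k = 0" "z \<noteq> E" using s sE[of k] k n by auto
    with z x show "\<exists>z>x0. z < E \<and> q z k = 0" by (intro exI[of _ z]) auto
  qed
qed

end

section \<open>Solutions at the edge of the essential spectrum\<close>

text \<open>Discrete Gronwall estimate: \<open>1 + c\<close> is at most \<open>exp c\<close>, and
  the exponents add up to at most the full series.\<close>

lemma bounded_of_growth_factors:
  fixes f c :: "nat \<Rightarrow> real"
  assumes step: "\<And>n. n \<ge> N \<Longrightarrow> f (Suc n) \<le> (1 + c n) * f n"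
    and c: "\<And>n. c n \<ge> 0" "summable c" and f: "f N \<ge> 0" and n: "n \<ge> N"
  shows "f n \<le> exp (suminf c) * f N"
proof -
  have "f n \<le> exp (\<Sum>k\<in>{N..<n}. c k) * f N"
    using n
  proof (induction n rule: dec_induct)
    case (step n)
    have "f (Suc n) \<le> (1 + c n) * f n" using assms(1) step by simp
    also have "\<dots> \<le> (1 + c n) * (exp (\<Sum>k\<in>{N..<n}. c k) * f N)"
      using step c(1)[of n] by (intro mult_left_mono) auto
    also have "\<dots> \<le> exp (c n) * (exp (\<Sum>k\<in>{N..<n}. c k) * f N)"
      using f by (intro mult_right_mono) auto
    also have "\<dots> = exp (\<Sum>k\<in>{N..<Suc n}. c k) * f N"
      using step by (simp add: exp_add)
    finally show ?case .
  qed simp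
  also have "\<dots> \<le> exp (suminf c) * f N"
    using sum_le_suminf[OF c(2), of "{N..<n}"] c f by (intro mult_right_mono) auto
  finally show ?thesis .
qed

text \<open>Stolz-Cesaro with denominators \<open>n\<close>: past \<open>M\<close> each step
  deviates from \<open>A\<close> by less than r/2, and the start contributes a constant that the
  division removes.\<close>

lemma LIMSEQ_div_of_diff:
  fixes f :: "nat \<Rightarrow> real"
  assumes "(\<lambda>n. f (Suc n) - f n) \<longlonglongrightarrow> A"
  shows "(\<lambda>n. f n / real n) \<longlonglongrightarrow> A"
proof (rule LIMSEQ_I)
  fix r :: real assume r: "r > 0"
  then have "eventually (\<lambda>n. \<bar>f (Suc n) - f n - A\<bar> < r / 2) sequentially"
    using tendstoD[OF assms, of "r / 2"] by (simp add: dist_real_def)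
  then obtain M where M: "\<And>n. n \<ge> M \<Longrightarrow> \<bar>f (Suc n) - f n - A\<bar> < r / 2"
    by (auto simp: eventually_sequentially)
  have bd: "\<bar>f n - f M - real (n - M) * A\<bar> \<le> real (n - M) * (r / 2)" if "n \<ge> M" for n
    using that
  proof (induction n rule: dec_induct)
    case (step n)
    have len: "real (Suc n - M) = real (n - M) + 1" using step by simp
    have "f (Suc n) - f M - real (Suc n - M) * A
        = (f n - f M - real (n - M) * A) + (f (Suc n) - f n - A)"
      "real (Suc n - M) * (r / 2) = real (n - M) * (r / 2) + r / 2"
      unfolding len by (simp_all add: distrib_right)
    then show ?case using step.IH M[OF step(1)] by linarith
  qed simp
  define K where "K = \<bar>f M - real M * A\<bar>"
  obtain L where L: "real L > 2 * K / r" using reals_Archimedean2 by blast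
  show "\<exists>no. \<forall>n\<ge>no. norm (f n / real n - A) < r"
  proof (intro exI allI impI)
    fix n assume n: "n \<ge> max (max M L) 1"
    have "f n - real n * A = (f n - f M - real (n - M) * A) + (f M - real M * A)"
      using n by (simp add: of_nat_diff algebra_simps)
    then have "\<bar>f n - real n * A\<bar> \<le> real (n - M) * (r / 2) + K"
      using bd[of n] n unfolding K_def by linarith
    also have "\<dots> \<le> real n * (r / 2) + K" using r by simp
    also have "K < real n * (r / 2)"
    proof -
      have "2 * K / r < real n" using L n by (meson less_le_trans max.bounded_iff of_nat_le_iff)
      then show ?thesis using r by (simp add: field_simps)
    qed
    finally have "\<bar>f n - real n * A\<bar> < real n * r" by (simp add: mult.commute)
    moreover have "f n / real n - A = (f n - real n * A) / real n" using n by (simp add: field_simps)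
    ultimately show "norm (f n / real n - A) < r" using n by (simp add: abs_divide field_simps)
  qed
qed

context jacobi_polys
begin

text \<open>Deviation from the free coefficients a = 1, b = 0 among those that enter the step from
  \<open>n\<close> to \<open>Suc n\<close>.\<close>

definition e :: "nat \<Rightarrow> real" where
  "e n = \<bar>a n - 1\<bar> + \<bar>a (Suc n) - 1\<bar> + \<bar>b (Suc n)\<bar>"

lemma e_nonneg [simp]: "e n \<ge> 0"
  by (simp add: e_def)

lemma summable_ne: "summable (\<lambda>n. real n * e n)"
proof (rule summable_comparison_test')
  let ?w = "\<lambda>n. real n * (\<bar>a n - 1\<bar> + \<bar>b n\<bar>)"
  show "summable (\<lambda>n. ?w n + ?w (Suc n))"
    by (intro summable_add decay summable_Suc_iff[of ?w, THEN iffD2])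
  show "norm (real n * e n) \<le> ?w n + ?w (Suc n)" if "n \<ge> 0" for n
    by (simp add: e_def abs_mult algebra_simps)
qed

lemma eventually_a_ge_half: "eventually (\<lambda>n. a n \<ge> 1 / 2) sequentially"
proof -
  have "eventually (\<lambda>n. 1 / 2 < a n) sequentially" by (rule order_tendstoD(1)[OF a_tendsto]) simp
  then show ?thesis by eventually_elim simp
qed

text \<open>At the edge \<open>x = 2\<close> of the essential spectrum the solution grows linearly unless it is
  (up to a slowly varying factor) bounded; \<open>\<sigma>\<close> is its growth exponent.\<close>

lemma edge_asymptotics:
  obtains s \<sigma> :: real and M where "s = 1 \<or> s = -1" "\<sigma> = 0 \<or> \<sigma> = 1" "M \<ge> 1"
    "\<And>n. n \<ge> M \<Longrightarrow> s * q 2 n > 0"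
    "(\<lambda>n. real n * (1 - q 2 (n - 1) / q 2 n)) \<longlonglongrightarrow> \<sigma>"
proof -
  define u where "u = q 2"
  \<comment> \<open>At x = 2 the free recursion says that differences are constant. With the weight
    \<open>a (Suc n)\<close>, the increment of \<open>d\<close> is a small multiple of
    \<open>u n\<close> alone.\<close>
  define d where "d n = a (Suc n) * (u (Suc n) - u n)" for n
  define f where "f n = real n * e n" for n
  have f0: "f n \<ge> 0" for n by (simp add: f_def)
  have sf: "summable f" unfolding f_def by (rule summable_ne)
  have d_step: "\<bar>d n - d (n - 1)\<bar> \<le> e n * \<bar>u n\<bar>" if "n \<ge> 1" for n
  proof -
    have "d n - d (n - 1) = ((1 - a n) + (1 - a (Suc n)) - b (Suc n)) * u n"
      using q_step[OF that, of 2] that by (simp add: d_def u_def algebra_simps)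
    moreover have "\<bar>(1 - a n) + (1 - a (Suc n)) - b (Suc n)\<bar> \<le> e n"
      by (simp add: e_def)
    ultimately show ?thesis by (simp add: abs_mult mult_right_mono)
  qed
  obtain N0 where N0: "N0 \<ge> 1" "\<And>n. n \<ge> N0 \<Longrightarrow> a n \<ge> 1 / 2"
    using eventually_a_ge_half unfolding eventually_sequentially
    by (metis le_trans max.cobounded1 max.cobounded2)
  have u_step: "\<bar>u (Suc n) - u n\<bar> \<le> 2 * \<bar>d n\<bar>" if "n \<ge> N0" for n
  proof -
    have "(1 / 2) * \<bar>u (Suc n) - u n\<bar> \<le> a (Suc n) * \<bar>u (Suc n) - u n\<bar>"
      using N0(2)[of "Suc n"] that by (intro mult_right_mono) auto
    also have "\<dots> = \<bar>d n\<bar>" using N0(2)[of "Suc n"] that by (simp add: d_def abs_mult)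
    finally show ?thesis by simp
  qed
  \<comment> \<open>Controls linear growth and slope together. One step multiplies it by at most
    \<open>1 + 4 * f (Suc n)\<close> with \<open>f\<close> summable, so it stays bounded and
    \<open>u\<close> grows at most linearly.\<close>
  define Q where "Q n = max (\<bar>u n\<bar> / (real n + 1)) (2 * \<bar>d n\<bar>)" for n
  have Q_step: "Q (Suc n) \<le> (1 + 4 * f (Suc n)) * Q n" if n: "n \<ge> N0" for n
  proof -
    have Q0: "Q n \<ge> 0" by (auto simp: Q_def le_max_iff_disj)
    have "\<bar>u n\<bar> / (real n + 1) \<le> Q n" by (simp add: Q_def)
    then have "\<bar>u n\<bar> \<le> (real n + 1) * Q n" by (simp add: field_simps)
    moreover have "2 * \<bar>d n\<bar> \<le> Q n" by (simp add: Q_def)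
    ultimately have uS: "\<bar>u (Suc n)\<bar> \<le> (real n + 2) * Q n"
      using u_step[OF n] by (simp add: algebra_simps)
    then have 1: "\<bar>u (Suc n)\<bar> / (real (Suc n) + 1) \<le> Q n" by (simp add: field_simps)
    have "2 * \<bar>d (Suc n)\<bar> \<le> 2 * \<bar>d n\<bar> + 2 * (e (Suc n) * \<bar>u (Suc n)\<bar>)"
      using d_step[of "Suc n"] by simp
    also have "\<dots> \<le> Q n + 2 * (e (Suc n) * ((real n + 2) * Q n))"
      using uS by (intro add_mono mult_left_mono) (auto simp: Q_def)
    also have "\<dots> \<le> Q n + 2 * (e (Suc n) * ((2 * real (Suc n)) * Q n))"
      using Q0 by (intro add_mono mult_left_mono mult_right_mono) auto
    also have "\<dots> = (1 + 4 * f (Suc n)) * Q n" by (simp add: f_def algebra_simps)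
    finally have 2: "2 * \<bar>d (Suc n)\<bar> \<le> (1 + 4 * f (Suc n)) * Q n" .
    have "Q n \<le> (1 + 4 * f (Suc n)) * Q n" using Q0 f0[of "Suc n"] by (simp add: algebra_simps)
    with 1 2 show ?thesis unfolding Q_def[of "Suc n"] by simp
  qed
  have sf': "summable (\<lambda>n. 4 * f (Suc n))" using sf by (intro summable_mult) (simp add: summable_Suc_iff)
  define C where "C = exp (\<Sum>n. 4 * f (Suc n)) * Q N0"
  have "Q n \<le> C" if "n \<ge> N0" for n
    unfolding C_def using f0 sf' that
    by (intro bounded_of_growth_factors[where c = "\<lambda>n. 4 * f (Suc n)"] Q_step) (auto simp: Q_def le_max_iff_disj)
  then have u_bd: "\<bar>u n\<bar> \<le> 2 * C * real n" if "n \<ge> N0" for n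
  proof -
    have "\<bar>u n\<bar> / (real n + 1) \<le> C" using \<open>n \<ge> N0 \<Longrightarrow> Q n \<le> C\<close>[OF that] by (simp add: Q_def)
    then have "\<bar>u n\<bar> \<le> C * (real n + 1)" by (simp add: field_simps)
    also have "\<dots> \<le> C * (2 * real n)"
    proof (rule mult_left_mono)
      show "real n + 1 \<le> 2 * real n" using that N0 by simp
      show "0 \<le> C" unfolding C_def by (auto simp: Q_def le_max_iff_disj)
    qed
    finally show ?thesis by (simp add: algebra_simps)
  qed
  have d_diff: "\<bar>d k - d n\<bar> \<le> K * (\<Sum>m\<in>{n<..k}. f m)"
    if n: "n \<ge> N0" and k: "k \<ge> n" and K: "\<And>m. m \<ge> n \<Longrightarrow> \<bar>u m\<bar> \<le> K * real m" for k n K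
    using k
  proof (induction k rule: dec_induct)
    case (step k)
    have "\<bar>d (Suc k) - d k\<bar> \<le> e (Suc k) * \<bar>u (Suc k)\<bar>" using d_step[of "Suc k"] by simp
    also have "\<dots> \<le> e (Suc k) * (K * real (Suc k))" using K[of "Suc k"] step by (intro mult_left_mono) auto
    also have "\<dots> = K * f (Suc k)" by (simp add: f_def)
    finally have "\<bar>d (Suc k) - d k\<bar> \<le> K * f (Suc k)" .
    moreover have "{n<..Suc k} = insert (Suc k) {n<..k}" using step by auto
    ultimately show ?case using step by (simp add: distrib_left)
  qed simp
  define \<tau> where "\<tau> n = suminf f - (\<Sum>m\<le>n. f m)" for n
  have \<tau>_lim: "\<tau> \<longlonglongrightarrow> 0"
    unfolding \<tau>_def using tendsto_diff[OF tendsto_const summable_LIMSEQ'[OF sf], of "suminf f"] by simp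
  have \<tau>_sum: "(\<Sum>m\<in>{n<..k}. f m) \<le> \<tau> n" if "k \<ge> n" for n k
  proof -
    have "{..k} = {..n} \<union> {n<..k}" using that by auto
    then have "(\<Sum>m\<le>k. f m) = sum f ({..n} \<union> {n<..k})" by simp
    also have "\<dots> = (\<Sum>m\<le>n. f m) + (\<Sum>m\<in>{n<..k}. f m)"
      by (rule sum.union_disjoint) auto
    finally have "(\<Sum>m\<le>k. f m) = (\<Sum>m\<le>n. f m) + (\<Sum>m\<in>{n<..k}. f m)" .
    moreover have "(\<Sum>m\<le>k. f m) \<le> suminf f" using sum_le_suminf[OF sf] f0 by auto
    ultimately show ?thesis by (simp add: \<tau>_def)
  qed
  have \<tau>_mono: "\<tau> k \<le> \<tau> n" if "k \<ge> n" for k n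
    using sum_mono2[of "{..k}" "{..n}" f] that f0 by (auto simp: \<tau>_def)
  have \<tau>0: "\<tau> n \<ge> 0" for n using sum_le_suminf[OF sf, of "{..n}"] f0 by (auto simp: \<tau>_def)
  \<comment> \<open>With the linear bound on \<open>u\<close>, the increments of \<open>d\<close>
    are at most \<open>2 * C * f\<close>, hence summable; the limiting slope \<open>A\<close>
    separates the two growth types.\<close>
  have "Cauchy d"
  proof (rule metric_CauchyI)
    fix r :: real assume r: "r > 0"
    have "(\<lambda>n. 2 * C * \<tau> n) \<longlonglongrightarrow> 2 * C * 0" by (intro tendsto_intros \<tau>_lim)
    then have "eventually (\<lambda>n. 2 * C * \<tau> n < r / 2) sequentially"
      using r by (intro order_tendstoD(2)) auto
    then obtain L where L: "\<And>n. n \<ge> L \<Longrightarrow> 2 * C * \<tau> n < r / 2" by (auto simp: eventually_sequentially)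
    define L' where "L' = max L N0"
    have C0: "C \<ge> 0" unfolding C_def by (auto simp: Q_def le_max_iff_disj)
    have "\<bar>d k - d L'\<bar> < r / 2" if "k \<ge> L'" for k
    proof -
      have "\<bar>d k - d L'\<bar> \<le> 2 * C * (\<Sum>m\<in>{L'<..k}. f m)"
        using that u_bd by (intro d_diff) (auto simp: L'_def)
      also have "\<dots> \<le> 2 * C * \<tau> L'" using \<tau>_sum[OF that] C0 by (intro mult_left_mono) auto
      also have "\<dots> < r / 2" using L by (simp add: L'_def)
      finally show ?thesis .
    qed
    then show "\<exists>M. \<forall>m\<ge>M. \<forall>n\<ge>M. dist (d m) (d n) < r"
      by (intro exI[of _ L'] allI impI) (smt (verit) dist_real_def field_sum_of_halves)
  qed
  then obtain A where A: "d \<longlonglongrightarrow> A" using convergent_eq_Cauchy by blast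
  have "(\<lambda>n. d n / a (Suc n)) \<longlonglongrightarrow> A / 1"
    by (intro tendsto_divide A LIMSEQ_Suc a_tendsto) auto
  moreover have "d n / a (Suc n) = u (Suc n) - u n" for n using a_pos[of "Suc n"] by (simp add: d_def)
  ultimately have diff: "(\<lambda>n. u (Suc n) - u n) \<longlonglongrightarrow> A" by simp
  show thesis
  proof (cases "A = 0")
    case False
    have lim: "(\<lambda>n. u n / real n) \<longlonglongrightarrow> A" by (rule LIMSEQ_div_of_diff[OF diff])
    define s where "s = sgn A"
    have s: "s = 1 \<or> s = -1" using False by (auto simp: s_def sgn_if)
    have "(\<lambda>n. s * (u n / real n)) \<longlonglongrightarrow> s * A" by (intro tendsto_intros lim)
    moreover have "s * A > 0" using False by (simp add: s_def sgn_if)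
    ultimately have "eventually (\<lambda>n. s * (u n / real n) > 0) sequentially"
      by (rule order_tendstoD)
    then obtain M where M: "\<And>n. n \<ge> M \<Longrightarrow> s * (u n / real n) > 0"
      by (auto simp: eventually_sequentially)
    have pos: "s * u n > 0" if "n \<ge> max M 1" for n
      using M[of n] that by (auto simp: zero_less_mult_iff zero_less_divide_iff divide_less_0_iff)
    \<comment> \<open>Slope divided by mean slope: both tend to \<open>A\<close>, so the growth
      exponent is 1.\<close>
    have "(\<lambda>n. (u (Suc n) - u n) / (u (Suc n) / real (Suc n))) \<longlonglongrightarrow> A / A"
      using False by (intro tendsto_divide diff filterlim_compose[OF lim filterlim_Suc])
    moreover have "eventually (\<lambda>n. (u (Suc n) - u n) / (u (Suc n) / real (Suc n))
        = real (Suc n) * (1 - u n / u (Suc n))) sequentially"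
    proof (rule eventually_sequentiallyI[of "max M 1"])
      fix n assume "max M 1 \<le> n"
      then have "u (Suc n) \<noteq> 0" using pos[of "Suc n"] by auto
      then show "(u (Suc n) - u n) / (u (Suc n) / real (Suc n)) = real (Suc n) * (1 - u n / u (Suc n))"
        by (simp add: field_simps)
    qed
    ultimately have "(\<lambda>n. real (Suc n) * (1 - u (Suc n - 1) / u (Suc n))) \<longlonglongrightarrow> 1"
      using False by (simp add: tendsto_cong)
    then have "(\<lambda>n. real n * (1 - u (n - 1) / u n)) \<longlonglongrightarrow> 1"
      by (rule LIMSEQ_imp_Suc)
    then show thesis
      using that[of s 1 "max M 1"] s pos by (simp add: u_def)
  next
    case True
    have "eventually (\<lambda>n. \<tau> n < 1 / 8) sequentially" by (rule order_tendstoD(2)[OF \<tau>_lim]) simp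
    then obtain N1 where N1: "N1 \<ge> N0" "\<And>n. n \<ge> N1 \<Longrightarrow> \<tau> n < 1 / 8"
      unfolding eventually_sequentially by (metis le_trans max.cobounded1 max.cobounded2)
    have step: "\<bar>u (Suc n) - u n\<bar> \<le> 4 * \<tau> n * (\<bar>u n\<bar> / real n)" if n: "n \<ge> N1" for n
    proof -
      have n1: "n \<ge> 1" and nN0: "n \<ge> N0" using n N1 N0 by auto
      \<comment> \<open>For limiting slope 0, later slopes are bounded by
        \<open>K * \<tau> n\<close>, and summing them bounds \<open>K\<close> by
        \<open>\<bar>u n\<bar> / real n + K / 4\<close>, the quarter coming from the threshold 1/8.
        So \<open>K\<close> is comparable with the value at \<open>n\<close> itself, and the
        estimates below are relative to \<open>u n\<close>.\<close>
      define K where "K = (SUP m\<in>{n..}. \<bar>u m\<bar> / real m)"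
      have bdd: "bdd_above ((\<lambda>m. \<bar>u m\<bar> / real m) ` {n..})"
        using u_bd n1 nN0 by (intro bdd_aboveI[of _ "2 * C"]) (auto simp: field_simps)
      have K: "\<bar>u m\<bar> \<le> K * real m" if "m \<ge> n" for m
      proof -
        have "\<bar>u m\<bar> / real m \<le> K" unfolding K_def using that by (intro cSUP_upper bdd) auto
        then show ?thesis using that n1 by (simp add: field_simps)
      qed
      have K0: "K \<ge> 0"
      proof -
        have "0 \<le> K * real n" using K[of n] by (meson abs_ge_zero le_refl order_trans)
        then show ?thesis using n1 by (simp add: zero_le_mult_iff)
      qed
      have d_bd: "\<bar>d j\<bar> \<le> K * \<tau> n" if j: "j \<ge> n" for j
      proof -
        have "(\<lambda>k. \<bar>d k - d j\<bar>) \<longlonglongrightarrow> \<bar>0 - d j\<bar>"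
          using A True by (intro tendsto_intros) auto
        moreover have "\<bar>d k - d j\<bar> \<le> K * \<tau> n" if "k \<ge> j" for k
        proof -
          have "\<bar>d k - d j\<bar> \<le> K * (\<Sum>m\<in>{j<..k}. f m)"
            using that j nN0 K by (intro d_diff) auto
          also have "\<dots> \<le> K * \<tau> n"
            using \<tau>_sum[OF that] \<tau>_mono[OF j] K0 by (intro mult_left_mono) auto
          finally show ?thesis .
        qed
        ultimately have "\<bar>0 - d j\<bar> \<le> K * \<tau> n" by (intro Lim_bounded[where M = j]) auto
        then show ?thesis by simp
      qed
      have u_diff: "\<bar>u m - u n\<bar> \<le> real (m - n) * (2 * (K * \<tau> n))" if "m \<ge> n" for m
        using that
      proof (induction m rule: dec_induct)
        case (step m)
        have "\<bar>u (Suc m) - u m\<bar> \<le> 2 * (K * \<tau> n)"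
          using u_step[of m] d_bd[of m] step nN0 by simp
        moreover have "real (Suc m - n) = real (m - n) + 1" using step by simp
        ultimately show ?case using step.IH by (simp add: distrib_right)
      qed simp
      have "K \<le> \<bar>u n\<bar> / real n + K / 4"
        unfolding K_def
      proof (rule cSUP_least, goal_cases)
        case (2 m)
        then have m: "m \<ge> n" by simp
        have "K * \<tau> n \<le> K * (1 / 8)" using K0 N1(2)[OF n] by (intro mult_left_mono) auto
        then have "real (m - n) * (2 * (K * \<tau> n)) \<le> real m * (K / 4)"
          using K0 \<tau>0[of n] by (intro mult_mono) auto
        then have "\<bar>u m\<bar> \<le> \<bar>u n\<bar> + real m * (K / 4)" using u_diff[OF m] by linarith
        moreover have "\<bar>u n\<bar> \<le> real m * (\<bar>u n\<bar> / real n)"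
        proof -
          have "real n * (\<bar>u n\<bar> / real n) \<le> real m * (\<bar>u n\<bar> / real n)"
            using m by (intro mult_right_mono) auto
          then show ?thesis using n1 by simp
        qed
        ultimately have "\<bar>u m\<bar> \<le> real m * (\<bar>u n\<bar> / real n + K / 4)" by (simp add: distrib_left)
        then show ?case using m n1 unfolding K_def[symmetric] by (simp add: divide_le_eq mult.commute)
      qed simp
      then have K2: "K \<le> 2 * (\<bar>u n\<bar> / real n)" using K0 by simp
      have "\<bar>u (Suc n) - u n\<bar> \<le> 2 * (K * \<tau> n)" using u_step[OF nN0] d_bd[of n] by simp
      also have "\<dots> \<le> 2 * (2 * (\<bar>u n\<bar> / real n) * \<tau> n)"
        using K2 \<tau>0[of n] by (intro mult_left_mono mult_right_mono) auto
      finally show ?thesis by (simp add: mult_ac)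
    qed
    \<comment> \<open>A relative change of at most one half excludes sign changes; it excludes zeros
      as well, since a zero would be followed by another one.\<close>
    have half: "\<bar>u (Suc n) - u n\<bar> \<le> \<bar>u n\<bar> / 2" if n: "n \<ge> N1" for n
    proof -
      have "4 * \<tau> n * (\<bar>u n\<bar> / real n) \<le> (1 / 2) * (\<bar>u n\<bar> / 1)"
        using less_imp_le[OF N1(2)[OF n]] n N1(1) N0(1) by (intro mult_mono divide_left_mono) auto
      then show ?thesis using step[OF n] by simp
    qed
    have nz: "u n \<noteq> 0" if "n \<ge> N1" for n
      using half[OF that] q_consecutive_nonzero[of 2 n] by (auto simp: u_def)
    define s where "s = sgn (u N1)"
    have s: "s = 1 \<or> s = -1" using nz[of N1] by (auto simp: s_def sgn_if)
    have pos: "s * u n > 0" if "n \<ge> N1" for n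
      using that
    proof (induction n rule: dec_induct)
      case base then show ?case using nz[of N1] by (simp add: s_def sgn_if)
    next
      case (step n)
      then show ?case using half[of n] s by (auto simp: abs_if split: if_splits)
    qed
    have "(\<lambda>n. real (Suc n) * (1 - u n / u (Suc n))) \<longlonglongrightarrow> 0"
    proof (rule Lim_null_comparison)
      show "(\<lambda>n. 16 * \<tau> n) \<longlonglongrightarrow> 0" using tendsto_mult_right_zero[OF \<tau>_lim, of 16] by simp
      show "eventually (\<lambda>n. norm (real (Suc n) * (1 - u n / u (Suc n))) \<le> 16 * \<tau> n) sequentially"
      proof (rule eventually_sequentiallyI[of N1])
        fix n assume n: "N1 \<le> n"
        then have n1: "n \<ge> 1" using N1 N0 by auto
        have uS: "\<bar>u (Suc n)\<bar> \<ge> \<bar>u n\<bar> / 2" using half[OF n] by (simp add: abs_if split: if_splits)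
        have un: "\<bar>u n\<bar> > 0" using nz[OF n] by simp
        have eq: "1 - u n / u (Suc n) = (u (Suc n) - u n) / u (Suc n)"
          using nz[of "Suc n"] n by (simp add: field_simps)
        have "norm (real (Suc n) * (1 - u n / u (Suc n)))
            = real (Suc n) * (\<bar>u (Suc n) - u n\<bar> / \<bar>u (Suc n)\<bar>)"
          unfolding eq by (simp add: abs_mult)
        also have "\<dots> \<le> (2 * real n) * ((4 * \<tau> n * (\<bar>u n\<bar> / real n)) / (\<bar>u n\<bar> / 2))"
          using step[OF n] uS un n1 \<tau>0[of n] by (intro mult_mono frac_le) auto
        also have "\<dots> = 16 * \<tau> n" using un n1 by (simp add: field_simps)
        finally show "norm (real (Suc n) * (1 - u n / u (Suc n))) \<le> 16 * \<tau> n" .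
      qed
    qed
    then have "(\<lambda>n. real (Suc n) * (1 - u (Suc n - 1) / u (Suc n))) \<longlonglongrightarrow> 0" by simp
    then have "(\<lambda>n. real n * (1 - u (n - 1) / u n)) \<longlonglongrightarrow> 0"
      by (rule LIMSEQ_imp_Suc)
    then show thesis
      using that[of s 0 N1] s pos N1 N0 by (simp add: u_def)
  qed
qed

end

section \<open>Counting the zeros outside the essential spectrum\<close>

lemma isCont_pos_nbhd:
  fixes f :: "'a::metric_space \<Rightarrow> real"
  assumes "isCont f x" "f x > 0"
  obtains d where "d > 0" "\<And>y. dist y x < d \<Longrightarrow> f y > 0"
proof -
  have "(f \<longlongrightarrow> f x) (nhds x)"
    using assms(1) by (simp add: isCont_def tendsto_at_iff_tendsto_nhds)
  then have "eventually (\<lambda>y. f y > 0) (nhds x)" using assms(2) by (rule order_tendstoD)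
  then show thesis using that by (auto simp: eventually_nhds_metric)
qed

context jacobi_polys
begin

text \<open>Comparison with the solution at 2, whose sign is eventually constant. For x \<ge> 2 a
  positive kernel sum makes the ratio of the two solutions nondecreasing, which keeps the next
  kernel sum positive. As \<open>r\<close> is independent of \<open>n\<close>, exterior zeros cannot
  accumulate at 2.\<close>

lemma no_zeros_right_of_2:
  obtains r n0 where "r > 0" "\<And>x n. 2 \<le> x \<Longrightarrow> x < 2 + r \<Longrightarrow> n \<ge> n0 \<Longrightarrow> q x n \<noteq> 0"
proof -
  obtain s \<sigma> :: real and M where s: "s = 1 \<or> s = -1" and M: "\<And>n. n \<ge> M \<Longrightarrow> s * q 2 n > 0"
    using edge_asymptotics by metis
  have ss: "s * s = 1" using s by auto
  have "isCont (\<lambda>x. \<Sum>k\<le>M. q x k * q 2 k) 2" by (intro continuous_intros)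
  then obtain d1 where d1: "d1 > 0" "\<And>x. dist x 2 < d1 \<Longrightarrow> (\<Sum>k\<le>M. q x k * q 2 k) > 0"
    using sum_q_square_pos[of 2 M] by (rule isCont_pos_nbhd) auto
  have "isCont (\<lambda>x. s * q x M) 2" by (intro continuous_intros)
  then obtain d2 where d2: "d2 > 0" "\<And>x. dist x 2 < d2 \<Longrightarrow> s * q x M > 0"
    using M[of M] by (rule isCont_pos_nbhd) auto
  have "s * q x n > 0" if x: "2 \<le> x" "x < 2 + min d1 d2" and n: "n \<ge> M" for x n
  proof -
    have "s * q x n > 0 \<and> (\<Sum>k\<le>n. q x k * q 2 k) > 0"
      using n
    proof (induction n rule: dec_induct)
      case base
      then show ?case using d1 d2 x by (auto simp: dist_real_def)
    next
      case (step n)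
      have "a (Suc n) * (q x (Suc n) * q 2 n - q x n * q 2 (Suc n)) \<ge> 0"
        unfolding q_CD[symmetric] using step.IH x by (intro mult_nonneg_nonneg) auto
      then have "q x n * q 2 (Suc n) \<le> q x (Suc n) * q 2 n"
        using a_pos[of "Suc n"] by (simp add: zero_le_mult_iff)
      then have "(s * s) * (q x n * q 2 (Suc n)) \<le> (s * s) * (q x (Suc n) * q 2 n)"
        using ss by simp
      then have "(s * q x n) * (s * q 2 (Suc n)) \<le> (s * q x (Suc n)) * (s * q 2 n)"
        by (simp add: mult_ac)
      moreover have "(s * q x n) * (s * q 2 (Suc n)) > 0"
        by (rule mult_pos_pos) (use step M[of "Suc n"] in auto)
      ultimately have "(s * q x (Suc n)) * (s * q 2 n) > 0" by linarith
      then have 1: "s * q x (Suc n) > 0"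
        by (rule zero_less_mult_pos2) (use M[of n] step in simp)
      then have "(s * q x (Suc n)) * (s * q 2 (Suc n)) > 0" using M[of "Suc n"] step by simp
      then have "(s * s) * (q x (Suc n) * q 2 (Suc n)) > 0" by (simp add: mult_ac)
      then show ?case using 1 step ss by simp
    qed
    then show ?thesis by simp
  qed
  then show thesis using d1 d2 by (intro that[of "min d1 d2" M]) force+
qed

text \<open>Near 2 and near a point that is no eigenvalue there are eventually no zeros; near an
  eigenvalue two zeros would contradict Christoffel-Darboux.\<close>

lemma local_zero_bound:
  assumes "E \<ge> 2"
  obtains r n0 where "r > 0"
    "\<And>n. n \<ge> n0 \<Longrightarrow> card {x. 2 < x \<and> \<bar>x - E\<bar> < r \<and> q x n = 0} \<le> (if E > 2 \<and> E \<in> l2_points then 1 else 0)"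
proof (cases "E = 2")
  case True
  obtain r n0 where "r > 0" and *: "\<And>x n. 2 \<le> x \<Longrightarrow> x < 2 + r \<Longrightarrow> n \<ge> n0 \<Longrightarrow> q x n \<noteq> 0"
    using no_zeros_right_of_2 by blast
  have "card {x. 2 < x \<and> \<bar>x - E\<bar> < r \<and> q x n = 0} = 0" if "n \<ge> n0" for n
  proof -
    have "{x. 2 < x \<and> \<bar>x - E\<bar> < r \<and> q x n = 0} = {}"
      using *[of _ n] that True by force
    then show ?thesis by (simp only: card.empty)
  qed
  then show thesis using that[of r n0] \<open>r > 0\<close> by simp
next
  case False
  with assms have E2: "E > 2" by simp
  define \<eta> where "\<eta> = (E - 2) / 2"
  have \<eta>: "\<eta> > 0" "2 + \<eta> < E" "E - \<eta> = 2 + \<eta>" using E2 by (auto simp: \<eta>_def field_simps)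
  obtain N \<kappa> where N: "N \<ge> 1" and \<kappa>: "0 < \<kappa>" "\<kappa> < 1" and grow: "\<And>x n. x \<ge> 2 + \<eta> \<Longrightarrow> n \<ge> N \<Longrightarrow> q x n \<noteq> 0 \<Longrightarrow>
       \<bar>q x (n - 1)\<bar> \<le> \<bar>q x n\<bar> \<or> q x (n - 1) * q x n \<le> 0 \<Longrightarrow>
       q x (Suc n) * q x n > 0 \<and> \<bar>q x n\<bar> < \<bar>q x (Suc n)\<bar>"
    and decay: "\<And>x n. x \<ge> 2 + \<eta> \<Longrightarrow> n \<ge> N \<Longrightarrow> \<bar>q x (Suc n)\<bar> \<le> \<bar>q x n\<bar> \<Longrightarrow>
       \<bar>q x n\<bar> \<le> \<kappa> * \<bar>q x (n - 1)\<bar>"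
    using exterior_dichotomy[OF \<eta>(1)] by metis
  show thesis
  proof (cases "E \<in> l2_points")
    case False
    have "n \<ge> N \<Longrightarrow> \<bar>q E (Suc n)\<bar> \<le> \<bar>q E n\<bar> \<Longrightarrow> \<bar>q E n\<bar> \<le> \<kappa> * \<bar>q E (n - 1)\<bar>" for n
      using decay[of E n] \<eta> by simp
    then obtain m where m: "m \<ge> N" "\<bar>q E (Suc m)\<bar> > \<bar>q E m\<bar>"
      using not_l2_points_growth[of N E \<kappa>] \<kappa> False by blast
    \<comment> \<open>Growth at one index is an open condition in \<open>x\<close> and persists to
      all later indices, so one neighbourhood serves all \<open>n\<close>.\<close>
    have "isCont (\<lambda>x. \<bar>q x (Suc m)\<bar> - \<bar>q x m\<bar>) E" by (intro continuous_intros)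
    moreover have "\<bar>q E (Suc m)\<bar> - \<bar>q E m\<bar> > 0" using m(2) by simp
    ultimately obtain d where d: "d > 0" "\<And>x. dist x E < d \<Longrightarrow> \<bar>q x (Suc m)\<bar> - \<bar>q x m\<bar> > 0"
      by (rule isCont_pos_nbhd) auto
    have nz: "q x n \<noteq> 0" if x: "\<bar>x - E\<bar> < min d \<eta>" and n: "n \<ge> Suc m" for x n
    proof -
      have x2: "x \<ge> 2 + \<eta>" using x \<eta> by (auto simp: abs_less_iff)
      have "\<bar>q x m\<bar> < \<bar>q x (Suc m)\<bar>" using d(2)[of x] x by (simp add: dist_real_def)
      then have "q x n * q x (Suc m) > 0"
        using exterior_growth_persists[of N x "Suc m" n, OF grow[OF x2]] m n by auto
      then show ?thesis by auto
    qed
    have "card {x. 2 < x \<and> \<bar>x - E\<bar> < min d \<eta> \<and> q x n = 0} = 0" if "n \<ge> Suc m" for n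
    proof -
      have "{x. 2 < x \<and> \<bar>x - E\<bar> < min d \<eta> \<and> q x n = 0} = {}" using nz that by blast
      then show ?thesis by (simp only: card.empty)
    qed
    then show thesis using that[of "min d \<eta>" "Suc m"] d \<eta> by simp
  next
    case True
    have growE: "n \<ge> N \<Longrightarrow> q E n \<noteq> 0 \<Longrightarrow>
       \<bar>q E (n - 1)\<bar> \<le> \<bar>q E n\<bar> \<or> q E (n - 1) * q E n \<le> 0 \<Longrightarrow>
       q E (Suc n) * q E n > 0 \<and> \<bar>q E n\<bar> < \<bar>q E (Suc n)\<bar>" for n
      using grow[of E n] \<eta> by simp
    define s where "s = sgn (q E N)"
    have qEN: "q E N \<noteq> 0" using l2_points_decreasing[OF growE N True, of N] by auto
    then have s: "s = 1 \<or> s = -1" by (auto simp: s_def sgn_if)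
    then have ss: "s * s = 1" by auto
    have sN: "s * q E N > 0" using qEN by (simp add: s_def sgn_if)
    have "isCont (\<lambda>x. s * q x N) E" by (intro continuous_intros)
    then obtain d1 where d1: "d1 > 0" "\<And>x. dist x E < d1 \<Longrightarrow> s * q x N > 0"
      using sN by (rule isCont_pos_nbhd) auto
    \<comment> \<open>Joint continuity, because both arguments of the kernel vary: two zeros near
      \<open>E\<close> are compared with each other.\<close>
    have "continuous_on UNIV (\<lambda>z. \<Sum>k\<le>N. q (fst z) k * q (snd z) k)"
      by (intro continuous_intros)
    then have "isCont (\<lambda>z. \<Sum>k\<le>N. q (fst z) k * q (snd z) k) (E, E)"
      by (simp add: continuous_on_eq_continuous_at)
    moreover have "(\<Sum>k\<le>N. q (fst (E, E)) k * q (snd (E, E)) k) > 0"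
      using sum_q_square_pos[of E N] by simp
    ultimately obtain d2 where d2: "d2 > 0"
        "\<And>z. dist z (E, E) < d2 \<Longrightarrow> (\<Sum>k\<le>N. q (fst z) k * q (snd z) k) > 0"
      by (rule isCont_pos_nbhd) auto
    define r where "r = min (min d1 (d2 / 2)) \<eta>"
    have r: "r > 0" using d1 d2 \<eta> by (simp add: r_def)
    \<comment> \<open>A sign change before the index \<open>n\<close> would be permanent and rule
      out a zero at \<open>n\<close>.\<close>
    have pos: "s * q x k > 0" if x: "\<bar>x - E\<bar> < r" and n: "q x n = 0" and k: "N \<le> k" "k < n" for x n k
      using k
    proof (induction k rule: dec_induct)
      case base
      then show ?case using d1(2)[of x] x by (simp add: dist_real_def r_def)
    next
      case (step k)
      have x2: "x \<ge> 2 + \<eta>" using x \<eta> by (auto simp: abs_less_iff r_def)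
      show ?case
      proof (rule ccontr)
        assume "\<not> 0 < s * q x (Suc k)"
        then have "s * q x n < 0"
          using exterior_sign_flip[of N x "Suc k" s n, OF grow[OF x2]] N s step by simp
        with n show False by simp
      qed
    qed
    \<comment> \<open>The kernel sum vanishes at two distinct zeros, yet its part up to
      \<open>N\<close> is positive and all later terms are nonnegative.\<close>
    have uniq: "x = y" if xy: "\<bar>x - E\<bar> < r" "\<bar>y - E\<bar> < r" "q x n = 0" "q y n = 0" and n: "n \<ge> Suc N" for x y n
    proof (rule ccontr)
      assume neq: "x \<noteq> y"
      have "dist (x, y) (E, E) \<le> \<bar>x - E\<bar> + \<bar>y - E\<bar>"
        by (simp add: dist_Pair_Pair dist_real_def sqrt_sum_squares_le_sum_abs)
      also have "\<dots> < d2" using xy by (simp add: r_def)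
      finally have "0 < (\<Sum>k\<le>N. q x k * q y k)" using d2(2)[of "(x, y)"] by simp
      also have "\<dots> \<le> (\<Sum>k\<le>n - 1. q x k * q y k)"
      proof (rule sum_mono2)
        fix k assume "k \<in> {..n - 1} - {..N}"
        then have "N \<le> k" "k < n" using n by auto
        then have "(s * q x k) * (s * q y k) > 0"
          by (intro mult_pos_pos pos[OF xy(1,3)] pos[OF xy(2,4)])
        also have "(s * q x k) * (s * q y k) = (s * s) * (q x k * q y k)" by (simp only: mult_ac)
        finally show "0 \<le> q x k * q y k" using ss by simp
      qed (use n in auto)
      finally have "(x - y) * (\<Sum>k\<le>n - 1. q x k * q y k) \<noteq> 0" using neq by simp
      moreover have "(x - y) * (\<Sum>k\<le>n - 1. q x k * q y k) = 0"
        using q_CD[of x y "n - 1"] n xy by simp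
      ultimately show False by simp
    qed
    have "card {x. 2 < x \<and> \<bar>x - E\<bar> < r \<and> q x n = 0} \<le> 1" if n: "n \<ge> Suc N" for n
    proof -
      have "finite {x. 2 < x \<and> \<bar>x - E\<bar> < r \<and> q x n = 0}"
        by (rule finite_subset[OF _ finite_zeros[of n]]) auto
      then show ?thesis
        unfolding One_nat_def by (subst card_le_Suc0_iff_eq) (use uniq[OF _ _ _ _ n] in blast)+
    qed
    then show thesis using that[of r "Suc N"] r True E2 by simp
  qed
qed

text \<open>Beyond \<open>B\<close> the diagonal term dominates from the start, so
  \<open>\<bar>q x n\<bar>\<close> never decreases. This confines the zeros right of 2 to a compact
  interval independent of \<open>n\<close>.\<close>

lemma zeros_bounded:
  obtains B where "\<And>x n. x \<ge> B \<Longrightarrow> q x n \<noteq> 0"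
proof -
  have "Bseq a" "Bseq b" using a_tendsto b_tendsto by (auto intro: convergent_imp_Bseq convergentI)
  then obtain A1 A2 where A: "A1 > 0" "\<And>n. \<bar>a n\<bar> \<le> A1" "A2 > 0" "\<And>n. \<bar>b n\<bar> \<le> A2"
    by (auto simp: Bseq_def)
  define B where "B = A2 + 2 * A1"
  have "0 < \<bar>q x n\<bar> \<and> \<bar>q x n\<bar> \<le> \<bar>q x (Suc n)\<bar>" if x: "x \<ge> B" for x n
  proof (induction n)
    case 0
    have "a (Suc 0) * q x (Suc 0) = x - b (Suc 0)" using q_rec[of x 0] by (simp add: algebra_simps)
    moreover have "\<bar>x - b (Suc 0)\<bar> \<ge> A1" using x A(1) A(4)[of "Suc 0"] by (simp add: B_def abs_le_iff)
    ultimately have "A1 \<le> \<bar>a (Suc 0)\<bar> * \<bar>q x (Suc 0)\<bar>" by (metis abs_mult)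
    also have "\<dots> \<le> A1 * \<bar>q x (Suc 0)\<bar>" using A(2)[of "Suc 0"] by (intro mult_right_mono) auto
    finally show ?case using A(1) by simp
  next
    case (Suc n)
    let ?u = "\<bar>q x (Suc n)\<bar>" and ?v = "\<bar>q x n\<bar>" and ?w = "\<bar>q x (Suc (Suc n))\<bar>"
    have "(x - b (Suc (Suc n))) * q x (Suc n) = a (Suc (Suc n)) * q x (Suc (Suc n)) + a (Suc n) * q x n"
      using q_step[of "Suc n" x] by simp
    then have "\<bar>x - b (Suc (Suc n))\<bar> * ?u \<le> \<bar>a (Suc (Suc n))\<bar> * ?w + \<bar>a (Suc n)\<bar> * ?v"
      by (metis abs_mult abs_triangle_ineq)
    also have "\<dots> \<le> A1 * ?w + A1 * ?u"
      using A Suc.IH by (intro add_mono mult_mono) (auto intro: order_trans[OF abs_ge_zero])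
    finally have "\<bar>x - b (Suc (Suc n))\<bar> * ?u \<le> A1 * ?w + A1 * ?u" .
    moreover have "(2 * A1) * ?u \<le> \<bar>x - b (Suc (Suc n))\<bar> * ?u"
      using x A(4)[of "Suc (Suc n)"] by (intro mult_right_mono) (auto simp: B_def abs_le_iff)
    ultimately have "A1 * ?u \<le> A1 * ?w" by simp
    moreover have "0 < ?u" using Suc.IH by linarith
    ultimately show ?case using A(1) by simp
  qed
  then show thesis by (intro that[of B]) fastforce
qed

text \<open>Phrased with finite subsets because the finiteness of the set of eigenvalues is still to
  be derived from it.\<close>

lemma zeros_exceed_finite_subset:
  assumes F: "finite F" "F \<subseteq> {x \<in> l2_points. x > 2}"
  shows "eventually (\<lambda>n. card F \<le> card {x. x > 2 \<and> q x n = 0}) sequentially"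
proof -
  \<comment> \<open>The next smaller point of \<open>F\<close>, or 2. The intervals from
    \<open>x0 E\<close> to \<open>E\<close> are disjoint, so the zeros found in them are
    distinct.\<close>
  define x0 where "x0 E = Max (insert 2 {E' \<in> F. E' < E})" for E
  have x0: "x0 E < E" "2 \<le> x0 E" "\<And>E'. E' \<in> F \<Longrightarrow> E' < E \<Longrightarrow> E' \<le> x0 E" if "E \<in> F" for E
    using F that by (auto simp: x0_def)
  have "eventually (\<lambda>n. \<forall>E\<in>F. \<exists>z. x0 E < z \<and> z < E \<and> q z n = 0) sequentially"
    using F x0 by (intro eventually_ball_finite ballI zero_left_of_l2_point) auto
  then show ?thesis
  proof eventually_elim
    case (elim n)
    then obtain z where z: "\<And>E. E \<in> F \<Longrightarrow> x0 E < z E \<and> z E < E \<and> q (z E) n = 0" by metis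
    have "inj_on z F"
    proof (rule linorder_inj_onI)
      fix E E' assume "E < E'" "E \<in> F" "E' \<in> F"
      then have "z E < z E'" using z[of E] z[of E'] x0(3)[of E' E] by linarith
      then show "z E \<noteq> z E'" by simp
    qed auto
    moreover have "z ` F \<subseteq> {x. x > 2 \<and> q x n = 0}" using z x0(2) by fastforce
    moreover have "finite {x. x > 2 \<and> q x n = 0}" by (rule finite_subset[OF _ finite_zeros[of n]]) auto
    ultimately show ?case by (metis card_image card_mono)
  qed
qed

text \<open>A finite cover by the local neighbourhoods admits at most as many zeros as it has
  eigenvalues among its centres, and any finite set of eigenvalues produces as many zeros as it has
  elements. Together this gives finiteness and equality.\<close>

theorem exterior_zero_count:
  shows "finite {x \<in> l2_points. x > 2}"
    and "eventually (\<lambda>n. card {x. x > 2 \<and> q x n = 0} = card {x \<in> l2_points. x > 2}) sequentially"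
proof -
  obtain B where B: "\<And>x n. x \<ge> B \<Longrightarrow> q x n \<noteq> 0" using zeros_bounded by blast
  have "\<forall>E\<in>{2..B}. \<exists>r n0. r > 0 \<and> (\<forall>n\<ge>n0. card {x. 2 < x \<and> \<bar>x - E\<bar> < r \<and> q x n = 0}
          \<le> (if E > 2 \<and> E \<in> l2_points then 1 else 0))"
  proof
    fix E assume "E \<in> {2..B}"
    then have "E \<ge> 2" by simp
    then obtain r n0 where "r > 0" "\<And>n. n \<ge> n0 \<Longrightarrow>
        card {x. 2 < x \<and> \<bar>x - E\<bar> < r \<and> q x n = 0} \<le> (if E > 2 \<and> E \<in> l2_points then 1 else 0)"
      by (rule local_zero_bound) blast
    then show "\<exists>r n0. r > 0 \<and> (\<forall>n\<ge>n0. card {x. 2 < x \<and> \<bar>x - E\<bar> < r \<and> q x n = 0}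
          \<le> (if E > 2 \<and> E \<in> l2_points then 1 else 0))"
      by blast
  qed
  from bchoice[OF this] obtain r where r: "\<forall>E\<in>{2..B}. \<exists>n0. r E > 0 \<and>
      (\<forall>n\<ge>n0. card {x. 2 < x \<and> \<bar>x - E\<bar> < r E \<and> q x n = 0} \<le> (if E > 2 \<and> E \<in> l2_points then 1 else 0))" ..
  from bchoice[OF r] obtain n0 where n0: "\<forall>E\<in>{2..B}. r E > 0 \<and>
      (\<forall>n\<ge>n0 E. card {x. 2 < x \<and> \<bar>x - E\<bar> < r E \<and> q x n = 0} \<le> (if E > 2 \<and> E \<in> l2_points then 1 else 0))" ..
  obtain C where C: "C \<subseteq> {2..B}" "finite C" "{2..B} \<subseteq> (\<Union>E\<in>C. ball E (r E))"
  proof (rule compactE_image[of "{2..B}" "{2..B}" "\<lambda>E. ball E (r E)"])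
    show "{2..B} \<subseteq> (\<Union>E\<in>{2..B}. ball E (r E))" using n0 by auto
  qed auto
  let ?G = "{E \<in> C. E > 2 \<and> E \<in> l2_points}"
  have "eventually (\<lambda>n. \<forall>E\<in>C. n \<ge> n0 E) sequentially"
    using C(2) by (intro eventually_ball_finite) (auto intro: eventually_ge_at_top)
  then have upper: "eventually (\<lambda>n. card {x. x > 2 \<and> q x n = 0} \<le> card ?G) sequentially"
  proof eventually_elim
    case (elim n)
    let ?Z = "\<lambda>E. {x. 2 < x \<and> \<bar>x - E\<bar> < r E \<and> q x n = 0}"
    have fin: "finite (?Z E)" for E by (rule finite_subset[OF _ finite_zeros[of n]]) auto
    have "{x. x > 2 \<and> q x n = 0} \<subseteq> (\<Union>E\<in>C. ?Z E)"
    proof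
      fix x assume x: "x \<in> {x. x > 2 \<and> q x n = 0}"
      then have "x \<in> {2..B}" using B[of x n] by force
      then obtain E where "E \<in> C" "x \<in> ball E (r E)" using C(3) by auto
      then show "x \<in> (\<Union>E\<in>C. ?Z E)" using x by (auto simp: dist_real_def abs_minus_commute)
    qed
    then have "card {x. x > 2 \<and> q x n = 0} \<le> card (\<Union>E\<in>C. ?Z E)"
      using C(2) fin by (intro card_mono) auto
    also have "\<dots> \<le> (\<Sum>E\<in>C. card (?Z E))" by (rule card_UN_le[OF C(2)])
    also have "\<dots> \<le> (\<Sum>E\<in>C. if E > 2 \<and> E \<in> l2_points then 1 else 0)"
    proof (rule sum_mono)
      fix E assume "E \<in> C"
      then have "E \<in> {2..B}" "n \<ge> n0 E" using C(1) elim by auto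
      then show "card (?Z E) \<le> (if E > 2 \<and> E \<in> l2_points then 1 else 0)" using n0 by blast
    qed
    also have "\<dots> = card ?G" using C(2) by (simp add: sum.If_cases Int_def)
    finally show ?case .
  qed
  have bd: "card F \<le> card ?G" if "F \<subseteq> {x \<in> l2_points. x > 2}" "finite F" for F
  proof -
    have "eventually (\<lambda>n. card F \<le> card ?G) sequentially"
      using zeros_exceed_finite_subset[OF that(2,1)] upper by eventually_elim simp
    then show ?thesis by simp
  qed
  have fin: "finite {x \<in> l2_points. x > 2}" and le: "card {x \<in> l2_points. x > 2} \<le> card ?G"
    using finite_if_finite_subsets_card_bdd[of "{x \<in> l2_points. x > 2}" "card ?G"] bd by auto
  have ge: "card ?G \<le> card {x \<in> l2_points. x > 2}" using fin by (intro card_mono) auto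
  show "finite {x \<in> l2_points. x > 2}" by fact
  show "eventually (\<lambda>n. card {x. x > 2 \<and> q x n = 0} = card {x \<in> l2_points. x > 2}) sequentially"
    using zeros_exceed_finite_subset[OF fin order_refl] upper
    by eventually_elim (use le ge in simp)
qed


section \<open>Solutions on the scale 2 - x = O(1/n^2)\<close>

text \<open>The comparison is with the solution at \<open>x = 2\<close>: by the Christoffel-Darboux formula the ratio
  of the two solutions changes by \<open>O((2 - x) n)\<close> in the \<open>n\<close>-th step, as long as it stays bounded.\<close>

lemma edge_behaviour:
  obtains s \<sigma> C T0 :: real where "s = 1 \<or> s = -1" "\<sigma> = 0 \<or> \<sigma> = 1" "C > 0" "T0 > 0"
    "\<And>T. 0 < T \<Longrightarrow> T \<le> T0 \<Longrightarrow> \<exists>M\<ge>1. \<forall>n\<ge>M. \<forall>x. 0 \<le> x \<longrightarrow> x \<le> 2 \<longrightarrow>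
       (2 - x) * (real n)\<^sup>2 \<le> T\<^sup>2 \<longrightarrow>
       s * q x n > 0 \<and> \<bar>real n * (1 - q x (n - 1) / q x n) - \<sigma>\<bar> \<le> C * T\<^sup>2"
proof -
  obtain s \<sigma> :: real and M where s: "s = 1 \<or> s = -1" and \<sigma>: "\<sigma> = 0 \<or> \<sigma> = 1" and M1: "M \<ge> 1"
    and M: "\<And>n. n \<ge> M \<Longrightarrow> s * q 2 n > 0"
    and lim: "(\<lambda>n. real n * (1 - q 2 (n - 1) / q 2 n)) \<longlonglongrightarrow> \<sigma>"
    by (rule edge_asymptotics) (rule that)
  have ss: "s * s = 1" using s by auto
  define u where "u n = s * q 2 n" for n
  have u_pos: "u n > 0" if "n \<ge> M" for n using M[OF that] by (simp add: u_def)
  have ratio_u: "q 2 (n - 1) / q 2 n = u (n - 1) / u n" for n using s by (auto simp: u_def)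
  \<comment> \<open>The upper bound 2 gives \<open>u_lo\<close>, since \<open>Suc n\<close> is at
    least 4. The lower bound -1/12 lets \<open>u\<close> decrease only so slowly that the induction
    for \<open>R\<close> still closes.\<close>
  have "eventually (\<lambda>n. -(1/12) < real n * (1 - q 2 (n - 1) / q 2 n)) sequentially"
    using \<sigma> by (intro order_tendstoD(1)[OF lim]) auto
  moreover have "eventually (\<lambda>n. real n * (1 - q 2 (n - 1) / q 2 n) < 2) sequentially"
    using \<sigma> by (intro order_tendstoD(2)[OF lim]) auto
  moreover have "eventually (\<lambda>n. n \<ge> max M 4) sequentially" by (rule eventually_ge_at_top)
  ultimately have "eventually (\<lambda>n. a n \<ge> 1 / 2 \<and> n \<ge> 4 \<and> n \<ge> M \<and>
      - (1/12) < real n * (1 - u (n - 1) / u n) \<and> real n * (1 - u (n - 1) / u n) < 2) sequentially"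
    using eventually_a_ge_half unfolding ratio_u by eventually_elim auto
  then obtain L where L: "\<And>n. n \<ge> L \<Longrightarrow> a n \<ge> 1 / 2 \<and> n \<ge> 4 \<and> n \<ge> M \<and>
      - (1/12) < real n * (1 - u (n - 1) / u n) \<and> real n * (1 - u (n - 1) / u n) < 2"
    by (auto simp: eventually_sequentially)
  have L4: "L \<ge> 4" "L \<ge> M" using L[of L] by auto
  have uL: "u n > 0" if "n \<ge> L" for n using u_pos L4 that by simp
  have u_up: "u n \<le> (1 + 1 / (12 * real (Suc n))) * u (Suc n)" if "n \<ge> L" for n
    using L[of "Suc n"] uL[of "Suc n"] that by (simp add: field_simps)
  have u_lo: "u n \<ge> u (Suc n) / 2" if "n \<ge> L" for n
  proof -
    have "real (Suc n) * (u (Suc n) - u n) < 2 * u (Suc n)"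
      using L[of "Suc n"] uL[of "Suc n"] that by (simp add: field_simps)
    moreover have "4 * (u (Suc n) - u n) \<le> real (Suc n) * (u (Suc n) - u n)" if "u (Suc n) > u n"
      using that \<open>n \<ge> L\<close> L4 by (intro mult_right_mono) auto
    ultimately show ?thesis using uL[of "Suc n"] that by (cases "u (Suc n) > u n") auto
  qed
  \<comment> \<open>Almost monotone growth bounds the sum of squares by a multiple of
    \<open>n\<close> times the last square, for both values of \<open>\<sigma>\<close>; this
    controls the kernel sum.\<close>
  have R: "(\<Sum>k\<in>{L..<n}. (u k)\<^sup>2) \<le> 2 * real n * (u n)\<^sup>2" if "n \<ge> L" for n
    using that
  proof (induction n rule: dec_induct)
    case (step n)
    define y where "y = 1 / real (Suc n)"
    have y: "0 < y" "y \<le> 1" "real n * y = 1 - y" by (auto simp: y_def field_simps)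
    have y12: "1 / (12 * real (Suc n)) = y / 12" by (simp add: y_def)
    have "u n \<le> (1 + y / 12) * u (Suc n)" using u_up[OF step(1)] unfolding y12 .
    then have "(u n)\<^sup>2 \<le> ((1 + y / 12) * u (Suc n))\<^sup>2"
      using uL[OF step(1)] by (intro power_mono) auto
    then have "(2 * real n + 1) * (u n)\<^sup>2 \<le> (2 * real n + 1) * ((1 + y / 12)\<^sup>2 * (u (Suc n))\<^sup>2)"
      by (intro mult_left_mono) (auto simp: power_mult_distrib)
    also have "\<dots> = ((2 * real n + 1) * (1 + y / 12)\<^sup>2) * (u (Suc n))\<^sup>2" by (simp add: mult.assoc)
    also have "\<dots> \<le> (2 * real (Suc n)) * (u (Suc n))\<^sup>2"
    proof (rule mult_right_mono)
      have "y\<^sup>2 \<le> y" using y by (simp add: power2_eq_square)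
      moreover have "(1 + y / 12)\<^sup>2 = 1 + y / 6 + y\<^sup>2 / 144"
        by (simp add: power2_eq_square algebra_simps)
      ultimately have "(1 + y / 12)\<^sup>2 \<le> 1 + y / 4" using y by linarith
      then have "(2 * real n + 1) * (1 + y / 12)\<^sup>2 \<le> (2 * real n + 1) * (1 + y / 4)"
        by (intro mult_left_mono) auto
      also have "\<dots> = 2 * real n + 1 + (real n * y) / 2 + y / 4" by (simp add: algebra_simps)
      also have "\<dots> \<le> 2 * real (Suc n)" unfolding of_nat_Suc y(3) using y(1,2) by argo
      finally show "(2 * real n + 1) * (1 + y / 12)\<^sup>2 \<le> 2 * real (Suc n)" .
    qed simp
    finally have "(2 * real n + 1) * (u n)\<^sup>2 \<le> 2 * real (Suc n) * (u (Suc n))\<^sup>2" .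
    then show ?case using step by (simp add: distrib_right)
  qed simp
  \<comment> \<open>Lower bound for \<open>n * (u n)^2\<close>, through which the contribution
    \<open>C0\<close> of the indices below \<open>L\<close> is absorbed.\<close>
  define c where "c = (u L)\<^sup>2 / 2"
  have c: "c > 0" using uL[of L] by (simp add: c_def)
  have nu: "c \<le> real (Suc n) * (u (Suc n))\<^sup>2" if "n \<ge> L" for n
  proof -
    have "(\<Sum>k\<in>{L}. (u k)\<^sup>2) \<le> (\<Sum>k\<in>{L..<Suc n}. (u k)\<^sup>2)"
      using that by (intro sum_mono2) auto
    then have "(u L)\<^sup>2 \<le> (\<Sum>k\<in>{L..<Suc n}. (u k)\<^sup>2)" by simp
    also have "\<dots> \<le> 2 * real (Suc n) * (u (Suc n))\<^sup>2" using that by (intro R) simp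
    finally have "(u L)\<^sup>2 \<le> 2 * (real (Suc n) * (u (Suc n))\<^sup>2)" by (simp only: mult.assoc)
    then show ?thesis unfolding c_def by argo
  qed
  have "compact ((\<lambda>x. \<Sum>k<L. q x k * q 2 k) ` {0..2})"
    by (intro compact_continuous_image continuous_intros) auto
  then have "bounded ((\<lambda>x. \<Sum>k<L. q x k * q 2 k) ` {0..2})" by (rule compact_imp_bounded)
  then obtain C0 where C0: "C0 > 0" "\<And>x. x \<in> {0..2} \<Longrightarrow> \<bar>\<Sum>k<L. q x k * q 2 k\<bar> \<le> C0"
    by (auto simp: bounded_pos)
  \<comment> \<open>\<open>C / 4\<close> bounds the kernel sum in units of
    \<open>n * (u n)^2\<close>; the factor 4 pays for \<open>a (Suc n) \<ge> 1 / 2\<close> and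
    \<open>u n \<ge> u (Suc n) / 2\<close>.\<close>
  define C where "C = 4 * (C0 / c + 4)"
  have C: "C > 0" using C0 c by (simp add: C_def add_pos_pos)
  define r where "r x n = q x n / q 2 n" for x n
  have r_eq: "s * q x n = r x n * u n" if "n \<ge> L" for x n
    using uL[OF that] s by (auto simp: r_def u_def)
  have "isCont (\<lambda>x. 1 / 4 - \<bar>r x L - 1\<bar>) 2"
    using uL[of L] unfolding r_def by (intro continuous_intros) (auto simp: u_def)
  moreover have "1 / 4 - \<bar>r 2 L - 1\<bar> > 0" using uL[of L] by (auto simp: r_def u_def)
  ultimately obtain d where d: "d > 0" "\<And>x. dist x 2 < d \<Longrightarrow> 1 / 4 - \<bar>r x L - 1\<bar> > 0"
    by (rule isCont_pos_nbhd) auto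
  have diff: "\<bar>r x (Suc n) - r x n\<bar> \<le> C * (2 - x) * real (Suc n)"
    if x: "0 \<le> x" "x \<le> 2" and n: "n \<ge> L" and bd: "\<And>k. L \<le> k \<Longrightarrow> k \<le> n \<Longrightarrow> \<bar>r x k\<bar> \<le> 2" for x n
  proof -
    let ?S = "\<Sum>k\<le>n. q x k * q 2 k"
    have us: "u n > 0" "u (Suc n) > 0" "a (Suc n) \<ge> 1 / 2" using uL L n by auto
    have "\<bar>?S\<bar> \<le> \<bar>\<Sum>k<L. q x k * q 2 k\<bar> + \<bar>\<Sum>k\<in>{L..<Suc n}. q x k * q 2 k\<bar>"
    proof -
      have "{..n} = {..<L} \<union> {L..<Suc n}" using n by auto
      then have "?S = sum (\<lambda>k. q x k * q 2 k) ({..<L} \<union> {L..<Suc n})" by simp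
      also have "\<dots> = (\<Sum>k<L. q x k * q 2 k) + (\<Sum>k\<in>{L..<Suc n}. q x k * q 2 k)"
        by (rule sum.union_disjoint) auto
      finally show ?thesis by simp
    qed
    also have "\<dots> \<le> C0 + (\<Sum>k\<in>{L..<Suc n}. 2 * (u k)\<^sup>2)"
    proof (intro add_mono C0 order_trans[OF sum_abs] sum_mono)
      fix k assume k: "k \<in> {L..<Suc n}"
      have "q x k * q 2 k = (s * s) * (q x k * q 2 k)" using ss by simp
      also have "\<dots> = (s * q x k) * u k" by (simp only: u_def mult_ac)
      also have "\<dots> = r x k * (u k)\<^sup>2" using r_eq[of k x] k by (simp add: power2_eq_square)
      finally show "\<bar>q x k * q 2 k\<bar> \<le> 2 * (u k)\<^sup>2" using bd[of k] k by (simp add: abs_mult mult_right_mono)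
    qed (use x in auto)
    also have "\<dots> \<le> (C0 / c) * (real (Suc n) * (u (Suc n))\<^sup>2) + 4 * (real (Suc n) * (u (Suc n))\<^sup>2)"
    proof (rule add_mono)
      have "C0 = (C0 / c) * c" using c by simp
      also have "\<dots> \<le> (C0 / c) * (real (Suc n) * (u (Suc n))\<^sup>2)"
        using nu[OF n] C0 c by (intro mult_left_mono) auto
      finally show "C0 \<le> (C0 / c) * (real (Suc n) * (u (Suc n))\<^sup>2)" .
      show "(\<Sum>k\<in>{L..<Suc n}. 2 * (u k)\<^sup>2) \<le> 4 * (real (Suc n) * (u (Suc n))\<^sup>2)"
        unfolding sum_distrib_left[symmetric] using R[OF le_SucI[OF n]] by (simp only: mult.assoc)
    qed
    also have "\<dots> = (C / 4) * real (Suc n) * (u (Suc n))\<^sup>2"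
      unfolding C_def by (simp only: distrib_right[symmetric] mult.assoc) simp
    finally have S: "\<bar>?S\<bar> \<le> (C / 4) * real (Suc n) * (u (Suc n))\<^sup>2" .
    have "(x - 2) * ?S = (s * s) * (a (Suc n) * (q x (Suc n) * q 2 n - q x n * q 2 (Suc n)))"
      using q_CD[of x 2 n] ss by simp
    also have "\<dots> = a (Suc n) * ((s * q x (Suc n)) * u n - (s * q x n) * u (Suc n))"
      by (simp add: u_def algebra_simps)
    also have "\<dots> = a (Suc n) * u n * u (Suc n) * (r x (Suc n) - r x n)"
      using r_eq[of n x] r_eq[of "Suc n" x] n by (simp add: algebra_simps)
    finally have eq: "(x - 2) * ?S = a (Suc n) * u n * u (Suc n) * (r x (Suc n) - r x n)" .
    have "(1 / 2) * (u (Suc n) / 2) * u (Suc n) * \<bar>r x (Suc n) - r x n\<bar>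
        \<le> a (Suc n) * u n * u (Suc n) * \<bar>r x (Suc n) - r x n\<bar>"
      using us u_lo[OF n] by (intro mult_right_mono mult_mono) auto
    also have "\<dots> = \<bar>a (Suc n) * u n * u (Suc n) * (r x (Suc n) - r x n)\<bar>"
      using us by (simp add: abs_mult)
    also have "\<dots> = (2 - x) * \<bar>?S\<bar>" using x by (simp add: eq[symmetric] abs_mult)
    also have "\<dots> \<le> (2 - x) * ((C / 4) * real (Suc n) * (u (Suc n))\<^sup>2)"
      using S x by (intro mult_left_mono) auto
    finally have "((u (Suc n))\<^sup>2 / 4) * \<bar>r x (Suc n) - r x n\<bar> \<le> ((u (Suc n))\<^sup>2 / 4) * (C * (2 - x) * real (Suc n))"
      by (simp add: power2_eq_square mult_ac)
    then show ?thesis using us by (simp add: mult_le_cancel_left)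
  qed
  \<comment> \<open>The ratio moves by at most 1/4 from its value at \<open>L\<close>, which is
    within 1/4 of 1. So the bound \<open>\<bar>r x k\<bar> \<le> 2\<close> demanded by
    \<open>diff\<close> reproduces itself in the induction.\<close>
  define T0 where "T0 = sqrt (1 / (4 * C))"
  have T0: "T0 > 0" "C * T0\<^sup>2 = 1 / 4" using C by (auto simp: T0_def)
  have main: "\<bar>r x n - r x L\<bar> \<le> C * (2 - x) * (real n)\<^sup>2" "\<bar>r x n - 1\<bar> \<le> 1 / 2"
    if x: "0 \<le> x" "x \<le> 2" "2 - x < d" and n: "n \<ge> L" and small: "(2 - x) * (real n)\<^sup>2 \<le> T0\<^sup>2" for x n
  proof -
    have "(2 - x) * (real n)\<^sup>2 \<le> T0\<^sup>2 \<longrightarrow> (\<forall>k\<in>{L..n}. \<bar>r x k - r x L\<bar> \<le> C * (2 - x) * (real k)\<^sup>2 \<and> \<bar>r x k - 1\<bar> \<le> 1 / 2)"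
      using n
    proof (induction n rule: dec_induct)
      case base
      then show ?case using d(2)[of x] x C by (auto simp: dist_real_def)
    next
      case (step n)
      show ?case
      proof
        assume sm: "(2 - x) * (real (Suc n))\<^sup>2 \<le> T0\<^sup>2"
        have "(2 - x) * (real n)\<^sup>2 \<le> (2 - x) * (real (Suc n))\<^sup>2"
          using x by (intro mult_left_mono power_mono) auto
        with sm step.IH have IH: "\<forall>k\<in>{L..n}. \<bar>r x k - r x L\<bar> \<le> C * (2 - x) * (real k)\<^sup>2 \<and> \<bar>r x k - 1\<bar> \<le> 1 / 2"
          by auto
        have "\<bar>r x k\<bar> \<le> 2" if "L \<le> k" "k \<le> n" for k
        proof -
          have "\<bar>r x k - 1\<bar> \<le> 1 / 2" using IH that by auto
          then show ?thesis by linarith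
        qed
        then have "\<bar>r x (Suc n) - r x n\<bar> \<le> C * (2 - x) * real (Suc n)"
          using x step(1) by (intro diff) auto
        moreover have "\<bar>r x n - r x L\<bar> \<le> C * (2 - x) * (real n)\<^sup>2" using IH step by auto
        moreover have "C * (2 - x) * (real n)\<^sup>2 + C * (2 - x) * real (Suc n) \<le> C * (2 - x) * (real (Suc n))\<^sup>2"
          using C x by (subst distrib_left[symmetric], intro mult_left_mono) (auto simp: power2_eq_square algebra_simps)
        ultimately have 1: "\<bar>r x (Suc n) - r x L\<bar> \<le> C * (2 - x) * (real (Suc n))\<^sup>2" by linarith
        also have "\<dots> \<le> C * T0\<^sup>2" using sm C by (simp add: mult.assoc)
        finally have "\<bar>r x (Suc n) - r x L\<bar> \<le> 1 / 4" using T0 by simp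
        moreover have "\<bar>r x L - 1\<bar> \<le> 1 / 4" using d(2)[of x] x by (auto simp: dist_real_def)
        ultimately have "\<bar>r x (Suc n) - 1\<bar> \<le> 1 / 2" by linarith
        with 1 IH show "\<forall>k\<in>{L..Suc n}. \<bar>r x k - r x L\<bar> \<le> C * (2 - x) * (real k)\<^sup>2 \<and> \<bar>r x k - 1\<bar> \<le> 1 / 2"
          by (auto simp: le_Suc_eq)
      qed
    qed
    then show "\<bar>r x n - r x L\<bar> \<le> C * (2 - x) * (real n)\<^sup>2" "\<bar>r x n - 1\<bar> \<le> 1 / 2"
      using small n by auto
  qed
  show thesis
  proof (rule that[of s \<sigma> "4 * C + 1" T0])
    fix T :: real assume T: "0 < T" "T \<le> T0"
    have "eventually (\<lambda>n. \<bar>real n * (1 - q 2 (n - 1) / q 2 n) - \<sigma>\<bar> < T\<^sup>2) sequentially"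
      using tendstoD[OF lim, of "T\<^sup>2"] T by (simp add: dist_real_def)
    then obtain K where K: "\<And>n. n \<ge> K \<Longrightarrow> \<bar>real n * (1 - q 2 (n - 1) / q 2 n) - \<sigma>\<bar> < T\<^sup>2"
      by (auto simp: eventually_sequentially)
    \<comment> \<open>From \<open>K'\<close> on, the condition
      \<open>(2 - x) * n^2 \<le> T^2\<close> forces \<open>2 - x < d\<close>.\<close>
    obtain K' where K': "real K' > T\<^sup>2 / d" using reals_Archimedean2 by blast
    show "\<exists>M\<ge>1. \<forall>n\<ge>M. \<forall>x. 0 \<le> x \<longrightarrow> x \<le> 2 \<longrightarrow> (2 - x) * (real n)\<^sup>2 \<le> T\<^sup>2 \<longrightarrow>
       s * q x n > 0 \<and> \<bar>real n * (1 - q x (n - 1) / q x n) - \<sigma>\<bar> \<le> (4 * C + 1) * T\<^sup>2"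
    proof (intro exI[of _ "Suc (max L (max K K'))"] conjI allI impI)
      fix n x assume n: "Suc (max L (max K K')) \<le> n" and x: "0 \<le> x" "x \<le> (2::real)"
        and small: "(2 - x) * (real n)\<^sup>2 \<le> T\<^sup>2"
      have n1: "n \<ge> 1" "n - 1 \<ge> L" "Suc (n - 1) = n" "n \<ge> L" "n \<ge> K" using n by auto
      have TT: "T\<^sup>2 \<le> T0\<^sup>2" using T by (intro power_mono) auto
      have small': "(2 - x) * (real (n - 1))\<^sup>2 \<le> T\<^sup>2"
      proof -
        have "(2 - x) * (real (n - 1))\<^sup>2 \<le> (2 - x) * (real n)\<^sup>2"
          using x by (intro mult_left_mono power_mono) auto
        with small show ?thesis by simp
      qed
      have "(2 - x) * real n \<le> (2 - x) * (real n)\<^sup>2"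
        using x n1 by (intro mult_left_mono) (auto simp: power2_eq_square)
      moreover have "T\<^sup>2 < d * real n"
      proof -
        have "T\<^sup>2 < d * real K'" using K' d by (simp add: field_simps)
        also have "\<dots> \<le> d * real n" using d n by (intro mult_left_mono) auto
        finally show ?thesis .
      qed
      ultimately have "(2 - x) * real n < d * real n" using small by linarith
      then have xd: "2 - x < d" by (rule mult_right_less_imp_less) simp
      have bd: "\<bar>r x k\<bar> \<le> 2" if "L \<le> k" "k \<le> n" for k
      proof -
        have "(2 - x) * (real k)\<^sup>2 \<le> (2 - x) * (real n)\<^sup>2"
          using x that by (intro mult_left_mono power_mono) auto
        then have "\<bar>r x k - 1\<bar> \<le> 1 / 2" using main(2)[OF x xd, of k] that small TT by simp
        then show ?thesis by linarith
      qed
      have rn: "\<bar>r x n - 1\<bar> \<le> 1 / 2" using main(2)[OF x xd, of n] n1 small TT by simp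
      have dr: "\<bar>r x n - r x (n - 1)\<bar> \<le> C * (2 - x) * real n"
        using diff[OF x, of "n - 1"] bd n1 by auto
      have un: "u n > 0" "u (n - 1) > 0" using uL n1 by auto
      have rpos: "r x n \<ge> 1 / 2" using rn by linarith
      have pos: "s * q x n > 0" using r_eq[of n x] n1 un rpos by simp
      define \<rho> where "\<rho> = u (n - 1) / u n"
      have \<rho>: "0 < \<rho>" "\<rho> \<le> 2"
      proof -
        show "0 < \<rho>" using un by (simp add: \<rho>_def)
        have "1 / (12 * real (Suc (n - 1))) \<le> 1" using n1 by (simp add: field_simps)
        then have "(1 + 1 / (12 * real (Suc (n - 1)))) * u (Suc (n - 1)) \<le> 2 * u n"
          using un n1 by (simp only: n1(3)) (intro mult_right_mono, auto)
        then have "u (n - 1) \<le> 2 * u n" using u_up[of "n - 1"] n1 by linarith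
        then show "\<rho> \<le> 2" using un by (simp add: \<rho>_def field_simps)
      qed
      have "q x (n - 1) / q x n = (s * q x (n - 1)) / (s * q x n)" using s by auto
      also have "\<dots> = \<rho> * (r x (n - 1) / r x n)"
        using r_eq[of n x] r_eq[of "n - 1" x] n1 by (simp add: \<rho>_def mult.commute)
      finally have eq: "q x (n - 1) / q x n = \<rho> * (r x (n - 1) / r x n)" .
      \<comment> \<open>Separates the edge solution, responsible for \<open>\<sigma>\<close>, from
        the variation of the ratio \<open>r\<close>. With \<open>\<rho> \<le> 2\<close> and
        \<open>r x n \<ge> 1 / 2\<close> the latter contributes the
        \<open>4 * C * T^2\<close>.\<close>
      have split: "1 - q x (n - 1) / q x n = (1 - \<rho>) + \<rho> * ((r x n - r x (n - 1)) / r x n)"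
        unfolding eq using rpos by (simp add: field_simps)
      have "real n * (1 - q x (n - 1) / q x n) - \<sigma>
          = (real n * (1 - \<rho>) - \<sigma>) + real n * (\<rho> * ((r x n - r x (n - 1)) / r x n))"
        unfolding split distrib_left by (rule diff_add_eq[symmetric])
      moreover have "\<bar>real n * (1 - \<rho>) - \<sigma>\<bar> \<le> T\<^sup>2"
        using K[OF n1(5)] unfolding ratio_u \<rho>_def by (rule less_imp_le)
      moreover have "\<bar>real n * (\<rho> * ((r x n - r x (n - 1)) / r x n))\<bar> \<le> 4 * C * T\<^sup>2"
      proof -
        have "\<bar>real n * (\<rho> * ((r x n - r x (n - 1)) / r x n))\<bar>
            = real n * (\<rho> * (\<bar>r x n - r x (n - 1)\<bar> / r x n))"
          using \<rho> rpos by (simp add: abs_mult)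
        also have "\<dots> \<le> real n * (2 * ((C * (2 - x) * real n) / (1 / 2)))"
          using \<rho> rpos dr C x by (intro mult_left_mono mult_mono frac_le) auto
        also have "\<dots> = 4 * C * ((2 - x) * (real n)\<^sup>2)" by (simp add: power2_eq_square algebra_simps)
        also have "\<dots> \<le> 4 * C * T\<^sup>2" using small C by (intro mult_left_mono) auto
        finally show ?thesis .
      qed
      moreover have "z = v + w \<Longrightarrow> \<bar>v\<bar> \<le> T\<^sup>2 \<Longrightarrow> \<bar>w\<bar> \<le> 4 * C * T\<^sup>2 \<Longrightarrow> \<bar>z\<bar> \<le> (4 * C + 1) * T\<^sup>2" for z v w
        unfolding distrib_right by linarith
      ultimately have "\<bar>real n * (1 - q x (n - 1) / q x n) - \<sigma>\<bar> \<le> (4 * C + 1) * T\<^sup>2"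
        by blast
      with pos show "s * q x n > 0" "\<bar>real n * (1 - q x (n - 1) / q x n) - \<sigma>\<bar> \<le> (4 * C + 1) * T\<^sup>2"
        by auto
    qed simp
  qed (use s \<sigma> C T0 in auto)
qed

end

section \<open>Phases inside the essential spectrum\<close>

text \<open>The change of length and the change of the vector contribute
  \<open>norm (u - v) / norm v\<close> each.\<close>

lemma norm_sgn_diff_le:
  fixes u v :: "'a::real_normed_vector"
  assumes "v \<noteq> 0"
  shows "norm (sgn u - sgn v) \<le> 2 * norm (u - v) / norm v"
proof (cases "u = 0")
  case True
  then show ?thesis using assms by (simp add: norm_sgn)
next
  case False
  have "sgn u - sgn v = (inverse (norm u) - inverse (norm v)) *\<^sub>R u + inverse (norm v) *\<^sub>R (u - v)"
    by (simp add: sgn_div_norm algebra_simps)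
  then have "norm (sgn u - sgn v)
      \<le> norm ((inverse (norm u) - inverse (norm v)) *\<^sub>R u) + norm (inverse (norm v) *\<^sub>R (u - v))"
    by (simp only: norm_triangle_ineq)
  also have "\<dots> = \<bar>inverse (norm u) - inverse (norm v)\<bar> * norm u + inverse (norm v) * norm (u - v)"
    by simp
  also have "inverse (norm u) - inverse (norm v) = (norm v - norm u) / (norm u * norm v)"
    using False assms by (simp add: field_simps)
  also have "\<bar>(norm v - norm u) / (norm u * norm v)\<bar> * norm u = \<bar>norm v - norm u\<bar> / norm v"
    using False by (simp add: abs_mult)
  also have "\<dots> \<le> norm (u - v) / norm v"
    using norm_triangle_ineq3[of v u] by (intro divide_right_mono) (auto simp: norm_minus_commute)
  finally show ?thesis by (simp add: field_simps)
qed

context jacobi_polys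
begin

text \<open>For vanishing perturbation \<open>Y t\<close> would not depend on \<open>n\<close>. Up to sign, its argument is the
  deviation of the Pruefer phase of the solution at \<open>x = 2 cos t\<close> from \<open>n t\<close>.\<close>

definition X :: "real \<Rightarrow> nat \<Rightarrow> complex" where
  "X t n = cis t * of_real (q (2 * cos t) n) - of_real (q (2 * cos t) (n - 1))"

definition Y :: "real \<Rightarrow> nat \<Rightarrow> complex" where
  "Y t n = cis (- (real n * t)) * X t n"

lemma X_eq: "X t n = cis (real n * t) * Y t n"
  by (simp add: Y_def cis_mult flip: mult.assoc)

lemma norm_Y: "norm (Y t n) = norm (X t n)"
  by (simp add: Y_def norm_mult)

lemma Im_X: "Im (X t n) = sin t * q (2 * cos t) n"
  by (simp add: X_def)

lemma X_nonzero:
  assumes "sin t \<noteq> 0" "n \<ge> 1"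
  shows "X t n \<noteq> 0"
proof
  assume 0: "X t n = 0"
  then have "q (2 * cos t) n = 0" using Im_X[of t n] assms by simp
  moreover from this 0 have "q (2 * cos t) (n - 1) = 0" by (simp add: X_def)
  ultimately show False using q_consecutive_nonzero[of "2 * cos t" "n - 1"] assms by simp
qed

lemma Y_nonzero: "sin t \<noteq> 0 \<Longrightarrow> n \<ge> 1 \<Longrightarrow> Y t n \<noteq> 0"
  using X_nonzero[of t n] by (auto simp: X_eq)

text \<open>Each value times \<open>sin t\<close> is an imaginary part, one of \<open>X t n\<close>
  and the other of \<open>cis (- t) * X t n\<close>. This division by \<open>sin t\<close> is the
  source of the singularity at the edges.\<close>

lemma abs_q_le_norm_X:
  assumes "sin t > 0" "n \<ge> 1"
  shows "\<bar>q (2 * cos t) n\<bar> \<le> norm (X t n) / sin t"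
    and "\<bar>q (2 * cos t) (n - 1)\<bar> \<le> norm (X t n) / sin t"
proof -
  have "sin t * \<bar>q (2 * cos t) n\<bar> = \<bar>Im (X t n)\<bar>" using assms by (simp add: Im_X abs_mult)
  also have "\<dots> \<le> norm (X t n)" by (rule abs_Im_le_cmod)
  finally show "\<bar>q (2 * cos t) n\<bar> \<le> norm (X t n) / sin t" using assms by (simp add: field_simps)
  have "Im (cis (- t) * X t n) = sin t * q (2 * cos t) (n - 1)"
    by (simp add: X_def algebra_simps)
  then have "sin t * \<bar>q (2 * cos t) (n - 1)\<bar> = \<bar>Im (cis (- t) * X t n)\<bar>" using assms by (simp add: abs_mult)
  also have "\<dots> \<le> norm (cis (- t) * X t n)" by (rule abs_Im_le_cmod)
  also have "\<dots> = norm (X t n)" by (simp add: norm_mult)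
  finally show "\<bar>q (2 * cos t) (n - 1)\<bar> \<le> norm (X t n) / sin t" using assms by (simp add: field_simps)
qed

text \<open>As 2 cos t = cis t + cis (-t), the free recursion multiplies \<open>X\<close> by
  \<open>cis t\<close> and fixes \<open>Y\<close>; what remains is the residual \<open>D\<close> of
  the free recursion. The 6 is three units of \<open>e n\<close> times 2 from
  \<open>a (Suc n) \<ge> 1 / 2\<close>.\<close>

lemma Y_step:
  assumes t: "sin t > 0" and n: "n \<ge> 1" "a (Suc n) \<ge> 1 / 2"
  shows "norm (Y t (Suc n) - Y t n) \<le> (6 * e n / sin t) * norm (Y t n)"
proof -
  let ?x = "2 * cos t"
  have two: "of_real ?x = cis t + cis (- t)"
    by (simp add: complex_eq_iff)
  have cc: "cis t * cis (- t) = 1" by (simp add: cis_mult)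
  have "X t (Suc n) - cis t * X t n
      = cis t * of_real (q ?x (Suc n)) - of_real (q ?x n) - cis t * cis t * of_real (q ?x n)
        + cis t * of_real (q ?x (n - 1))"
    by (simp add: X_def algebra_simps)
  also have "\<dots> = cis t * (of_real (q ?x (Suc n)) - of_real ?x * of_real (q ?x n) + of_real (q ?x (n - 1)))"
    unfolding two using cc by (simp add: algebra_simps)
  also have "\<dots> = cis t * of_real (q ?x (Suc n) - ?x * q ?x n + q ?x (n - 1))" by simp
  finally have eq: "X t (Suc n) - cis t * X t n = cis t * of_real (q ?x (Suc n) - ?x * q ?x n + q ?x (n - 1))" .
  define D where "D = q ?x (Suc n) - ?x * q ?x n + q ?x (n - 1)"
  have "a (Suc n) * D = ((1 - a (Suc n)) * ?x - b (Suc n)) * q ?x n + (a (Suc n) - a n) * q ?x (n - 1)"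
    using q_step[OF n(1), of ?x] by (simp add: D_def algebra_simps)
  then have "\<bar>a (Suc n) * D\<bar> \<le> \<bar>(1 - a (Suc n)) * ?x - b (Suc n)\<bar> * \<bar>q ?x n\<bar> + \<bar>a (Suc n) - a n\<bar> * \<bar>q ?x (n - 1)\<bar>"
    by (metis abs_mult abs_triangle_ineq)
  also have "\<dots> \<le> (2 * e n) * (norm (X t n) / sin t) + e n * (norm (X t n) / sin t)"
  proof (intro add_mono mult_mono abs_q_le_norm_X t n(1))
    have "\<bar>(1 - a (Suc n)) * ?x\<bar> \<le> \<bar>1 - a (Suc n)\<bar> * 2"
      unfolding abs_mult by (intro mult_left_mono) (auto simp: abs_mult)
    then have "\<bar>(1 - a (Suc n)) * ?x - b (Suc n)\<bar> \<le> \<bar>1 - a (Suc n)\<bar> * 2 + \<bar>b (Suc n)\<bar>"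
      by (intro order_trans[OF abs_triangle_ineq4] add_right_mono)
    also have "\<dots> \<le> 2 * e n" by (simp add: e_def abs_minus_commute)
    finally show "\<bar>(1 - a (Suc n)) * ?x - b (Suc n)\<bar> \<le> 2 * e n" .
    show "\<bar>a (Suc n) - a n\<bar> \<le> e n" unfolding e_def by linarith
  qed auto
  also have "\<dots> = 3 * e n * norm (X t n) / sin t" by (simp add: algebra_simps add_divide_distrib)
  finally have "\<bar>a (Suc n) * D\<bar> \<le> 3 * e n * norm (X t n) / sin t" .
  moreover have "(1 / 2) * \<bar>D\<bar> \<le> \<bar>a (Suc n) * D\<bar>"
    unfolding abs_mult using n by (intro mult_right_mono) auto
  ultimately have D: "\<bar>D\<bar> \<le> (6 * e n / sin t) * norm (X t n)" by simp
  have "Y t (Suc n) - Y t n = cis (- (real (Suc n) * t)) * (X t (Suc n) - cis t * X t n)"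
  proof -
    have "cis (- (real (Suc n) * t)) * cis t = cis (- (real n * t))"
      by (simp add: cis_mult algebra_simps)
    then show ?thesis by (simp add: Y_def right_diff_distrib flip: mult.assoc)
  qed
  then have "norm (Y t (Suc n) - Y t n) = \<bar>D\<bar>"
    unfolding eq D_def[symmetric] by (simp only: norm_mult norm_cis norm_of_real mult_1)
  with D show ?thesis by (simp add: norm_Y)
qed

lemma Y_variation:
  assumes t: "sin t > 0" and m: "m \<ge> 1" "\<And>n. n \<ge> m \<Longrightarrow> a n \<ge> 1 / 2" and n: "m \<le> n"
  shows "norm (Y t n - Y t m) \<le> (exp (6 * (\<Sum>k\<in>{m..<n}. e k) / sin t) - 1) * norm (Y t m)"
  using n
proof (induction n rule: dec_induct)
  case (step n)
  define E where "E = exp (6 * (\<Sum>k\<in>{m..<n}. e k) / sin t)"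
  define c where "c = 6 * e n / sin t"
  have c: "c \<ge> 0" using t by (simp add: c_def)
  have "norm (Y t n) \<le> norm (Y t m) + norm (Y t n - Y t m)"
    by (metis add.commute diff_add_cancel norm_triangle_ineq)
  also have "\<dots> \<le> E * norm (Y t m)" using step.IH by (simp add: E_def algebra_simps)
  finally have Yn: "norm (Y t n) \<le> E * norm (Y t m)" .
  have "norm (Y t (Suc n) - Y t m) \<le> norm (Y t (Suc n) - Y t n) + norm (Y t n - Y t m)"
    by (metis diff_add_cancel add_diff_eq norm_triangle_ineq)
  also have "\<dots> \<le> c * (E * norm (Y t m)) + (E - 1) * norm (Y t m)"
  proof (rule add_mono)
    have "norm (Y t (Suc n) - Y t n) \<le> c * norm (Y t n)"
      unfolding c_def using m step by (intro Y_step t) auto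
    also have "\<dots> \<le> c * (E * norm (Y t m))" using Yn c by (intro mult_left_mono)
    finally show "norm (Y t (Suc n) - Y t n) \<le> c * (E * norm (Y t m))" .
  qed (use step.IH in \<open>simp add: E_def\<close>)
  also have "\<dots> = (E * (1 + c) - 1) * norm (Y t m)" by (simp add: algebra_simps)
  also have "\<dots> \<le> (E * exp c - 1) * norm (Y t m)"
    by (intro mult_right_mono diff_right_mono mult_left_mono) (auto simp: E_def)
  also have "E * exp c = exp (6 * (\<Sum>k\<in>{m..<Suc n}. e k) / sin t)"
    using step(1) by (simp add: E_def c_def algebra_simps add_divide_distrib flip: exp_add)
  finally show ?case .
qed simp

text \<open>One factor 2 stems from \<open>exp \<epsilon> - 1 \<le> 2 * \<epsilon>\<close>, the
  other from normalising the vectors.\<close>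

lemma sgn_Y_variation:
  assumes t: "sin t > 0" and m: "m \<ge> 1" "\<And>n. n \<ge> m \<Longrightarrow> a n \<ge> 1 / 2" and n: "m \<le> n"
    and S: "6 * (\<Sum>k\<in>{m..<n}. e k) / sin t \<le> \<epsilon>" "\<epsilon> \<le> 1"
  shows "norm (sgn (Y t n) - sgn (Y t m)) \<le> 4 * \<epsilon>"
proof -
  have nz: "Y t m \<noteq> 0" using Y_nonzero[of t m] t m by simp
  have \<epsilon>0: "\<epsilon> \<ge> 0"
    by (rule order_trans[OF _ S(1)]) (use t in \<open>auto intro!: divide_nonneg_pos mult_nonneg_nonneg sum_nonneg\<close>)
  have "exp \<epsilon> \<le> 1 + \<epsilon> + \<epsilon>\<^sup>2" using \<epsilon>0 S(2) by (rule exp_bound)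
  also have "\<epsilon>\<^sup>2 \<le> \<epsilon>" using \<epsilon>0 S(2) by (simp add: power2_eq_square mult_left_le)
  finally have "exp \<epsilon> - 1 \<le> 2 * \<epsilon>" by simp
  moreover have "exp (6 * (\<Sum>k\<in>{m..<n}. e k) / sin t) \<le> exp \<epsilon>" using S by simp
  ultimately have "exp (6 * (\<Sum>k\<in>{m..<n}. e k) / sin t) - 1 \<le> 2 * \<epsilon>" by linarith
  then have "(exp (6 * (\<Sum>k\<in>{m..<n}. e k) / sin t) - 1) * norm (Y t m) \<le> 2 * \<epsilon> * norm (Y t m)"
    by (rule mult_right_mono) simp
  with Y_variation[OF t m n] have "norm (Y t n - Y t m) \<le> 2 * \<epsilon> * norm (Y t m)" by linarith
  then have "2 * norm (Y t n - Y t m) / norm (Y t m) \<le> 4 * \<epsilon>" using nz by (simp add: field_simps)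
  then show ?thesis using norm_sgn_diff_le[OF nz, of "Y t n"] by linarith
qed

text \<open>The first moment enters here: \<open>m * e k \<le> k * e k\<close> for k \<ge> m, so the
  tails of \<open>e\<close> are o(1/m).\<close>

lemma tail_small:
  assumes "\<epsilon> > 0"
  obtains M where "M \<ge> 1" "\<And>n. n \<ge> M \<Longrightarrow> a n \<ge> 1 / 2"
    "\<And>m n. m \<ge> M \<Longrightarrow> real m * (\<Sum>k\<in>{m..<n}. e k) \<le> \<epsilon>"
proof -
  obtain M1 where M1: "\<And>n. n \<ge> M1 \<Longrightarrow> a n \<ge> 1 / 2"
    using eventually_a_ge_half by (auto simp: eventually_sequentially)
  obtain M2 where M2: "\<And>m n. m \<ge> M2 \<Longrightarrow> norm (\<Sum>k\<in>{m..<n}. real k * e k) < \<epsilon>"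
    using summable_ne assms unfolding summable_Cauchy by blast
  show thesis
  proof (rule that[of "max 1 (max M1 M2)"])
    fix m n assume m: "max 1 (max M1 M2) \<le> m"
    have "real m * (\<Sum>k\<in>{m..<n}. e k) = (\<Sum>k\<in>{m..<n}. real m * e k)" by (rule sum_distrib_left)
    also have "\<dots> \<le> (\<Sum>k\<in>{m..<n}. real k * e k)" by (intro sum_mono mult_right_mono) auto
    also have "\<dots> \<le> \<epsilon>" using M2[of m n] m by simp
    finally show "real m * (\<Sum>k\<in>{m..<n}. e k) \<le> \<epsilon>" .
  qed (use M1 in auto)
qed

lemma continuous_on_sgn_Y:
  assumes "n \<ge> 1" "\<And>t. t \<in> A \<Longrightarrow> sin t \<noteq> 0"
  shows "continuous_on A (\<lambda>t. sgn (Y t n))"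
proof -
  have "continuous_on A (\<lambda>t. Y t n)"
    unfolding Y_def X_def by (intro continuous_intros)
  then show ?thesis
    unfolding sgn_div_norm using assms Y_nonzero by (intro continuous_intros) auto
qed

text \<open>From a fixed index \<open>M\<close> on, the direction stays within
  \<open>4 * \<epsilon>1\<close> of the one at \<open>M\<close>, uniformly on the compact interval,
  and at \<open>M\<close> it is uniformly continuous. So \<open>h\<close> serves all
  \<open>n\<close>, and three such errors make up the 12.\<close>

lemma phase_equicontinuous_interior:
  assumes t0: "0 < t0" "t0 < pi / 2" and \<epsilon>: "\<epsilon> > 0"
  obtains N h where "h > 0"
    "\<And>n t t'. n \<ge> N \<Longrightarrow> t \<in> {t0..pi - t0} \<Longrightarrow> t' \<in> {t0..pi - t0} \<Longrightarrow> \<bar>t - t'\<bar> < h \<Longrightarrow>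
       norm (sgn (Y t n) - sgn (Y t' n)) \<le> \<epsilon>"
proof -
  define \<epsilon>1 where "\<epsilon>1 = min 1 (\<epsilon> / 12)"
  have \<epsilon>1: "\<epsilon>1 > 0" "\<epsilon>1 \<le> 1" "12 * \<epsilon>1 \<le> \<epsilon>" using \<epsilon> by (auto simp: \<epsilon>1_def)
  have s0: "sin t0 > 0" using t0 by (intro sin_gt_zero) auto
  have sin_ge: "sin t \<ge> sin t0" if "t \<in> {t0..pi - t0}" for t
  proof (cases "t \<le> pi / 2")
    case True
    then show ?thesis using that t0 by (intro sin_monotone_2pi_le) auto
  next
    case False
    have "sin t0 \<le> sin (pi - t)" using that t0 False by (intro sin_monotone_2pi_le) auto
    then show ?thesis by simp
  qed
  obtain M where M: "M \<ge> 1" "\<And>n. n \<ge> M \<Longrightarrow> a n \<ge> 1 / 2"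
    "\<And>m n. m \<ge> M \<Longrightarrow> real m * (\<Sum>k\<in>{m..<n}. e k) \<le> \<epsilon>1 * sin t0 / 6"
    using tail_small[of "\<epsilon>1 * sin t0 / 6"] \<epsilon>1 s0 by (metis divide_pos_pos mult_pos_pos zero_less_numeral)
  have near: "norm (sgn (Y t n) - sgn (Y t M)) \<le> 4 * \<epsilon>1" if n: "n \<ge> M" and t: "t \<in> {t0..pi - t0}" for n t
  proof (rule sgn_Y_variation)
    show st: "sin t > 0" using sin_ge[OF t] s0 by simp
    have e0: "(\<Sum>k\<in>{M..<n}. e k) \<ge> 0" by (intro sum_nonneg) auto
    then have "1 * (\<Sum>k\<in>{M..<n}. e k) \<le> real M * (\<Sum>k\<in>{M..<n}. e k)" using M(1) by (intro mult_right_mono) auto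
    also have "\<dots> \<le> \<epsilon>1 * sin t0 / 6" by (rule M(3)) simp
    finally have "6 * (\<Sum>k\<in>{M..<n}. e k) \<le> \<epsilon>1 * sin t0" by simp
    also have "\<dots> \<le> \<epsilon>1 * sin t" using sin_ge[OF t] \<epsilon>1 by (intro mult_left_mono) auto
    finally show "6 * (\<Sum>k\<in>{M..<n}. e k) / sin t \<le> \<epsilon>1" using st by (simp add: divide_le_eq)
  qed (use M n \<epsilon>1 in auto)
  have "uniformly_continuous_on {t0..pi - t0} (\<lambda>t. sgn (Y t M))"
  proof (intro compact_uniformly_continuous continuous_on_sgn_Y)
    fix t assume "t \<in> {t0..pi - t0}"
    then show "sin t \<noteq> 0" using sin_ge[of t] s0 by auto
  qed (use M in auto)
  then obtain h where h: "h > 0" "\<And>t t'. t \<in> {t0..pi - t0} \<Longrightarrow> t' \<in> {t0..pi - t0} \<Longrightarrow> dist t' t < h \<Longrightarrow>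
      dist (sgn (Y t' M)) (sgn (Y t M)) < 4 * \<epsilon>1"
    using \<epsilon>1(1) unfolding uniformly_continuous_on_def by (metis mult_pos_pos zero_less_numeral)
  show thesis
  proof (rule that[of h M])
    fix n t t' assume *: "n \<ge> M" "t \<in> {t0..pi - t0}" "t' \<in> {t0..pi - t0}" "\<bar>t - t'\<bar> < h"
    have "norm (sgn (Y t n) - sgn (Y t' n)) \<le> norm (sgn (Y t n) - sgn (Y t M))
        + norm (sgn (Y t M) - sgn (Y t' M)) + norm (sgn (Y t' M) - sgn (Y t' n))"
      by (smt (verit) diff_add_cancel add_diff_eq norm_triangle_ineq)
    also have "\<dots> \<le> 4 * \<epsilon>1 + 4 * \<epsilon>1 + 4 * \<epsilon>1"
      using near[OF *(1,2)] near[OF *(1,3)] h(2)[OF *(3,2)] *(4)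
      by (intro add_mono) (auto simp: dist_norm norm_minus_commute less_imp_le)
    also have "\<dots> \<le> \<epsilon>" using \<epsilon>1 by simp
    finally show "norm (sgn (Y t n) - sgn (Y t' n)) \<le> \<epsilon>" .
  qed (fact h)
qed

end

section \<open>Elementary estimates for sine, cosine and the unit circle\<close>

lemma two_minus_two_cos_le: "2 - 2 * cos t \<le> (t::real)\<^sup>2"
proof -
  have "cos t = 1 - 2 * (sin (t / 2))\<^sup>2" using cos_double_sin[of "t / 2"] by simp
  moreover have "(sin (t / 2))\<^sup>2 \<le> (t / 2)\<^sup>2"
    using abs_sin_x_le_abs_x[of "t / 2"] by (simp only: abs_le_square_iff)
  ultimately show ?thesis by (simp add: power2_eq_square)
qed

lemma sin_bounds_near_0:
  fixes t :: real
  assumes "0 < t" "t \<le> 1"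
  shows "t / 2 \<le> sin t" "\<bar>sin t - t\<bar> \<le> t\<^sup>2 / 2"
proof -
  obtain z where z: "0 < z" "z < t" "sin t - sin 0 = (t - 0) * cos z"
    using MVT2[of 0 t sin cos] assms by (auto intro: DERIV_sin)
  have "z\<^sup>2 \<le> z" using z assms by (simp add: power2_eq_square mult_left_le)
  then have z2: "1 - cos z \<le> z / 2" using two_minus_two_cos_le[of z] by simp
  have "t * (1 / 2) \<le> t * cos z" using z z2 assms by (intro mult_left_mono) auto
  then show "t / 2 \<le> sin t" using z by simp
  have "t * (1 - cos z) \<le> t * (t / 2)" using z z2 assms by (intro mult_left_mono) auto
  moreover have "t * (1 - cos z) \<ge> 0" using assms by simp
  moreover have "t - sin t = t * (1 - cos z)" using z by (simp add: algebra_simps)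
  ultimately show "\<bar>sin t - t\<bar> \<le> t\<^sup>2 / 2" by (simp add: power2_eq_square)
qed

lemma norm_cis_minus_1_le: "norm (cis t - 1) \<le> \<bar>t\<bar>"
proof -
  have "(norm (cis t - 1))\<^sup>2 = (cos t - 1)\<^sup>2 + (sin t)\<^sup>2" by (simp add: cmod_power2)
  also have "\<dots> = 2 - 2 * cos t" using sin_cos_squared_add[of t] by (simp add: power2_eq_square algebra_simps)
  also have "\<dots> \<le> \<bar>t\<bar>\<^sup>2" using two_minus_two_cos_le[of t] by simp
  finally show ?thesis by (rule power2_le_imp_le) simp
qed

lemma norm_cis_taylor_1:
  assumes "0 < t" "t \<le> 1"
  shows "norm (cis t - 1 - \<i> * of_real t) \<le> t\<^sup>2"
proof -
  have "norm (cis t - 1 - \<i> * of_real t) \<le> \<bar>cos t - 1\<bar> + \<bar>sin t - t\<bar>"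
    using cmod_le[of "cis t - 1 - \<i> * of_real t"] by simp
  also have "\<dots> \<le> t\<^sup>2 / 2 + t\<^sup>2 / 2"
    using two_minus_two_cos_le[of t] sin_bounds_near_0[OF assms] by (intro add_mono) auto
  finally show ?thesis by simp
qed

context jacobi_polys
begin

text \<open>Just above \<open>t = 0\<close>, the unit vector \<open>sgn (Y t n)\<close> is evaluated at the index
  \<open>m\<close> with \<open>m * t\<close> close to a small constant \<open>T\<close>. Up to this index the comparison with \<open>t = 0\<close>
  is valid, and beyond it the remaining variation is small by the first-moment condition.\<close>

lemma phase_edge:
  obtains y :: complex and t1 :: real and M where "t1 > 0"
    "\<And>n t. n \<ge> M \<Longrightarrow> 0 \<le> t \<Longrightarrow> t \<le> pi / 2 \<Longrightarrow> real n * t \<le> t1 \<Longrightarrow> q (2 * cos t) n \<noteq> 0"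
    "\<And>\<epsilon> \<tau>. \<epsilon> > 0 \<Longrightarrow> \<tau> > 0 \<Longrightarrow> \<exists>t0>0. \<forall>t n. 0 < t \<longrightarrow> t < t0 \<longrightarrow> \<tau> \<le> real n * t \<longrightarrow>
       norm (sgn (Y t n) - y) \<le> \<epsilon>"
proof -
  obtain s \<sigma> C T0 :: real where s: "s = 1 \<or> s = -1" and \<sigma>: "\<sigma> = 0 \<or> \<sigma> = 1" and C: "C > 0" and T0: "T0 > 0"
    and edge: "\<And>T. 0 < T \<Longrightarrow> T \<le> T0 \<Longrightarrow> \<exists>M\<ge>1. \<forall>n\<ge>M. \<forall>x. 0 \<le> x \<longrightarrow> x \<le> 2 \<longrightarrow>
       (2 - x) * (real n)\<^sup>2 \<le> T\<^sup>2 \<longrightarrow>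
       s * q x n > 0 \<and> \<bar>real n * (1 - q x (n - 1) / q x n) - \<sigma>\<bar> \<le> C * T\<^sup>2"
    by (rule edge_behaviour) (rule that)
  have small: "(2 - 2 * cos t) * (real n)\<^sup>2 \<le> T\<^sup>2" if "0 \<le> t" "real n * t \<le> T" for t T n
  proof -
    have "(2 - 2 * cos t) * (real n)\<^sup>2 \<le> t\<^sup>2 * (real n)\<^sup>2"
      using two_minus_two_cos_le by (intro mult_right_mono) auto
    also have "\<dots> = (real n * t)\<^sup>2" by (simp add: power_mult_distrib mult.commute)
    also have "\<dots> \<le> T\<^sup>2" using that by (intro power_mono) auto
    finally show ?thesis .
  qed
  obtain M0 where M0: "\<forall>n\<ge>M0. \<forall>x. 0 \<le> x \<longrightarrow> x \<le> 2 \<longrightarrow> (2 - x) * (real n)\<^sup>2 \<le> T0\<^sup>2 \<longrightarrow>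
       s * q x n > 0 \<and> \<bar>real n * (1 - q x (n - 1) / q x n) - \<sigma>\<bar> \<le> C * T0\<^sup>2"
    using edge[OF T0 order_refl] by blast
  \<comment> \<open>\<open>X t m\<close> is \<open>q / m\<close> times
    \<open>m * (cis t - 1) + w\<close>, with \<open>w\<close> close to \<open>\<sigma>\<close> and
    \<open>m * t\<close> close to a small \<open>T\<close>. For \<open>\<sigma> = 1\<close> the real
    part dominates, for \<open>\<sigma> = 0\<close> the term near \<open>\<i> * T\<close>.\<close>
  define y :: complex where "y = of_real s * (if \<sigma> = 1 then 1 else \<i>)"
  show thesis
  proof (rule that[of T0 M0 y])
    fix n t assume n: "n \<ge> M0" and t: "0 \<le> t" "t \<le> pi / 2" "real n * t \<le> T0"
    have "0 \<le> 2 * cos t" using t by (simp add: cos_ge_zero)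
    then have "s * q (2 * cos t) n > 0" using M0 n small[OF t(1,3)] by auto
    then show "q (2 * cos t) n \<noteq> 0" by auto
  next
    fix \<epsilon> \<tau> :: real assume \<epsilon>: "\<epsilon> > 0" and \<tau>: "\<tau> > 0"
    define \<epsilon>1 where "\<epsilon>1 = min 1 (\<epsilon> / 8)"
    have \<epsilon>1: "0 < \<epsilon>1" "\<epsilon>1 \<le> 1" "4 * \<epsilon>1 \<le> \<epsilon> / 2" using \<epsilon> by (auto simp: \<epsilon>1_def)
    \<comment> \<open>\<open>T \<le> T0\<close> makes the edge comparison valid,
      \<open>T \<le> \<tau>\<close> ensures \<open>m \<le> n\<close>, and the last bound keeps all
      errors of order \<open>T\<close> below \<open>\<epsilon> / 2\<close>.\<close>
    define T where "T = min (min T0 \<tau>) (min 1 (\<epsilon> / (2 * (5 + 4 * C))))"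
    have T: "0 < T" "T \<le> T0" "T \<le> \<tau>" "T \<le> 1" "T \<le> \<epsilon> / (2 * (5 + 4 * C))"
      using T0 \<tau> \<epsilon> C by (auto simp: T_def)
    have T\<epsilon>: "T * (5 + 4 * C) \<le> \<epsilon> / 2" using T(5) C by (simp add: field_simps)
    obtain M where M1: "M \<ge> 1" and M: "\<forall>n\<ge>M. \<forall>x. 0 \<le> x \<longrightarrow> x \<le> 2 \<longrightarrow> (2 - x) * (real n)\<^sup>2 \<le> T\<^sup>2 \<longrightarrow>
       s * q x n > 0 \<and> \<bar>real n * (1 - q x (n - 1) / q x n) - \<sigma>\<bar> \<le> C * T\<^sup>2"
      using edge[OF T(1,2)] by blast
    \<comment> \<open>24 = 2 * 2 * 6: from \<open>m * t \<ge> T / 2\<close>, from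
      \<open>sin t \<ge> t / 2\<close>, and from the constant in the phase variation.\<close>
    have "\<epsilon>1 * T / 24 > 0" using \<epsilon>1 T by simp
    then obtain M' where M': "M' \<ge> 1" "\<And>n. n \<ge> M' \<Longrightarrow> a n \<ge> 1 / 2"
      "\<And>m n. m \<ge> M' \<Longrightarrow> real m * (\<Sum>k\<in>{m..<n}. e k) \<le> \<epsilon>1 * T / 24"
      by (rule tail_small) (rule that)
    define L where "L = real (max M M')"
    have L: "L \<ge> 1" using M1 by (simp add: L_def)
    \<comment> \<open>Below \<open>t0\<close> the index \<open>m\<close> exceeds both
      \<open>M\<close> and \<open>M'\<close>, and \<open>m * t\<close> is at least
      \<open>T / 2\<close>.\<close>
    define t0 where "t0 = T / (2 * L)"
    have t0: "t0 > 0" "t0 \<le> T / 2" using T L by (auto simp: t0_def field_simps mult_le_cancel_left1)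
    show "\<exists>t0>0. \<forall>t n. 0 < t \<longrightarrow> t < t0 \<longrightarrow> \<tau> \<le> real n * t \<longrightarrow> norm (sgn (Y t n) - y) \<le> \<epsilon>"
    proof (intro exI[of _ t0] conjI allI impI t0)
      fix t n assume t: "0 < t" "t < t0" and nt: "\<tau> \<le> real n * t"
      have t1: "t \<le> 1" "t \<le> T" "t \<le> T / 2" using t t0 T by auto
      have tpi: "t < pi / 2" using t1 pi_gt3 by simp
      have sint: "sin t > 0" "t / 2 \<le> sin t" using sin_bounds_near_0[OF t(1) t1(1)] t by auto
      define m where "m = nat \<lfloor>T / t\<rfloor>"
      have m_real: "real m = of_int \<lfloor>T / t\<rfloor>" using T t by (simp add: m_def)
      have "real m \<le> T / t" unfolding m_real by simp
      then have mt_le: "real m * t \<le> T" using t by (simp add: field_simps)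
      have m_gt: "real m > T / t - 1" unfolding m_real by linarith
      then have "real m * t > T - t" using t by (simp add: field_simps)
      then have mt_ge: "real m * t \<ge> T / 2" using t1 by linarith
      have "2 * L * t < T" using t L by (simp add: t0_def field_simps)
      then have "L * t < real m * t" using mt_ge by simp
      then have "L < real m" using t by simp
      then have mM: "m \<ge> M" "m \<ge> M'" by (auto simp: L_def)
      have m1: "m \<ge> 1" using mM M1 by simp
      have "real m * t \<le> real n * t" using mt_le T(3) nt by linarith
      then have mn: "m \<le> n" using t by simp
      let ?x = "2 * cos t"
      define w where "w = real m * (1 - q ?x (m - 1) / q ?x m)"
      have x0: "0 \<le> ?x" using tpi t by (simp add: cos_ge_zero)
      have sq: "s * q ?x m > 0" and w: "\<bar>w - \<sigma>\<bar> \<le> C * T\<^sup>2"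
        using M mM(1) x0 small[OF _ mt_le] t by (auto simp: w_def)
      define Z where "Z = of_real (real m) * (cis t - 1) + of_real w"
      have q_nz: "q ?x m \<noteq> 0" using sq by auto
      have "X t m = of_real (q ?x m / real m) * Z"
      proof -
        have "real m \<noteq> 0" using m1 by simp
        then have "of_real (q ?x m / real m) * Z = of_real (q ?x m) * (cis t - 1) + of_real (q ?x m / real m * w)"
          by (simp add: Z_def distrib_left)
        also have "q ?x m / real m * w = q ?x m - q ?x (m - 1)"
          using q_nz \<open>real m \<noteq> 0\<close> by (simp add: w_def field_simps)
        finally show ?thesis by (simp add: X_def algebra_simps)
      qed
      then have "sgn (X t m) = of_real (sgn (q ?x m / real m)) * sgn Z"
        by (simp only: sgn_mult sgn_of_real)
      moreover have "sgn (q ?x m / real m) = s"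
        using s divide_pos_pos[OF sq, of "real m"] m1 by (auto simp: sgn_if)
      ultimately have sgnX: "sgn (X t m) = of_real s * sgn Z" by (simp only:)
      have CT: "C * T\<^sup>2 \<le> C * T" using C T by (simp add: power2_eq_square mult_left_le)
      have Z: "norm (sgn Z - (if \<sigma> = 1 then 1 else \<i>)) \<le> 4 * T + 4 * C * T"
      proof (cases "\<sigma> = 1")
        case True
        have "Z - 1 = of_real (real m) * (cis t - 1) + of_real (w - \<sigma>)" by (simp add: Z_def True)
        then have "norm (Z - 1) \<le> norm (of_real (real m) * (cis t - 1)) + norm (of_real (w - \<sigma>) :: complex)"
          by (simp only: norm_triangle_ineq)
        also have "\<dots> = real m * norm (cis t - 1) + \<bar>w - \<sigma>\<bar>" by (simp add: norm_mult flip: of_real_diff)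
        also have "\<dots> \<le> real m * \<bar>t\<bar> + C * T\<^sup>2"
          using w norm_cis_minus_1_le by (intro add_mono mult_left_mono) auto
        also have "\<dots> \<le> T + C * T" using mt_le t CT by simp
        finally have "norm (Z - 1) \<le> T + C * T" .
        moreover have "0 \<le> C * T" using C T by simp
        moreover have "norm (sgn Z - 1) \<le> 2 * norm (Z - 1)"
          using norm_sgn_diff_le[of "1 :: complex" Z] by simp
        ultimately show ?thesis using True T(1) by (simp add: mult.assoc)
      next
        case False
        then have \<sigma>0: "\<sigma> = 0" using \<sigma> by simp
        \<comment> \<open>The main term has size of order \<open>T\<close> only, so the error of
          \<open>w\<close> must be of smaller order: the quadratic bound \<open>C * T^2\<close> is
          essential here.\<close>
        define v :: complex where "v = \<i> * of_real (real m * t)"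
        have mt0: "real m * t > 0" using mt_ge T by linarith
        have v_eq: "v = (real m * t) *\<^sub>R \<i>" by (simp add: v_def scaleR_conv_of_real mult_ac)
        have v: "norm v = real m * t" "sgn v = \<i>"
          unfolding v_eq norm_scaleR sgn_scaleR abs_of_pos[OF mt0] sgn_pos[OF mt0]
          by (simp_all add: sgn_div_norm)
        have v0: "v \<noteq> 0" using v(1) mt0 by auto
        have "Z - v = of_real (real m) * (cis t - 1 - \<i> * of_real t) + of_real (w - \<sigma>)"
          by (simp add: Z_def \<sigma>0 v_def algebra_simps)
        then have "norm (Z - v) \<le> norm (of_real (real m) * (cis t - 1 - \<i> * of_real t)) + norm (of_real (w - \<sigma>) :: complex)"
          by (simp only: norm_triangle_ineq)
        also have "\<dots> = real m * norm (cis t - 1 - \<i> * of_real t) + \<bar>w - \<sigma>\<bar>" by (simp add: norm_mult flip: of_real_diff)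
        also have "\<dots> \<le> real m * t\<^sup>2 + C * T\<^sup>2"
          using w norm_cis_taylor_1[OF t(1) t1(1)] by (intro add_mono mult_left_mono) auto
        also have "real m * t\<^sup>2 \<le> T * T"
          using mult_mono[OF mt_le t1(2)] T t by (simp add: power2_eq_square mult.assoc)
        finally have "norm (Z - v) \<le> T * (T + C * T)" by (simp add: power2_eq_square algebra_simps)
        then have "2 * norm (Z - v) / norm v \<le> 2 * (T * (T + C * T)) / (T / 2)"
          using mt_ge T C v by (intro frac_le) auto
        also have "\<dots> = 4 * T + 4 * C * T" using T by (simp add: field_simps)
        finally show ?thesis using norm_sgn_diff_le[OF v0, of Z] v(2) False by simp
      qed
      have "norm (sgn (X t m) - y) = norm (of_real s * (sgn Z - (if \<sigma> = 1 then 1 else \<i>)))"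
        unfolding sgnX y_def by (simp only: right_diff_distrib)
      also have "\<dots> \<le> 4 * T + 4 * C * T" unfolding norm_mult using Z s by auto
      finally have 1: "norm (sgn (X t m) - y) \<le> 4 * T + 4 * C * T" .
      have "sgn (Y t m) - sgn (X t m) = (cis (- (real m * t)) - 1) * sgn (X t m)"
        by (simp add: Y_def sgn_mult sgn_div_norm[of "cis _"] algebra_simps)
      then have "norm (sgn (Y t m) - sgn (X t m)) = norm (cis (- (real m * t)) - 1) * norm (sgn (X t m))"
        by (simp only: norm_mult)
      also have "\<dots> \<le> \<bar>- (real m * t)\<bar> * 1"
        by (intro mult_mono norm_cis_minus_1_le) (auto simp: norm_sgn)
      finally have 2: "norm (sgn (Y t m) - sgn (X t m)) \<le> T" using mt_le t by simp
      have 3: "norm (sgn (Y t n) - sgn (Y t m)) \<le> 4 * \<epsilon>1"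
      proof (rule sgn_Y_variation)
        let ?S = "\<Sum>k\<in>{m..<n}. e k"
        have S0: "?S \<ge> 0" by (intro sum_nonneg) auto
        have "(T / 2) * ?S \<le> (real m * t) * ?S" using mt_ge S0 by (intro mult_right_mono)
        also have "\<dots> = t * (real m * ?S)" by simp
        also have "\<dots> \<le> t * (\<epsilon>1 * T / 24)" using M'(3)[OF mM(2)] t by (intro mult_left_mono) auto
        finally have "T * (6 * ?S) \<le> T * (\<epsilon>1 * (t / 2))" by (simp add: algebra_simps)
        then have "6 * ?S \<le> \<epsilon>1 * (t / 2)" using T by simp
        also have "\<dots> \<le> \<epsilon>1 * sin t" using sint \<epsilon>1 by (intro mult_left_mono) auto
        finally show "6 * ?S / sin t \<le> \<epsilon>1" using sint by (simp add: divide_le_eq)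
      qed (use sint m1 M' mM mn \<epsilon>1 in auto)
      have "sgn (Y t n) - y = (sgn (Y t n) - sgn (Y t m)) + (sgn (Y t m) - sgn (X t m)) + (sgn (X t m) - y)"
        by simp
      then have "norm (sgn (Y t n) - y) \<le> norm (sgn (Y t n) - sgn (Y t m))
          + norm (sgn (Y t m) - sgn (X t m)) + norm (sgn (X t m) - y)"
        by (metis norm_triangle_le norm_triangle_ineq add_right_mono)
      also have "\<dots> \<le> 4 * \<epsilon>1 + T + (4 * T + 4 * C * T)" using 1 2 3 by (intro add_mono)
      also have "\<dots> = 4 * \<epsilon>1 + T * (5 + 4 * C)" by (simp add: algebra_simps)
      also have "\<dots> \<le> \<epsilon>" using \<epsilon>1 T\<epsilon> by simp
      finally show "norm (sgn (Y t n) - y) \<le> \<epsilon>" .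
    qed
  qed (fact T0)
qed

text \<open>Replacing x by -x negates \<open>b\<close>; the sign \<open>(-1) ^ n\<close> keeps the
  off-diagonal coefficients positive.\<close>

lemma reflected: "jacobi_polys (\<lambda>n. smult ((-1) ^ n) (pcompose (p n) [:0, -1:])) a (\<lambda>n. - b n)"
proof
  show "smult ((-1) ^ 0) (pcompose (p 0) [:0, -1:]) = 1" by (simp add: p_0 pcompose_1)
  fix n
  show "[:0, 1:] * smult ((-1) ^ n) (pcompose (p n) [:0, -1:])
     = smult (a (Suc n)) (smult ((-1) ^ Suc n) (pcompose (p (Suc n)) [:0, -1:]))
       + smult (- b (Suc n)) (smult ((-1) ^ n) (pcompose (p n) [:0, -1:]))
       + (if n = 0 then 0 else smult (a n) (smult ((-1) ^ (n - 1)) (pcompose (p (n - 1)) [:0, -1:])))"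
  proof (subst poly_eq_poly_eq_iff[symmetric], rule ext)
    fix x
    show "poly ([:0, 1:] * smult ((-1) ^ n) (pcompose (p n) [:0, -1:])) x = poly (smult (a (Suc n)) (smult ((-1) ^ Suc n) (pcompose (p (Suc n)) [:0, -1:]))
       + smult (- b (Suc n)) (smult ((-1) ^ n) (pcompose (p n) [:0, -1:]))
       + (if n = 0 then 0 else smult (a n) (smult ((-1) ^ (n - 1)) (pcompose (p (n - 1)) [:0, -1:])))) x"
      using arg_cong[OF q_rec[of "- x" n], of "\<lambda>z. (-1) ^ n * z"] by (cases n) (auto simp: poly_pcompose q_def algebra_simps)
  qed
qed (use a_pos decay in auto)

interpretation R: jacobi_polys "\<lambda>n. smult ((-1) ^ n) (pcompose (p n) [:0, -1:])" a "\<lambda>n. - b n"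
  by (rule reflected)

lemma reflected_q: "R.q x n = (-1) ^ n * q (- x) n"
  by (simp add: R.q_def q_def poly_pcompose)

text \<open>The angle \<open>pi - t\<close> belongs to -x, and \<open>(-1) ^ n\<close> equals
  \<open>cis (- n * pi)\<close>, which matches the rotations at the two edges up to conjugation. The
  signs of indices \<open>n\<close> and \<open>n - 1\<close> leave the minus.\<close>

lemma reflected_Y:
  assumes "n \<ge> 1"
  shows "R.Y t n = - cnj (Y (pi - t) n)"
proof -
  obtain m where n: "n = Suc m" using assms by (cases n) auto
  have c: "- (2 * cos t) = 2 * cos (pi - t)" by simp
  have X: "R.X t n = (-1) ^ m * cnj (X (pi - t) n)"
    unfolding R.X_def X_def reflected_q c n
    by (simp add: complex_eq_iff algebra_simps)
  have "cis (- (real n * t)) = cnj (cis (- (real n * (pi - t)))) * (-1) ^ n"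
  proof -
    have "cnj (cis (- (real n * (pi - t)))) * (-1) ^ n = cis (real n * (pi - t)) * cis (real n * - pi)"
    proof -
      have "(-1 :: complex) = cis (- pi)" by (simp add: complex_eq_iff)
      then have "(-1) ^ n = cis (real n * - pi)" using Complex.DeMoivre[of "- pi" n] by (simp only:)
      then show ?thesis by (simp only: cis_cnj minus_minus)
    qed
    also have "\<dots> = cis (- (real n * t))" by (simp add: cis_mult algebra_simps)
    finally show ?thesis by simp
  qed
  then have "R.Y t n = cnj (cis (- (real n * (pi - t)))) * (-1) ^ n * ((-1) ^ m * cnj (X (pi - t) n))"
    unfolding R.Y_def X by (simp only:)
  also have "\<dots> = cnj (Y (pi - t) n) * ((-1) ^ n * (-1) ^ m)"
    unfolding Y_def complex_cnj_mult by (simp only: mult_ac)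
  also have "(-1 :: complex) ^ n * (-1) ^ m = -1" by (simp add: n flip: power_mult_distrib)
  finally show ?thesis by simp
qed

text \<open>For large \<open>n\<close>, two angles within 2 pi / n of each other lie in one common
  region, next to 0, next to pi or in the interior, and each region has its own estimate.\<close>

lemma phase_local:
  assumes \<tau>: "\<tau> > 0" and \<epsilon>: "\<epsilon> > 0"
  obtains N where "\<And>n t t'. n \<ge> N \<Longrightarrow> 0 < t \<Longrightarrow> t < pi \<Longrightarrow> 0 < t' \<Longrightarrow> t' < pi \<Longrightarrow>
     \<tau> \<le> real n * t \<Longrightarrow> \<tau> \<le> real n * t' \<Longrightarrow> \<tau> \<le> real n * (pi - t) \<Longrightarrow> \<tau> \<le> real n * (pi - t') \<Longrightarrow>
     real n * \<bar>t - t'\<bar> \<le> 2 * pi \<Longrightarrow> norm (sgn (Y t n) - sgn (Y t' n)) \<le> \<epsilon>"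
proof -
  have \<epsilon>2: "\<epsilon> / 2 > 0" using \<epsilon> by simp
  obtain y :: complex where "\<And>\<epsilon> \<tau>. \<epsilon> > 0 \<Longrightarrow> \<tau> > 0 \<Longrightarrow> \<exists>t0>0. \<forall>t n. 0 < t \<longrightarrow> t < t0 \<longrightarrow> \<tau> \<le> real n * t \<longrightarrow>
       norm (sgn (Y t n) - y) \<le> \<epsilon>"
    by (rule phase_edge) (rule that)
  from this[OF \<epsilon>2 \<tau>] obtain r1 where r1: "r1 > 0"
    "\<And>t n. 0 < t \<Longrightarrow> t < r1 \<Longrightarrow> \<tau> \<le> real n * t \<Longrightarrow> norm (sgn (Y t n) - y) \<le> \<epsilon> / 2"
    by blast
  obtain y' :: complex where "\<And>\<epsilon> \<tau>. \<epsilon> > 0 \<Longrightarrow> \<tau> > 0 \<Longrightarrow> \<exists>t0>0. \<forall>t n. 0 < t \<longrightarrow> t < t0 \<longrightarrow> \<tau> \<le> real n * t \<longrightarrow>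
       norm (sgn (R.Y t n) - y') \<le> \<epsilon>"
    by (rule R.phase_edge) (rule that)
  from this[OF \<epsilon>2 \<tau>] obtain r2 where r2: "r2 > 0"
    "\<And>t n. 0 < t \<Longrightarrow> t < r2 \<Longrightarrow> \<tau> \<le> real n * t \<Longrightarrow> norm (sgn (R.Y t n) - y') \<le> \<epsilon> / 2"
    by blast
  \<comment> \<open>At most half the range of the edge estimates: if one angle is within
    \<open>r\<close> of an edge, both are within that range.\<close>
  define r where "r = min (min r1 r2) 1 / 2"
  have r: "0 < r" "2 * r \<le> r1" "2 * r \<le> r2" "r < pi / 2" using r1 r2 pi_gt3 by (auto simp: r_def)
  obtain N h where h: "h > 0" and int: "\<And>n t t'. n \<ge> N \<Longrightarrow> t \<in> {r..pi - r} \<Longrightarrow> t' \<in> {r..pi - r} \<Longrightarrow> \<bar>t - t'\<bar> < h \<Longrightarrow>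
       norm (sgn (Y t n) - sgn (Y t' n)) \<le> \<epsilon>"
    using r(1,4) \<epsilon> by (rule phase_equicontinuous_interior) (rule that)
  define d where "d = min h r"
  have d: "d > 0" "d \<le> h" "d \<le> r" using h r by (auto simp: d_def)
  obtain N' where N': "real N' > 2 * pi / d" using reals_Archimedean2 by blast
  show thesis
  proof (rule that[of "max 1 (max N N')"])
    fix n t t' assume n: "n \<ge> max 1 (max N N')" and t: "0 < t" "t < pi" "0 < t'" "t' < pi"
      "\<tau> \<le> real n * t" "\<tau> \<le> real n * t'" "\<tau> \<le> real n * (pi - t)" "\<tau> \<le> real n * (pi - t')"
      and near: "real n * \<bar>t - t'\<bar> \<le> 2 * pi"
    have "2 * pi / d < real n" using N' n by (meson less_le_trans max.bounded_iff of_nat_le_iff)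
    then have "2 * pi < real n * d" using d by (simp add: field_simps)
    with near have "real n * \<bar>t - t'\<bar> < real n * d" by linarith
    then have tt: "\<bar>t - t'\<bar> < d" by (rule mult_left_less_imp_less) simp
    consider "t < r \<or> t' < r" | "t > pi - r \<or> t' > pi - r" | "t \<in> {r..pi - r}" "t' \<in> {r..pi - r}"
      by fastforce
    then show "norm (sgn (Y t n) - sgn (Y t' n)) \<le> \<epsilon>"
    proof cases
      case 1
      then have "t < r1" "t' < r1" using tt d r by auto
      then have "norm (sgn (Y t n) - y) \<le> \<epsilon> / 2" "norm (sgn (Y t' n) - y) \<le> \<epsilon> / 2"
        using r1 t by auto
      then show ?thesis
        using norm_triangle_ineq4[of "sgn (Y t n) - y" "sgn (Y t' n) - y"] by simp
    next
      case 2
      then have "pi - t < r2" "pi - t' < r2" using tt d r by auto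
      then have "norm (sgn (R.Y (pi - t) n) - y') \<le> \<epsilon> / 2" "norm (sgn (R.Y (pi - t') n) - y') \<le> \<epsilon> / 2"
        using r2 t by auto
      then have "norm (sgn (R.Y (pi - t) n) - sgn (R.Y (pi - t') n)) \<le> \<epsilon>"
        using norm_triangle_ineq4[of "sgn (R.Y (pi - t) n) - y'" "sgn (R.Y (pi - t') n) - y'"] by simp
      moreover have "sgn (R.Y (pi - t) n) - sgn (R.Y (pi - t') n) = - cnj (sgn (Y t n) - sgn (Y t' n))"
        using n by (simp add: reflected_Y sgn_div_norm)
      ultimately show ?thesis by (simp only: norm_minus_cancel complex_mod_cnj)
    next
      case 3
      then show ?thesis using int n tt d by auto
    qed
  qed
qed

end

section \<open>Spacing of the zeros\<close>

context jacobi_polys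
begin

text \<open>By Christoffel-Darboux, \<open>q z n\<close> just right of \<open>x\<close> has the sign
  of \<open>q x (n - 1)\<close>, and just left of \<open>y\<close> the sign opposite to
  \<open>q y (n - 1)\<close>; in between the sign is constant.\<close>

lemma consecutive_zeros_sign:
  assumes n: "n \<ge> 1" and xy: "x < y" "q x n = 0" "q y n = 0"
    and nz: "\<And>z. x < z \<Longrightarrow> z < y \<Longrightarrow> q z n \<noteq> 0"
  shows "q x (n - 1) * q y (n - 1) < 0"
proof -
  obtain m where m: "n = Suc m" using n by (cases n) auto
  have near: "\<exists>d>0. \<forall>z. dist z w < d \<longrightarrow> (\<Sum>k\<le>m. q z k * q w k) > 0" for w
  proof -
    have "isCont (\<lambda>z. \<Sum>k\<le>m. q z k * q w k) w" by (intro continuous_intros)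
    then obtain d where "d > 0" "\<And>z. dist z w < d \<Longrightarrow> (\<Sum>k\<le>m. q z k * q w k) > 0"
      using sum_q_square_pos[of w m] by (rule isCont_pos_nbhd) auto
    then show ?thesis by blast
  qed
  have CD: "(z - w) * (\<Sum>k\<le>m. q z k * q w k) = a n * (q z n * q w m)" if "q w n = 0" for z w
    using q_CD[of z w m] that m by simp
  obtain d1 where d1: "d1 > 0" "\<And>z. dist z x < d1 \<Longrightarrow> (\<Sum>k\<le>m. q z k * q x k) > 0"
    using near by blast
  obtain d2 where d2: "d2 > 0" "\<And>z. dist z y < d2 \<Longrightarrow> (\<Sum>k\<le>m. q z k * q y k) > 0"
    using near by blast
  define h1 where "h1 = min d1 (y - x)"
  define h2 where "h2 = min d2 (y - x)"
  have h: "0 < h1" "h1 \<le> d1" "h1 \<le> y - x" "0 < h2" "h2 \<le> d2" "h2 \<le> y - x"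
    using d1 d2 xy by (auto simp: h1_def h2_def)
  define z1 where "z1 = x + h1 / 2"
  define z2 where "z2 = y - h2 / 2"
  have z1: "x < z1" "z1 < y" "dist z1 x < d1" using h by (auto simp: z1_def dist_real_def)
  have z2: "x < z2" "z2 < y" "dist z2 y < d2" using h by (auto simp: z2_def dist_real_def)
  have an: "a n > 0" using a_pos n by simp
  have "(z1 - x) * (\<Sum>k\<le>m. q z1 k * q x k) > 0" using z1 d1 by simp
  then have 1: "q z1 n * q x m > 0" unfolding CD[OF xy(2)] using an by (simp add: zero_less_mult_iff)
  have "(z2 - y) * (\<Sum>k\<le>m. q z2 k * q y k) < 0" using z2 d2 by (simp add: mult_less_0_iff)
  then have 2: "q z2 n * q y m < 0" unfolding CD[OF xy(3)] using an by (simp add: mult_less_0_iff)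
  have 3: "q z1 n * q z2 n > 0"
  proof (rule ccontr)
    assume neg: "\<not> 0 < q z1 n * q z2 n"
    define l where "l = min z1 z2"
    define u where "u = max z1 z2"
    have lu: "x < l" "l \<le> u" "u < y" using z1 z2 by (auto simp: l_def u_def)
    have "q l n * q u n = q z1 n * q z2 n" by (auto simp: l_def u_def min_def max_def mult.commute)
    then have "q l n * q u n \<le> 0" using neg by simp
    then consider "q l n \<le> 0" "0 \<le> q u n" | "0 \<le> q l n" "q u n \<le> 0" by (auto simp: mult_le_0_iff)
    then obtain z where "l \<le> z" "z \<le> u" "q z n = 0"
      using IVT[of "\<lambda>z. q z n" l 0 u] IVT2[of "\<lambda>z. q z n" u 0 l] lu isCont_q by cases blast+
    then show False using nz[of z] lu by auto
  qed
  have "(q x m * q y m) * ((q z1 n)\<^sup>2 * (q z2 n)\<^sup>2) = (q z1 n * q x m) * (q z2 n * q y m) * (q z1 n * q z2 n)"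
    by (simp add: power2_eq_square mult_ac)
  also have "\<dots> < 0" by (rule mult_neg_pos[OF mult_pos_neg[OF 1 2] 3])
  finally show ?thesis unfolding m by (simp add: mult_less_0_iff zero_less_mult_iff)
qed

interpretation R: jacobi_polys "\<lambda>n. smult ((-1) ^ n) (pcompose (p n) [:0, -1:])" a "\<lambda>n. - b n"
  by (rule reflected)

text \<open>Within O(1/n) of an edge the solution still follows the edge solution and keeps its
  sign. This yields the lower bounds under which \<open>phase_local\<close> applies at the
  zeros.\<close>

lemma zeros_away_from_edges:
  obtains \<tau> N where "\<tau> > 0" "\<And>n t. n \<ge> N \<Longrightarrow> 0 < t \<Longrightarrow> t < pi \<Longrightarrow> q (2 * cos t) n = 0 \<Longrightarrow>
      \<tau> \<le> real n * t \<and> \<tau> \<le> real n * (pi - t)"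
proof -
  obtain t1 M1 where 1: "t1 > 0" "\<And>n t. n \<ge> M1 \<Longrightarrow> 0 \<le> t \<Longrightarrow> t \<le> pi / 2 \<Longrightarrow> real n * t \<le> t1 \<Longrightarrow> q (2 * cos t) n \<noteq> 0"
    by (rule phase_edge) (rule that)
  obtain t2 M2 where 2: "t2 > 0" "\<And>n t. n \<ge> M2 \<Longrightarrow> 0 \<le> t \<Longrightarrow> t \<le> pi / 2 \<Longrightarrow> real n * t \<le> t2 \<Longrightarrow> R.q (2 * cos t) n \<noteq> 0"
    by (rule R.phase_edge) (rule that)
  obtain M3 where M3: "real M3 > min t1 t2 / (pi / 2)" using reals_Archimedean2 by blast
  show thesis
  proof (rule that[of "min t1 t2" "max M1 (max M2 M3)"])
    fix n t assume n: "n \<ge> max M1 (max M2 M3)" and t: "0 < t" "t < pi" and 0: "q (2 * cos t) n = 0"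
    have "min t1 t2 / (pi / 2) \<le> real n"
      using M3 n by (meson less_imp_le max.bounded_iff of_nat_le_iff order_trans)
    then have big: "min t1 t2 \<le> real n * (pi / 2)" by (simp add: field_simps)
    have A: "min t1 t2 \<le> real n * t"
    proof (cases "t \<le> pi / 2")
      case True
      then show ?thesis using 1(2)[of n t] n t 0 by fastforce
    next
      case False
      then have "real n * (pi / 2) \<le> real n * t" by (intro mult_left_mono) auto
      then show ?thesis using big by linarith
    qed
    have B: "min t1 t2 \<le> real n * (pi - t)"
    proof (cases "pi - t \<le> pi / 2")
      case True
      have "R.q (2 * cos (pi - t)) n = 0" using 0 by (simp add: reflected_q)
      then show ?thesis using 2(2)[of n "pi - t"] n t True by fastforce
    next
      case False
      then have "real n * (pi / 2) \<le> real n * (pi - t)" by (intro mult_left_mono) auto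
      then show ?thesis using big by linarith
    qed
    from A B show "min t1 t2 \<le> real n * t \<and> min t1 t2 \<le> real n * (pi - t)" ..
  qed (use 1 2 in auto)
qed

lemma zero_gaps:
  assumes \<delta>: "\<delta> > 0"
  obtains N where "\<And>n t t'. n \<ge> N \<Longrightarrow> 0 < t \<Longrightarrow> t < t' \<Longrightarrow> t' < pi \<Longrightarrow>
      q (2 * cos t) n = 0 \<Longrightarrow> q (2 * cos t') n = 0 \<Longrightarrow>
      \<forall>u. t < u \<and> u < t' \<longrightarrow> q (2 * cos u) n \<noteq> 0 \<Longrightarrow> \<bar>real n * (t' - t) - pi\<bar> \<le> \<delta>"
proof -
  define \<delta>1 where "\<delta>1 = min \<delta> 1"
  have \<delta>1: "0 < \<delta>1" "\<delta>1 \<le> \<delta>" "\<delta>1 \<le> 1" using \<delta> by (auto simp: \<delta>1_def)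
  have "cos \<delta>1 < cos 0" using \<delta>1 pi_gt3 by (intro cos_monotone_0_pi) auto
  then have c1: "cos \<delta>1 < 1" by simp
  \<comment> \<open>1/2 is enough to read off signs where the sine is 1 or -1; the other bound turns
    \<open>1 + cos r \<le> \<epsilon>\<close> into
    \<open>cos (r - pi) > cos \<delta>1\<close>.\<close>
  define \<epsilon> where "\<epsilon> = min (1 / 2) ((1 - cos \<delta>1) / 2)"
  have \<epsilon>: "\<epsilon> > 0" "\<epsilon> \<le> 1 / 2" "\<epsilon> < 1 - cos \<delta>1" using c1 by (auto simp: \<epsilon>_def min_def)
  obtain \<tau> N1 where \<tau>: "\<tau> > 0" and N1: "\<And>n t. n \<ge> N1 \<Longrightarrow> 0 < t \<Longrightarrow> t < pi \<Longrightarrow> q (2 * cos t) n = 0 \<Longrightarrow>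
      \<tau> \<le> real n * t \<and> \<tau> \<le> real n * (pi - t)"
    by (rule zeros_away_from_edges) (rule that)
  obtain N2 where N2: "\<And>n t t'. n \<ge> N2 \<Longrightarrow> 0 < t \<Longrightarrow> t < pi \<Longrightarrow> 0 < t' \<Longrightarrow> t' < pi \<Longrightarrow>
     \<tau> \<le> real n * t \<Longrightarrow> \<tau> \<le> real n * t' \<Longrightarrow> \<tau> \<le> real n * (pi - t) \<Longrightarrow> \<tau> \<le> real n * (pi - t') \<Longrightarrow>
     real n * \<bar>t - t'\<bar> \<le> 2 * pi \<Longrightarrow> norm (sgn (Y t n) - sgn (Y t' n)) \<le> \<epsilon>"
    using \<tau> \<epsilon>(1) by (rule phase_local) (rule that)
  show thesis
  proof (rule that[of "max 1 (max N1 N2)"])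
    fix n t t' assume n: "n \<ge> max 1 (max N1 N2)" and t: "0 < t" "t < t'" "t' < pi"
      and zt: "q (2 * cos t) n = 0" and zt': "q (2 * cos t') n = 0"
      and no_zero: "\<forall>u. t < u \<and> u < t' \<longrightarrow> q (2 * cos u) n \<noteq> 0"
    have nz: "q (2 * cos u) n \<noteq> 0" if "t < u" "u < t'" for u using no_zero that by blast
    have n1: "n \<ge> 1" using n by simp
    have \<tau>t: "\<tau> \<le> real n * t" "\<tau> \<le> real n * (pi - t')"
      using N1[of n t] N1[of n t'] n t zt zt' by auto
    \<comment> \<open>At a zero \<open>X\<close> is real, so its direction is a sign:
      \<open>\<kappa>\<close> at \<open>t\<close>, and \<open>- \<kappa>\<close> at the next
      zero.\<close>
    define \<kappa> where "\<kappa> = sgn (- q (2 * cos t) (n - 1))"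
    have "X t n = of_real (- q (2 * cos t) (n - 1))" "X t' n = of_real (- q (2 * cos t') (n - 1))"
      by (simp_all add: X_def zt zt')
    then have Xt: "sgn (X t n) = of_real \<kappa>"
      and Xt': "sgn (X t' n) = of_real (sgn (- q (2 * cos t') (n - 1)))"
      unfolding \<kappa>_def by (simp_all only: sgn_of_real)
    have alt: "q (2 * cos t') (n - 1) * q (2 * cos t) (n - 1) < 0"
    proof (rule consecutive_zeros_sign)
      show "2 * cos t' < 2 * cos t" using cos_monotone_0_pi[of t t'] t by simp
      fix z assume z: "2 * cos t' < z" "z < 2 * cos t"
      have b: "-1 \<le> z / 2" "z / 2 \<le> 1" using z cos_ge_minus_one[of t'] cos_le_one[of t] by linarith+
      have cz: "cos (arccos (z / 2)) = z / 2" using b by (rule cos_arccos)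
      have "t < arccos (z / 2)"
        using z b t cz cos_mono_less_eq[of "arccos (z / 2)" t] arccos_lbound[OF b] arccos_ubound[OF b] by auto
      moreover have "arccos (z / 2) < t'"
        using z b t cz cos_mono_less_eq[of t' "arccos (z / 2)"] arccos_lbound[OF b] arccos_ubound[OF b] by auto
      ultimately show "q z n \<noteq> 0" using nz[of "arccos (z / 2)"] cz by simp
    qed (use n1 zt zt' in auto)
    then have \<kappa>: "\<kappa> = 1 \<or> \<kappa> = -1" and \<kappa>': "sgn (- q (2 * cos t') (n - 1)) = - \<kappa>"
      by (auto simp: \<kappa>_def sgn_if mult_less_0_iff)
    \<comment> \<open>Up to 2 pi / n beyond \<open>t\<close> the direction of \<open>Y\<close>
      hardly moves, so that of \<open>X\<close> rotates like \<open>cis (n * u)\<close>.\<close>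
    have near: "norm (sgn (X u n) - of_real \<kappa> * cis (real n * (u - t))) \<le> \<epsilon>"
      if u: "t \<le> u" "u \<le> t'" "real n * (u - t) \<le> 2 * pi" for u
    proof -
      have "\<tau> \<le> real n * u"
        by (rule order_trans[OF \<tau>t(1)]) (use u in \<open>auto intro: mult_left_mono\<close>)
      moreover have "\<tau> \<le> real n * (pi - u)" "\<tau> \<le> real n * (pi - t)"
        by (rule order_trans[OF \<tau>t(2)], use u t in \<open>auto intro: mult_left_mono\<close>)+
      ultimately have d: "norm (sgn (Y u n) - sgn (Y t n)) \<le> \<epsilon>"
        using u t \<tau>t(1) n by (intro N2) (auto simp: abs_of_nonneg)
      have sX: "sgn (X u n) = cis (real n * u) * sgn (Y u n)" for u
        by (simp add: X_eq sgn_mult sgn_div_norm[of "cis _"])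
      have "of_real \<kappa> * cis (real n * (u - t)) = cis (real n * (u - t)) * (cis (real n * t) * sgn (Y t n))"
        using sX[of t] Xt by simp
      also have "\<dots> = cis (real n * u) * sgn (Y t n)"
        by (simp add: cis_mult right_diff_distrib flip: mult.assoc)
      finally have "sgn (X u n) - of_real \<kappa> * cis (real n * (u - t)) = cis (real n * u) * (sgn (Y u n) - sgn (Y t n))"
        unfolding sX by (simp add: right_diff_distrib)
      then have "norm (sgn (X u n) - of_real \<kappa> * cis (real n * (u - t))) = norm (sgn (Y u n) - sgn (Y t n))"
        by (simp only: norm_mult norm_cis mult_1)
      with d show ?thesis by simp
    qed
    define r where "r = real n * (t' - t)"
    have r0: "r > 0" using n1 t by (simp add: r_def)
    \<comment> \<open>Up to 3 pi / 2, \<open>cos r\<close> close to -1 pins \<open>r\<close> to pi.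
      A larger gap would leave room for a sign change, hence for a zero strictly inside it.\<close>
    have "\<bar>r - pi\<bar> \<le> \<delta>1"
    proof (cases "r \<le> 3 / 2 * pi")
      case True
      then have "norm (sgn (X t' n) - of_real \<kappa> * cis r) \<le> \<epsilon>"
        unfolding r_def using pi_gt_zero t by (intro near) auto
      also have "sgn (X t' n) - of_real \<kappa> * cis r = - of_real \<kappa> * (1 + cis r)"
        unfolding Xt' \<kappa>' by (simp add: algebra_simps)
      also have "norm \<dots> = norm (1 + cis r)" using \<kappa> by (auto simp: norm_mult)
      finally have "1 + cos r \<le> \<epsilon>" using complex_Re_le_cmod[of "1 + cis r"] by simp
      then have cr: "cos (\<bar>r - pi\<bar>) > cos \<delta>1" using \<epsilon> by (simp add: cos_diff)
      show ?thesis
      proof (rule ccontr)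
        assume "\<not> \<bar>r - pi\<bar> \<le> \<delta>1"
        then have "cos \<bar>r - pi\<bar> < cos \<delta>1"
          using \<delta>1 True r0 pi_gt_zero by (intro cos_monotone_0_pi) (auto simp: abs_if)
        with cr show False by simp
      qed
    next
      case False
      \<comment> \<open>For c = 1/2 and c = 3/2 the normalised imaginary part of \<open>X\<close> is
        close to 1 and -1, well beyond the error, so \<open>q\<close> has opposite signs at these
        two angles.\<close>
      define u where "u c = t + c * pi / real n" for c
      have nu: "real n * (u c - t) = c * pi" for c using n1 by (simp add: u_def)
      have ut: "u c < t'" if "c \<le> 3 / 2" for c
      proof -
        have "c * pi \<le> 3 / 2 * pi" using that by (intro mult_right_mono) auto
        then have "real n * (u c - t) < real n * (t' - t)" using False unfolding nu r_def by linarith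
        then show ?thesis using n1 by (simp add: mult_less_cancel_left)
      qed
      have tu: "t < u c" if "c > 0" for c using that n1 by (simp add: u_def)
      have sign: "\<bar>\<kappa> * Im (sgn (X (u c) n)) - sin (c * pi)\<bar> \<le> 1 / 2" if c: "0 < c" "c \<le> 3 / 2" for c
      proof -
        have "real n * (u c - t) \<le> 2 * pi" unfolding nu using c by (intro mult_right_mono) auto
        then have "norm (sgn (X (u c) n) - of_real \<kappa> * cis (c * pi)) \<le> \<epsilon>"
          using near[of "u c"] ut[of c] tu[of c] c unfolding nu by simp
        then have "\<bar>Im (sgn (X (u c) n) - of_real \<kappa> * cis (c * pi))\<bar> \<le> 1 / 2"
          using abs_Im_le_cmod[of "sgn (X (u c) n) - of_real \<kappa> * cis (c * pi)"] \<epsilon> by linarith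
        moreover have "\<kappa> * Im (sgn (X (u c) n)) - sin (c * pi)
            = \<kappa> * Im (sgn (X (u c) n) - of_real \<kappa> * cis (c * pi))"
          using \<kappa> by auto
        ultimately show ?thesis using \<kappa> by (auto simp: abs_mult)
      qed
      have Im_sgn: "\<kappa> * Im (sgn (X v n)) = (sin v / norm (X v n)) * (\<kappa> * q (2 * cos v) n)" for v
        by (simp add: sgn_div_norm Im_X field_simps)
      have pos: "sin v / norm (X v n) > 0" if "0 < v" "v < pi" for v
        using that sin_gt_zero[of v] X_nonzero[of v n] n1 by simp
      have neg: "w < 0" if "v * w < 0" "v > 0" for v w :: real
        using that by (auto simp: mult_less_0_iff)
      have sin12: "sin (1 / 2 * pi) = 1" by simp
      have sin32: "sin (3 / 2 * pi) = -1"
        using sin_add[of pi "pi / 2"] by (simp add: field_simps)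
      have "\<kappa> * Im (sgn (X (u (1 / 2)) n)) > 0"
      proof -
        have "\<bar>z - sin (1 / 2 * pi)\<bar> \<le> 1 / 2 \<Longrightarrow> z > 0" for z unfolding sin12 by linarith
        then show ?thesis using sign[of "1 / 2"] by simp
      qed
      then have 1: "\<kappa> * q (2 * cos (u (1 / 2))) n > 0"
        unfolding Im_sgn by (rule zero_less_mult_pos[OF _ pos]) (use t tu[of "1 / 2"] ut[of "1 / 2"] in auto)
      have "\<kappa> * Im (sgn (X (u (3 / 2)) n)) < 0"
      proof -
        have "\<bar>z - sin (3 / 2 * pi)\<bar> \<le> 1 / 2 \<Longrightarrow> z < 0" for z unfolding sin32 by linarith
        then show ?thesis using sign[of "3 / 2"] by simp
      qed
      then have 2: "\<kappa> * q (2 * cos (u (3 / 2))) n < 0"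
        unfolding Im_sgn by (rule neg[OF _ pos]) (use t tu[of "3 / 2"] ut[of "3 / 2"] in auto)
      have uu: "u (1 / 2) \<le> u (3 / 2)" using n1 by (simp add: u_def field_simps)
      have "\<exists>v. u (1 / 2) \<le> v \<and> v \<le> u (3 / 2) \<and> \<kappa> * q (2 * cos v) n = 0"
      proof (rule IVT2)
        show "\<forall>x. u (1 / 2) \<le> x \<and> x \<le> u (3 / 2) \<longrightarrow> isCont (\<lambda>v. \<kappa> * q (2 * cos v) n) x"
          unfolding q_def by (intro allI impI continuous_intros)
      qed (use 1 2 uu in auto)
      then obtain v where "u (1 / 2) \<le> v" "v \<le> u (3 / 2)" "q (2 * cos v) n = 0" using \<kappa> by auto
      then show ?thesis using nz[of v] tu[of "1 / 2"] ut[of "3 / 2"] by auto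
    qed
    then show "\<bar>real n * (t' - t) - pi\<bar> \<le> \<delta>" using \<delta>1 by (simp add: r_def)
  qed
qed

end

section \<open>Mass points\<close>

text \<open>Second countability: the complement of the support is covered by the countably many
  basic open sets of measure 0.\<close>

lemma AE_in_measure_support:
  fixes \<mu> :: "real measure"
  assumes "sets \<mu> = sets borel"
  shows "AE x in \<mu>. x \<in> measure_support \<mu>"
proof -
  obtain B :: "real set set" where B: "countable B" "topological_basis B"
    using ex_countable_basis by blast
  let ?N = "{b \<in> B. emeasure \<mu> b = 0}"
  have null: "\<Union>?N \<in> null_sets \<mu>"
  proof -
    have "countable ?N" using B(1) by (rule countable_subset[rotated]) auto
    moreover have "b \<in> null_sets \<mu>" if "b \<in> ?N" for b
      using that B(2) assms by (auto simp: null_sets_def topological_basis_open)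
    ultimately have "(\<Union>b\<in>?N. b) \<in> null_sets \<mu>" by (rule null_sets_UN')
    then show ?thesis by simp
  qed
  show ?thesis
  proof (rule AE_I'[OF null], rule subsetI)
    fix x assume "x \<in> {x \<in> space \<mu>. x \<notin> measure_support \<mu>}"
    then obtain U where U: "open U" "x \<in> U" "emeasure \<mu> U = 0"
      by (auto simp: measure_support_def not_less)
    then obtain b where b: "b \<in> B" "x \<in> b" "b \<subseteq> U" using B(2) topological_basisE by blast
    have "emeasure \<mu> b \<le> emeasure \<mu> U" using b U assms by (intro emeasure_mono) auto
    then have "emeasure \<mu> b = 0" using U by simp
    then show "x \<in> \<Union>?N" using b by blast
  qed
qed

lemma integrable_poly:
  fixes \<mu> :: "real measure"
  assumes "prob_space \<mu>" and sets: "sets \<mu> = sets borel" and bd: "AE x in \<mu>. \<bar>x\<bar> \<le> R"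
  shows "integrable \<mu> (poly f)"
proof -
  interpret prob_space \<mu> by fact
  have "compact (poly f ` {-R..R})"
    by (intro compact_continuous_image continuous_intros) auto
  then have "bounded (poly f ` {-R..R})" by (rule compact_imp_bounded)
  then obtain C where "\<forall>y\<in>poly f ` {-R..R}. norm y \<le> C" unfolding bounded_iff by blast
  then have C: "\<bar>poly f x\<bar> \<le> C" if "x \<in> {-R..R}" for x using that by simp
  show ?thesis
  proof (rule integrable_const_bound)
    show "AE x in \<mu>. norm (poly f x) \<le> C" using bd by eventually_elim (auto intro!: C)
    have "poly f \<in> borel_measurable borel" by (intro borel_measurable_continuous_onI continuous_intros)
    then show "poly f \<in> borel_measurable \<mu>" by (simp add: measurable_cong_sets[OF sets refl])
  qed
qed

locale jacobi_measure = jacobi_polys p a b + prob_space \<mu>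
  for p :: "nat \<Rightarrow> real poly" and a b and \<mu> :: "real measure" +
  fixes R :: real
  assumes sets_\<mu>: "sets \<mu> = sets borel"
    and AE_bounded: "AE x in \<mu>. \<bar>x\<bar> \<le> R"
    and orthonormal: "\<And>m n. (\<integral>x. q x m * q x n \<partial>\<mu>) = (if m = n then 1 else 0)"
begin

lemma integrable_qq: "integrable \<mu> (\<lambda>x. q x m * q x n)"
proof -
  have "poly (p m * p n) = (\<lambda>x. q x m * q x n)" by (auto simp: q_def)
  then show ?thesis
    using integrable_poly[OF prob_space_axioms sets_\<mu> AE_bounded, of "p m * p n"] by simp
qed

text \<open>Parseval's identity for finite expansions in the orthonormal polynomials.\<close>

lemma integral_square_sum:
  "(\<integral>x. (\<Sum>k\<le>n. c k * q x k)\<^sup>2 \<partial>\<mu>) = (\<Sum>k\<le>n. (c k)\<^sup>2)"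
proof -
  have "(\<integral>x. (\<Sum>k\<le>n. c k * q x k)\<^sup>2 \<partial>\<mu>) = (\<integral>x. (\<Sum>i\<le>n. \<Sum>j\<le>n. (c i * c j) * (q x i * q x j)) \<partial>\<mu>)"
    by (simp add: power2_eq_square sum_product mult_ac)
  also have "\<dots> = (\<Sum>i\<le>n. \<Sum>j\<le>n. (c i * c j) * (\<integral>x. q x i * q x j \<partial>\<mu>))"
    by (subst Bochner_Integration.integral_sum |
        intro Bochner_Integration.integrable_sum integrable_mult_right integrable_qq sum.cong refl | simp)+
  also have "\<dots> = (\<Sum>k\<le>n. (c k)\<^sup>2)"
    by (simp add: orthonormal power2_eq_square if_distrib cong: if_cong)
  finally show ?thesis .
qed

lemma poly_expansion:
  assumes "degree f \<le> n"
  obtains c where "\<And>x. poly f x = (\<Sum>k\<le>n. c k * q x k)"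
proof -
  have "\<exists>c. \<forall>x. poly f x = (\<Sum>k\<le>n. c k * q x k)"
    using assms
  proof (induction n arbitrary: f)
    case 0
    then obtain h where "f = [:h:]" by (auto elim: degree_eq_zeroE)
    then show ?case by (intro exI[of _ "\<lambda>_. h"]) simp
  next
    case (Suc n)
    define r where "r = coeff f (Suc n) / coeff (p (Suc n)) (Suc n)"
    define g where "g = f - smult r (p (Suc n))"
    have "coeff (p (Suc n)) (Suc n) \<noteq> 0" using lead_coeff_p[of "Suc n"] degree_p[of "Suc n"] by simp
    then have top: "coeff g (Suc n) = 0" by (simp add: g_def r_def)
    have "degree g \<le> Suc n"
      using Suc.prems degree_p[of "Suc n"] unfolding g_def
      by (intro degree_diff_le order_trans[OF degree_smult_le]) auto
    then have "degree g \<le> n" using top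
      by (metis le_SucE leading_coeff_0_iff degree_0 le0)
    then obtain c where c: "\<And>x. poly g x = (\<Sum>k\<le>n. c k * q x k)" using Suc.IH by blast
    have "poly f x = poly g x + r * q x (Suc n)" for x by (simp add: g_def q_def)
    then have "poly f x = (\<Sum>k\<le>Suc n. (c(Suc n := r)) k * q x k)" for x
      by (simp add: c cong: sum.cong_simp)
    then show ?case by blast
  qed
  then show thesis using that by blast
qed

text \<open>The test polynomial is the Christoffel-Darboux kernel at \<open>E\<close>: the integral
  of its square equals its value K at \<open>E\<close>, so K^2 times the mass is at most K, and the
  partial sums stay below the inverse mass.\<close>

lemma mass_point_imp_l2:
  assumes "measure \<mu> {E} > 0"
  shows "E \<in> l2_points"
proof -
  let ?m = "measure \<mu> {E}"
  have sE: "{E} \<in> sets \<mu>" by (simp add: sets_\<mu>)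
  have "(\<Sum>k\<le>n. (q E k)\<^sup>2) \<le> 1 / ?m" for n
  proof -
    let ?K = "\<Sum>k\<le>n. (q E k)\<^sup>2"
    let ?f = "\<lambda>x. \<Sum>k\<le>n. q E k * q x k"
    have fp: "(\<lambda>x. (?f x)\<^sup>2) = poly ((\<Sum>k\<le>n. smult (q E k) (p k))\<^sup>2)"
      by (auto simp: poly_sum q_def)
    have "?K\<^sup>2 * ?m = (\<integral>x. ?K\<^sup>2 * indicator {E} x \<partial>\<mu>)" using sE by simp
    also have "\<dots> \<le> (\<integral>x. (?f x)\<^sup>2 \<partial>\<mu>)"
    proof (rule integral_mono)
      show "integrable \<mu> (\<lambda>x. ?K\<^sup>2 * indicator {E} x)"
        using sE by (intro integrable_mult_right integrable_real_indicator) (auto simp: emeasure_eq_measure)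
      show "integrable \<mu> (\<lambda>x. (?f x)\<^sup>2)"
        unfolding fp by (rule integrable_poly[OF prob_space_axioms sets_\<mu> AE_bounded])
      show "?K\<^sup>2 * indicator {E} x \<le> (?f x)\<^sup>2" for x
        by (auto simp: indicator_def power2_eq_square)
    qed
    also have "\<dots> = ?K" by (rule integral_square_sum)
    finally have "?K * (?K * ?m) \<le> ?K * 1" by (simp add: power2_eq_square mult_ac)
    moreover have "?K > 0" using sum_q_square_pos[of E n] by (simp add: power2_eq_square)
    ultimately have "?K * ?m \<le> 1" by (simp only: mult_le_cancel_left_pos)
    then show ?thesis using assms by (simp add: field_simps)
  qed
  then have "(\<Sum>k<n. (q E k)\<^sup>2) \<le> 1 / ?m" for n
    using sum_mono2[of "{..n}" "{..<n}" "\<lambda>k. (q E k)\<^sup>2"] by (meson order_trans finite_atMost lessThan_subset_iff less_imp_le subsetI atMost_iff lessThan_iff zero_le_power2)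
  then show ?thesis unfolding l2_points_def
    by (auto intro: summableI_nonneg_bounded[where x = "1 / ?m"])
qed

text \<open>Expansion and Cauchy-Schwarz bound \<open>(poly f E)^2\<close> by \<open>K\<close> times
  the integral of the square of \<open>f\<close>. For polynomials peaking at \<open>E\<close> this
  integral shrinks to the mass of \<open>E\<close>.\<close>

lemma l2_imp_mass_point:
  assumes "E \<in> l2_points"
  shows "measure \<mu> {E} > 0"
proof -
  define K where "K = (\<Sum>k. (q E k)\<^sup>2)"
  have sK: "summable (\<lambda>k. (q E k)\<^sup>2)" using assms by (simp add: l2_points_def)
  have ineq: "(poly f E)\<^sup>2 \<le> K * (\<integral>x. (poly f x)\<^sup>2 \<partial>\<mu>)" for f
  proof -
    obtain c where c: "\<And>x. poly f x = (\<Sum>k\<le>degree f. c k * q x k)"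
      using poly_expansion[OF order_refl] by blast
    have "(poly f E)\<^sup>2 \<le> (\<Sum>k\<le>degree f. (c k)\<^sup>2) * (\<Sum>k\<le>degree f. (q E k)\<^sup>2)"
      unfolding c by (rule Cauchy_Schwarz_ineq_sum)
    also have "\<dots> \<le> (\<Sum>k\<le>degree f. (c k)\<^sup>2) * K"
      unfolding K_def by (intro mult_left_mono sum_le_suminf sK sum_nonneg) auto
    also have "(\<Sum>k\<le>degree f. (c k)\<^sup>2) = (\<integral>x. (poly f x)\<^sup>2 \<partial>\<mu>)"
      unfolding c by (rule integral_square_sum[symmetric])
    finally show ?thesis by (simp add: mult.commute)
  qed
  \<comment> \<open>Exceeds the distance of \<open>E\<close> from any point with
    \<open>\<bar>x\<bar> \<le> R\<close>; there \<open>g\<close> lies between 0 and 1 and equals 1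
    only at \<open>E\<close>.\<close>
  define L where "L = \<bar>R\<bar> + \<bar>E\<bar> + 1"
  have L: "L > 0" by (simp add: L_def)
  define g where "g = [:1:] - smult (1 / L\<^sup>2) ([:- E, 1:]\<^sup>2)"
  have g: "poly g x = 1 - ((x - E) / L)\<^sup>2" for x
  proof -
    have "poly g x = 1 - (1 / L\<^sup>2) * (x - E)\<^sup>2" by (simp add: g_def)
    then show ?thesis by (simp add: power_divide)
  qed
  have g_bd: "0 \<le> poly g x \<and> poly g x \<le> 1" if "\<bar>x\<bar> \<le> R" for x
  proof -
    have "\<bar>(x - E) / L\<bar> \<le> 1" using that L by (simp add: abs_divide L_def)
    then have "((x - E) / L)\<^sup>2 \<le> 1" by (simp add: abs_square_le_1)
    then show ?thesis by (simp add: g)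
  qed
  have meas: "poly f \<in> borel_measurable \<mu>" for f
  proof -
    have "poly f \<in> borel_measurable borel" by (intro borel_measurable_continuous_onI continuous_intros)
    then show ?thesis by (simp add: measurable_cong_sets[OF sets_\<mu> refl])
  qed
  have "(\<lambda>m. \<integral>x. (poly (g ^ m) x)\<^sup>2 \<partial>\<mu>) \<longlonglongrightarrow> (\<integral>x. indicator {E} x \<partial>\<mu>)"
  proof (rule integral_dominated_convergence[where w = "\<lambda>_. 1"])
    show "indicat_real {E} \<in> borel_measurable \<mu>"
      by (rule borel_measurable_indicator) (simp add: sets_\<mu>)
    show "(\<lambda>x. (poly (g ^ m) x)\<^sup>2) \<in> borel_measurable \<mu>" for m using meas by measurable
    show "AE x in \<mu>. (\<lambda>m. (poly (g ^ m) x)\<^sup>2) \<longlonglongrightarrow> indicat_real {E} x"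
      using AE_bounded
    proof eventually_elim
      case (elim x)
      show ?case
      proof (cases "x = E")
        case True
        then show ?thesis by (simp add: g poly_power)
      next
        case False
        have "poly g x < 1" using False L by (simp add: g)
        then have "(\<lambda>m. poly g x ^ m) \<longlonglongrightarrow> 0"
          using g_bd[OF elim] by (simp add: LIMSEQ_power_zero)
        then have "(\<lambda>m. (poly g x ^ m)\<^sup>2) \<longlonglongrightarrow> 0\<^sup>2" by (rule tendsto_power)
        then show ?thesis using False by (simp add: poly_power)
      qed
    qed
    show "AE x in \<mu>. norm ((poly (g ^ m) x)\<^sup>2) \<le> 1" for m
      using AE_bounded
    proof eventually_elim
      case (elim x)
      then show ?case using g_bd[OF elim] by (simp add: poly_power power_le_one)
    qed
  qed simp
  then have "(\<lambda>m. K * (\<integral>x. (poly (g ^ m) x)\<^sup>2 \<partial>\<mu>)) \<longlonglongrightarrow> K * measure \<mu> {E}"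
    by (intro tendsto_mult tendsto_const) (simp add: sets_\<mu>)
  moreover have "1 \<le> K * (\<integral>x. (poly (g ^ m) x)\<^sup>2 \<partial>\<mu>)" for m
    using ineq[of "g ^ m"] by (simp add: poly_power g)
  ultimately have "1 \<le> K * measure \<mu> {E}" by (intro Lim_bounded2[where N = 0]) auto
  then show ?thesis by (cases "measure \<mu> {E} = 0") (auto simp: measure_nonneg less_le)
qed

lemma mass_point_iff_l2: "measure \<mu> {E} > 0 \<longleftrightarrow> E \<in> l2_points"
  using mass_point_imp_l2 l2_imp_mass_point by blast

end

section \<open>Angles of the zeros\<close>

text \<open>Zeros at 2 or -2 would have the angles 0 and pi, which the open interval excludes; the
  assumption \<open>ends\<close> rules them out.\<close>

lemma zero_angles_exist:
  assumes fin: "finite {x \<in> {-2..2}. poly f x = 0}"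
    and card: "card {x \<in> {-2..2}. poly f x = 0} = m"
    and ends: "poly f 2 \<noteq> 0" "poly f (-2) \<noteq> 0"
  shows "\<exists>\<phi>. zero_angles f m \<phi>"
proof -
  let ?Z = "{x \<in> {-2..2}. poly f x = 0}"
  let ?A = "(\<lambda>x. arccos (x / 2)) ` ?Z"
  have inside: "-2 < x" "x < 2" if "x \<in> ?Z" for x
    using that ends by (auto simp: less_le)
  have cos: "2 * cos (arccos (x / 2)) = x" if "x \<in> ?Z" for x
    using that by (simp add: cos_arccos)
  have inj: "inj_on (\<lambda>x. arccos (x / 2)) ?Z" by (rule inj_on_inverseI[where g = "\<lambda>t. 2 * cos t"]) (rule cos)
  have A: "finite ?A" "card ?A = m" using fin card inj by (auto simp: card_image)
  let ?l = "sorted_list_of_set ?A"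
  have l: "set ?l = ?A" "length ?l = m" "sorted_wrt (<) ?l"
    using A by (auto simp: strict_sorted_iff)
  \<comment> \<open>List positions start at 0, the indices of the angles at 1.\<close>
  define \<phi> where "\<phi> k = ?l ! (k - 1)" for k
  have im: "\<phi> ` {1..m} = ?A"
  proof -
    have "\<phi> ` {1..m} = (\<lambda>k. ?l ! k) ` ((\<lambda>k. k - 1) ` {1..m})" by (simp add: \<phi>_def image_image)
    also have "(\<lambda>k. k - 1) ` {1..m} = {0..<m}"
    proof (intro equalityI subsetI)
      fix k assume "k \<in> {0..<m}"
      then show "k \<in> (\<lambda>k. k - 1) ` {1..m}" by (intro image_eqI[of _ _ "Suc k"]) auto
    qed auto
    also have "(\<lambda>k. ?l ! k) ` {0..<m} = ?A"
    proof -
      have "(\<lambda>k. xs ! k) ` {0..<length xs} = set xs" for xs :: "real list"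
        by (auto simp: set_conv_nth)
      from this[of ?l] show ?thesis unfolding l(1,2) .
    qed
    finally show ?thesis .
  qed
  have "strict_mono_on {1..m} \<phi>"
  proof (rule strict_mono_onI)
    fix i j assume "i \<in> {1..m}" "j \<in> {1..m}" "i < j"
    then have "i - 1 < j - 1" "j - 1 < length ?l" using l(2) by auto
    then show "\<phi> i < \<phi> j" unfolding \<phi>_def using l(3) by (rule sorted_wrt_nth_less[rotated])
  qed
  moreover have "\<phi> ` {1..m} \<subseteq> {0<..<pi}"
    unfolding im using inside by (auto intro!: arccos_lt_bounded)
  moreover have "(\<lambda>k. 2 * cos (\<phi> k)) ` {1..m} = ?Z"
  proof -
    have "(\<lambda>k. 2 * cos (\<phi> k)) ` {1..m} = (\<lambda>t. 2 * cos t) ` (\<phi> ` {1..m})" by (simp only: image_image)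
    also have "\<dots> = (\<lambda>t. 2 * cos t) ` ?A" unfolding im ..
    also have "\<dots> = ?Z" unfolding image_image using cos by force
    finally show ?thesis .
  qed
  ultimately show ?thesis unfolding zero_angles_def by blast
qed

lemma zero_angles_consecutive:
  assumes z: "zero_angles f m \<theta>" and j: "j \<in> {1..m - 1}"
  shows "0 < \<theta> j" "\<theta> j < \<theta> (j + 1)" "\<theta> (j + 1) < pi"
    "poly f (2 * cos (\<theta> j)) = 0" "poly f (2 * cos (\<theta> (j + 1))) = 0"
    "\<And>u. \<theta> j < u \<Longrightarrow> u < \<theta> (j + 1) \<Longrightarrow> poly f (2 * cos u) \<noteq> 0"
proof -
  have mono: "strict_mono_on {1..m} \<theta>" and range: "\<theta> ` {1..m} \<subseteq> {0<..<pi}"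
    and zeros: "(\<lambda>l. 2 * cos (\<theta> l)) ` {1..m} = {x \<in> {-2..2}. poly f x = 0}"
    using z by (auto simp: zero_angles_def)
  have jm: "j \<in> {1..m}" "j + 1 \<in> {1..m}" using j by auto
  have rng: "\<theta> l \<in> {0<..<pi}" if "l \<in> {1..m}" for l
    by (rule subsetD[OF range imageI[OF that]])
  show 1: "0 < \<theta> j" "\<theta> (j + 1) < pi" using rng[OF jm(1)] rng[OF jm(2)] by simp_all
  show "\<theta> j < \<theta> (j + 1)" using strict_mono_onD[OF mono jm] by simp
  have "poly f (2 * cos (\<theta> l)) = 0" if "l \<in> {1..m}" for l
  proof -
    have "2 * cos (\<theta> l) \<in> {x \<in> {-2..2}. poly f x = 0}"
      unfolding zeros[symmetric] using that by (rule imageI)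
    then show ?thesis by simp
  qed
  from this[OF jm(1)] this[OF jm(2)]
  show "poly f (2 * cos (\<theta> j)) = 0" "poly f (2 * cos (\<theta> (j + 1))) = 0" by simp_all
  fix u assume u: "\<theta> j < u" "u < \<theta> (j + 1)"
  show "poly f (2 * cos u) \<noteq> 0"
  proof
    assume "poly f (2 * cos u) = 0"
    then have "2 * cos u \<in> {x \<in> {-2..2}. poly f x = 0}"
      using cos_ge_minus_one[of u] cos_le_one[of u] by auto
    then obtain l where l: "l \<in> {1..m}" "cos u = cos (\<theta> l)" unfolding zeros[symmetric] by auto
    have lpi: "0 < \<theta> l" "\<theta> l < pi" using rng[OF l(1)] by simp_all
    have "0 \<le> u" "u \<le> pi" using u 1 by linarith+
    then have ul: "u = \<theta> l"
      using less_imp_le[OF lpi(1)] less_imp_le[OF lpi(2)] l(2) by (rule cos_inj_pi)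
    have "\<theta> j < \<theta> l" "\<theta> l < \<theta> (j + 1)" using u unfolding ul .
    then have "j < l" "l < j + 1"
      unfolding strict_mono_on_less[OF mono jm(1) l(1)] strict_mono_on_less[OF mono l(1) jm(2)] .
    then show False by simp
  qed
qed

lemma uminus_image_right_of_2:
  "{x :: real. x < -2 \<and> Q x} = uminus ` {x. x > 2 \<and> Q (- x)}"
proof (intro equalityI subsetI)
  fix x assume "x \<in> {x :: real. x < -2 \<and> Q x}"
  then show "x \<in> uminus ` {x. x > 2 \<and> Q (- x)}" by (intro image_eqI[of x uminus "- x"]) auto
qed auto

section \<open>Both exterior half-lines and the limit for the angles\<close>

context jacobi_polys
begin

interpretation R: jacobi_polys "\<lambda>n. smult ((-1) ^ n) (pcompose (p n) [:0, -1:])" a "\<lambda>n. - b n"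
  by (rule reflected)

lemma left_zeros: "{x. x < -2 \<and> q x n = 0} = uminus ` {x. x > 2 \<and> R.q x n = 0}"
  unfolding uminus_image_right_of_2 by (simp add: reflected_q)

lemma left_l2_points: "{x \<in> l2_points. x < -2} = uminus ` {x \<in> R.l2_points. x > 2}"
proof -
  have "(R.q x n)\<^sup>2 = (q (- x) n)\<^sup>2" for x n
    by (simp add: reflected_q power_mult_distrib flip: power_mult)
  then have "x \<in> R.l2_points \<longleftrightarrow> - x \<in> l2_points" for x by (simp add: R.l2_points_def l2_points_def)
  then show ?thesis using uminus_image_right_of_2[of "\<lambda>x. x \<in> l2_points"] by (simp add: conj_commute)
qed

lemma exterior_l2_points: "{x \<in> l2_points. x \<notin> {-2..2}} = {x \<in> l2_points. x > 2} \<union> {x \<in> l2_points. x < -2}"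
  by auto

lemma finite_exterior_l2_points: "finite {x \<in> l2_points. x \<notin> {-2..2}}"
  unfolding exterior_l2_points left_l2_points using exterior_zero_count(1) R.exterior_zero_count(1) by simp

lemma eventually_exterior_zeros:
  "eventually (\<lambda>n. card {x. x \<notin> {-2..2} \<and> q x n = 0} = card {x \<in> l2_points. x \<notin> {-2..2}}) sequentially"
  using exterior_zero_count(2) R.exterior_zero_count(2)
proof eventually_elim
  case (elim n)
  have split: "{x. x \<notin> {-2..2} \<and> q x n = 0} = {x. x > 2 \<and> q x n = 0} \<union> {x. x < -2 \<and> q x n = 0}"
    by auto
  have 1: "card ({x. x > 2 \<and> q x n = 0} \<union> {x. x < -2 \<and> q x n = 0})
      = card {x. x > 2 \<and> q x n = 0} + card {x. x < -2 \<and> q x n = 0}"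
    by (intro card_Un_disjoint finite_subset[OF _ finite_zeros[of n]]) auto
  have 2: "card {x. x < -2 \<and> q x n = 0} = card {x \<in> l2_points. x < -2}"
    unfolding left_zeros left_l2_points using elim(2) by (simp add: card_image)
  have 3: "card ({x \<in> l2_points. x > 2} \<union> {x \<in> l2_points. x < -2}) = card {x \<in> l2_points. x > 2} + card {x \<in> l2_points. x < -2}"
    by (intro card_Un_disjoint finite_subset[OF _ finite_exterior_l2_points]) auto
  show ?case unfolding split exterior_l2_points 1 2 3 elim(1) ..
qed

lemma eventually_nonzero_at_ends: "eventually (\<lambda>n. q 2 n \<noteq> 0 \<and> q (-2) n \<noteq> 0) sequentially"
proof -
  obtain r n0 where 1: "r > 0" "\<And>x n. 2 \<le> x \<Longrightarrow> x < 2 + r \<Longrightarrow> n \<ge> n0 \<Longrightarrow> q x n \<noteq> 0"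
    by (rule no_zeros_right_of_2) (rule that)
  obtain r' n0' where 2: "r' > 0" "\<And>x n. 2 \<le> x \<Longrightarrow> x < 2 + r' \<Longrightarrow> n \<ge> n0' \<Longrightarrow> R.q x n \<noteq> 0"
    by (rule R.no_zeros_right_of_2) (rule that)
  show ?thesis
  proof (rule eventually_sequentiallyI[of "max n0 n0'"])
    fix n assume "max n0 n0' \<le> n"
    then show "q 2 n \<noteq> 0 \<and> q (-2) n \<noteq> 0" using 1(1) 1(2)[of 2 n] 2(1) 2(2)[of 2 n] by (simp add: reflected_q)
  qed
qed

text \<open>As all \<open>n\<close> zeros are real and simple, the exterior count determines the
  count in \<open>[-2,2]\<close>. Angles exist once neither endpoint is a zero.\<close>

lemma zero_structure:
  fixes J :: nat
  defines "J \<equiv> card {x \<in> l2_points. x \<notin> {-2..2}}"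
  shows "\<forall>\<^sub>F n in sequentially. J \<le> n \<and> card {x. x \<notin> {-2..2} \<and> poly (p n) x = 0} = J \<and>
       card {x \<in> {-2..2}. poly (p n) x = 0} = n - J"
    and "\<forall>\<^sub>F n in sequentially. \<exists>\<phi>. zero_angles (p n) (n - J) \<phi>"
proof -
  show counts: "\<forall>\<^sub>F n in sequentially. J \<le> n \<and> card {x. x \<notin> {-2..2} \<and> poly (p n) x = 0} = J \<and>
       card {x \<in> {-2..2}. poly (p n) x = 0} = n - J"
    using eventually_exterior_zeros
  proof eventually_elim
    case (elim n)
    have split: "{x. q x n = 0} = {x. x \<notin> {-2..2} \<and> q x n = 0} \<union> {x \<in> {-2..2}. q x n = 0}" by auto
    have "n = card {x. q x n = 0}" by (simp only: card_zeros)
    also have "\<dots> = card ({x. x \<notin> {-2..2} \<and> q x n = 0} \<union> {x \<in> {-2..2}. q x n = 0})"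
      by (rule arg_cong[OF split])
    also have "\<dots> = card {x. x \<notin> {-2..2} \<and> q x n = 0} + card {x \<in> {-2..2}. q x n = 0}"
      by (intro card_Un_disjoint finite_subset[OF _ finite_zeros[of n]]) auto
    also have "card {x. x \<notin> {-2..2} \<and> q x n = 0} = J" unfolding J_def by (rule elim)
    finally have "n = J + card {x \<in> {-2..2}. q x n = 0}" .
    then show ?case using elim unfolding J_def q_def by simp
  qed
  show "\<forall>\<^sub>F n in sequentially. \<exists>\<phi>. zero_angles (p n) (n - J) \<phi>"
    using counts eventually_nonzero_at_ends
  proof eventually_elim
    case (elim n)
    have "finite {x \<in> {-2..2}. poly (p n) x = 0}"
      by (rule finite_subset[OF _ finite_zeros[of n]]) (auto simp: q_def)
    then show ?case using elim by (intro zero_angles_exist) (auto simp: q_def)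
  qed
qed

lemma zero_angles_clock:
  fixes m :: "nat \<Rightarrow> nat"
  assumes \<theta>: "\<forall>\<^sub>F n in sequentially. zero_angles (p n) (m n) (\<theta> n)"
    and m: "\<forall>\<^sub>F n in sequentially. m n \<ge> 2"
  shows "(\<lambda>n. SUP j\<in>{1..m n - 1}.
          real n * \<bar>\<theta> n (j + 1) - \<theta> n j - 2 * pi / (2 * real n)\<bar>) \<longlonglongrightarrow> 0"
proof (rule tendstoI)
  fix \<epsilon> :: real assume \<epsilon>: "\<epsilon> > 0"
  then have "\<epsilon> / 2 > 0" by simp
  then obtain N where N: "\<And>n t t'. n \<ge> N \<Longrightarrow> 0 < t \<Longrightarrow> t < t' \<Longrightarrow> t' < pi \<Longrightarrow>
      q (2 * cos t) n = 0 \<Longrightarrow> q (2 * cos t') n = 0 \<Longrightarrow>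
      \<forall>u. t < u \<and> u < t' \<longrightarrow> q (2 * cos u) n \<noteq> 0 \<Longrightarrow> \<bar>real n * (t' - t) - pi\<bar> \<le> \<epsilon> / 2"
    by (rule zero_gaps) (rule that)
  show "\<forall>\<^sub>F n in sequentially. dist (SUP j\<in>{1..m n - 1}.
          real n * \<bar>\<theta> n (j + 1) - \<theta> n j - 2 * pi / (2 * real n)\<bar>) 0 < \<epsilon>"
    using \<theta> m eventually_ge_at_top[of "max N 1"]
  proof eventually_elim
    case (elim n)
    let ?g = "\<lambda>j. real n * \<bar>\<theta> n (j + 1) - \<theta> n j - 2 * pi / (2 * real n)\<bar>"
    \<comment> \<open>At least two angles make the index set nonempty; on the empty set the real
      supremum would be an arbitrary value.\<close>
    have ne: "{1..m n - 1} \<noteq> {}" using elim(2) by auto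
    have bound: "?g j \<le> \<epsilon> / 2" if j: "j \<in> {1..m n - 1}" for j
    proof -
      note c = zero_angles_consecutive[OF elim(1) j]
      have "?g j = \<bar>real n * (\<theta> n (j + 1) - \<theta> n j - 2 * pi / (2 * real n))\<bar>" by (simp add: abs_mult)
      also have "real n * (\<theta> n (j + 1) - \<theta> n j - 2 * pi / (2 * real n)) = real n * (\<theta> n (j + 1) - \<theta> n j) - pi"
        using elim(3) by (simp add: right_diff_distrib)
      also have "\<bar>\<dots>\<bar> \<le> \<epsilon> / 2" using c elim(3) by (intro N) (auto simp: q_def)
      finally show ?thesis .
    qed
    have "(SUP j\<in>{1..m n - 1}. ?g j) \<le> \<epsilon> / 2" by (rule cSUP_least[OF ne bound])
    moreover have "0 \<le> (SUP j\<in>{1..m n - 1}. ?g j)"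
    proof -
      obtain j where j: "j \<in> {1..m n - 1}" using ne by blast
      have "0 \<le> ?g j" by simp
      also have "?g j \<le> (SUP j\<in>{1..m n - 1}. ?g j)" by (rule cSUP_upper[OF j]) simp
      finally show ?thesis .
    qed
    ultimately show ?case using \<epsilon> by (simp add: dist_real_def)
  qed
qed

end

section \<open>From the monic polynomials of the measure to the orthonormal recursion\<close>

lemma zero_angles_cong:
  assumes "\<And>x. poly f x = 0 \<longleftrightarrow> poly g x = 0"
  shows "zero_angles f = zero_angles g"
  by (intro ext) (simp add: zero_angles_def assms)

theorem theorem4p2:
  fixes \<mu> :: "real measure"
    and P :: "nat \<Rightarrow> real poly"
    and a b :: "nat \<Rightarrow> real"
    and J :: nat
  assumes prob: "prob_space \<mu>"
    and borel_sets: "sets \<mu> = sets borel"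
    and bounded_support: "bounded (measure_support \<mu>)"
    and infinite_support: "infinite (measure_support \<mu>)"
    and monic_OPs: "monic_orthogonal_polys \<mu> P"
    and jacobi: "jacobi_parameters P a b"
    and decay: "summable (\<lambda>n. real n * (\<bar>a n - 1\<bar> + \<bar>b n\<bar>))"
    and J: "J = card (exterior_mass_points \<mu>)"
  shows "finite (exterior_mass_points \<mu>) \<and>
    (\<forall>\<^sub>F n in sequentially.
       J \<le> n \<and>
       card {x. x \<notin> {-2..2} \<and> poly (P n) x = 0} = J \<and>
       card {x \<in> {-2..2}. poly (P n) x = 0} = n - J) \<and>
    (\<forall>\<^sub>F n in sequentially. \<exists>\<phi>. zero_angles (P n) (n - J) \<phi>) \<and>
    (\<forall>\<theta> :: nat \<Rightarrow> nat \<Rightarrow> real.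
       (\<forall>\<^sub>F n in sequentially. zero_angles (P n) (n - J) (\<theta> n)) \<longrightarrow>
       (\<lambda>n. SUP j\<in>{1..n - J - 1}.
          real n * \<bar>\<theta> n (j + 1) - \<theta> n j - 2 * pi / (2 * real n)\<bar>) \<longlonglongrightarrow> 0)"
proof -
  interpret prob_space \<mu> by (rule prob)
  have a_pos: "a n > 0" if "n \<ge> 1" for n using jacobi that by (simp add: jacobi_parameters_def)
  have rec: "[:0, 1:] * P n = P (Suc n) + smult (b (Suc n)) (P n)
      + (if n = 0 then 0 else smult ((a n)\<^sup>2) (P (n - 1)))" for n
    using jacobi by (simp add: jacobi_parameters_def)
  have monic: "degree (P n) = n" "lead_coeff (P n) = 1" for n
    using monic_OPs unfolding monic_orthogonal_polys_def by blast+
  have orth: "m \<noteq> n \<Longrightarrow> (\<integral>x. poly (P m) x * poly (P n) x \<partial>\<mu>) = 0" for m n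
    using monic_OPs by (simp add: monic_orthogonal_polys_def)
  have P0: "P 0 = 1"
    using monic[of 0] by (metis degree_eq_zeroE lead_coeff_pCons(2) one_pCons)
  \<comment> \<open>The norm of \<open>P n\<close>, as \<open>norm_P\<close> confirms; dividing by
    it makes the recursion symmetric.\<close>
  define A where "A n = (\<Prod>k\<in>{1..n}. a k)" for n
  have A_pos: "A n > 0" for n unfolding A_def using a_pos by (intro prod_pos) auto
  have A_Suc: "A (Suc n) = A n * a (Suc n)" for n by (simp add: A_def)
  define p where "p n = smult (1 / A n) (P n)" for n
  have p_rec: "[:0, 1:] * p n = smult (a (Suc n)) (p (Suc n)) + smult (b (Suc n)) (p n)
                  + (if n = 0 then 0 else smult (a n) (p (n - 1)))" for n
  proof -
    have 1: "smult (1 / A n) (P (Suc n)) = smult (a (Suc n)) (p (Suc n))"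
      using a_pos[of "Suc n"] A_pos[of n] by (simp add: p_def A_Suc)
    have 2: "smult (1 / A n) (smult ((a n)\<^sup>2) (P (n - 1))) = smult (a n) (p (n - 1))" if "n > 0"
      using that a_pos[of n] A_Suc[of "n - 1"] by (simp add: p_def power2_eq_square)
    have "[:0, 1:] * p n = smult (1 / A n) ([:0, 1:] * P n)" by (simp add: p_def)
    also have "\<dots> = smult (1 / A n) (P (Suc n)) + smult (b (Suc n)) (p n)
        + (if n = 0 then 0 else smult (1 / A n) (smult ((a n)\<^sup>2) (P (n - 1))))"
      unfolding rec by (simp add: p_def smult_add_right mult.commute)
    finally show ?thesis using 1 2 by (cases "n = 0") auto
  qed
  interpret jacobi_polys p a b
    using P0 a_pos decay p_rec by unfold_locales (auto simp: p_def A_def)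
  obtain R where R: "\<And>x. x \<in> measure_support \<mu> \<Longrightarrow> \<bar>x\<bar> \<le> R"
    using bounded_support by (auto simp: bounded_iff)
  have AE_R: "AE x in \<mu>. \<bar>x\<bar> \<le> R"
    using AE_in_measure_support[OF borel_sets] by eventually_elim (rule R)
  note int = integrable_poly[OF prob borel_sets AE_R]
  \<comment> \<open>The integral of x P_n P_(n+1) is evaluated twice: expanding x P_n leaves the
    square of P_(n+1), expanding x P_(n+1) leaves a_(n+1)^2 times the square of P_n.\<close>
  have norm_P: "(\<integral>x. poly (P n) x * poly (P n) x \<partial>\<mu>) = (A n)\<^sup>2" for n
  proof (induction n)
    case 0
    then show ?case by (simp add: P0 A_def prob_space)
  next
    case (Suc n)
    define I where "I f = (\<integral>x. poly f x \<partial>\<mu>)" for f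
    have add: "I (f + g) = I f + I g" for f g
      using Bochner_Integration.integral_add[OF int[of f] int[of g]] by (simp add: I_def)
    have sm: "I (smult c f) = c * I f" for c f by (simp add: I_def)
    have or: "I (P i * P j) = 0" if "i \<noteq> j" for i j using orth[OF that] by (simp add: I_def)
    have "P (Suc n) * ([:0, 1:] * P n) = P (Suc n) * P (Suc n) + smult (b (Suc n)) (P (Suc n) * P n)
        + (if n = 0 then 0 else smult ((a n)\<^sup>2) (P (Suc n) * P (n - 1)))"
      unfolding rec by (cases "n = 0") (simp_all add: distrib_left)
    then have "I (P (Suc n) * ([:0, 1:] * P n)) = I (P (Suc n) * P (Suc n) + smult (b (Suc n)) (P (Suc n) * P n)
        + (if n = 0 then 0 else smult ((a n)\<^sup>2) (P (Suc n) * P (n - 1))))"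
      by (simp only:)
    also have "\<dots> = I (P (Suc n) * P (Suc n))"
      unfolding add sm by (simp add: or sm I_def[of 0])
    finally have 1: "I (P (Suc n) * ([:0, 1:] * P n)) = I (P (Suc n) * P (Suc n))" .
    have "([:0, 1:] * P (Suc n)) * P n = P (Suc (Suc n)) * P n + smult (b (Suc (Suc n))) (P (Suc n) * P n)
        + smult ((a (Suc n))\<^sup>2) (P n * P n)"
      unfolding rec by (simp add: distrib_right)
    then have "I (([:0, 1:] * P (Suc n)) * P n) = I (P (Suc (Suc n)) * P n + smult (b (Suc (Suc n))) (P (Suc n) * P n)
        + smult ((a (Suc n))\<^sup>2) (P n * P n))"
      by (simp only:)
    also have "\<dots> = (a (Suc n))\<^sup>2 * I (P n * P n)"
      unfolding add sm by (simp add: or)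
    finally have "I (([:0, 1:] * P (Suc n)) * P n) = (a (Suc n))\<^sup>2 * (A n)\<^sup>2" using Suc by (simp add: I_def)
    moreover have "P (Suc n) * ([:0, 1:] * P n) = ([:0, 1:] * P (Suc n)) * P n" by simp
    ultimately have "I (P (Suc n) * P (Suc n)) = (a (Suc n))\<^sup>2 * (A n)\<^sup>2" using 1 by simp
    then show ?case by (simp add: I_def A_Suc power_mult_distrib mult.commute)
  qed
  interpret jacobi_measure p a b \<mu> R
  proof
    fix m n
    have "(\<integral>x. q x m * q x n \<partial>\<mu>) = (\<integral>x. (1 / A m * (1 / A n)) * (poly (P m) x * poly (P n) x) \<partial>\<mu>)"
      by (simp add: q_def p_def)
    also have "\<dots> = (1 / A m * (1 / A n)) * (\<integral>x. poly (P m) x * poly (P n) x \<partial>\<mu>)"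
      by (rule integral_mult_right_zero)
    also have "\<dots> = (if m = n then 1 else 0)"
      using orth[of m n] norm_P[of n] A_pos[of n] by (simp add: power2_eq_square)
    finally show "(\<integral>x. q x m * q x n \<partial>\<mu>) = (if m = n then 1 else 0)" .
  qed (use borel_sets AE_R in auto)
  have exterior: "exterior_mass_points \<mu> = {x \<in> l2_points. x \<notin> {-2..2}}"
    unfolding exterior_mass_points_def mass_point_iff_l2 by blast
  have Pp: "poly (P n) x = 0 \<longleftrightarrow> poly (p n) x = 0" for n x using A_pos[of n] by (simp add: p_def)
  have za: "zero_angles (P n) = zero_angles (p n)" for n
    by (rule zero_angles_cong) (rule Pp)
  have "\<forall>\<^sub>F n in sequentially. n - J \<ge> 2"
    by (rule eventually_sequentiallyI[of "J + 2"]) simp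
  then show ?thesis
    using finite_exterior_l2_points zero_structure zero_angles_clock[of "\<lambda>n. n - J"]
    unfolding J exterior Pp za by blast
qed

end
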